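(* Let $\Gamma$ be the $3$-regular tree with graph distance $d$, and $\Sigma=[3-2\sqrt2,3+2\sqrt2]=\sigma(-\Delta_\Gamma)$. With $P_\lambda$, $m$ and $b(\lambda)$ as in the context, for every $f\in\ell^2(\Gamma)$ the modified mean $$\langle P_\lambda f,P_\lambda f\rangle_M=\lim_{N\to\infty}\frac1N\sum_{d(x,x_0)\le N}|P_\lambda f(x)|^2$$ exists for $m$-a.e. $\lambda\in\Sigma$, and $$\|f\|^2_{\ell^2(\Gamma)}=\int_\Sigma\langle P_\lambda f,P_\lambda f\rangle_M\,12\,b(\lambda)^{-1}\,dm(\lambda).$$
   Context: $\Delta_\Gamma f(x)=\sum_{y\sim x}(f(y)-f(x))$; $\ell^2$ is with respect to counting measure on vertices; $x_0\in\Gamma$ is any base point. For $z\in\mathbb C$ with $2^{2z-1}\ne1$, $c(z)=\frac13\,\frac{2^{1-z}-2^{z-1}}{2^{-z}-2^{z-1}}$ and $\varphi_z(n)=c(z)2^{-nz}+c(1-z)2^{-n(1-z)}$. For $0<t<\frac{\pi}{\log2}$ put $\lambda=\lambda(t)=3-2\sqrt2\cos(t\log2)$, a bijection onto the interior of $\Sigma$. $m$ is the image under $t\mapsto\lambda(t)$ of the measure $\frac{\log2}{3\pi}|c(\frac12+it)|^{-2}dt$ on $[0,\frac\pi{\log2}]$. $b(\lambda)=8\,\frac{-\lambda^2+6\lambda}{-\lambda^2+6\lambda-1}=8+\frac1{\sin^2(t\log2)}$. For finitely supported $f$, $P_\lambda f(x)=\sum_{y}\varphi_{\frac12+it}(d(x,y))f(y)$.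 For these, $f=\int_\Sigma P_\lambda f\,dm(\lambda)$ is the spectral resolution of $-\Delta_\Gamma$. For general $f\in\ell^2(\Gamma)$, $P_\lambda f(x)$ is defined for $m$-a.e. $\lambda$ as the density determined by $(E_If)(x)=\int_IP_\lambda f(x)\,dm(\lambda)$ for all Borel $I\subset\Sigma$ and all $x\in\Gamma$, where $E_I$ is the spectral projection of $-\Delta_\Gamma$. *)

theory Defs
  imports "HOL-Analysis.Analysis"
begin

section \<open>Regular trees\<close>

text \<open>A simple graph is a symmetric irreflexive relation; its vertex set is the whole type.\<close>

definition is_cycle :: "('v \<Rightarrow> 'v \<Rightarrow> bool) \<Rightarrow> 'v list \<Rightarrow> bool" where
  "is_cycle adj p \<longleftrightarrow>
     3 \<le> length p \<and> distinct p \<and> successively adj p \<and> adj (last p) (hd p)"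

definition regular_tree :: "nat \<Rightarrow> ('v \<Rightarrow> 'v \<Rightarrow> bool) \<Rightarrow> bool" where
  "regular_tree k adj \<longleftrightarrow>
     symp adj \<and> irreflp adj \<and>
     (\<forall>x y. adj\<^sup>*\<^sup>* x y) \<and> (\<nexists>p. is_cycle adj p) \<and>
     (\<forall>x. finite {y. adj x y} \<and> card {y. adj x y} = k)"

text \<open>\<open>(adj ^^ n) x y\<close> says that there is a walk of length \<open>n\<close> from \<open>x\<close> to \<open>y\<close>.\<close>

definition gdist :: "('v \<Rightarrow> 'v \<Rightarrow> bool) \<Rightarrow> 'v \<Rightarrow> 'v \<Rightarrow> nat" where
  "gdist adj x y = (LEAST n. (adj ^^ n) x y)"

definition graph_laplacian :: "('v \<Rightarrow> 'v \<Rightarrow> bool) \<Rightarrow> ('v \<Rightarrow> complex) \<Rightarrow> 'v \<Rightarrow> complex" where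
  "graph_laplacian adj f x = (\<Sum>y | adj x y. f y - f x)"

definition neg_laplacian :: "('v \<Rightarrow> 'v \<Rightarrow> bool) \<Rightarrow> ('v \<Rightarrow> complex) \<Rightarrow> 'v \<Rightarrow> complex" where
  "neg_laplacian adj f x = - graph_laplacian adj f x"


section \<open>The Hilbert space of square-summable functions and spectral resolutions\<close>

definition l2 :: "('v \<Rightarrow> complex) set" where
  "l2 = {f. (\<lambda>x. (cmod (f x))\<^sup>2) summable_on UNIV}"

definition l2_norm :: "('v \<Rightarrow> complex) \<Rightarrow> real" where
  "l2_norm f = sqrt (\<Sum>\<^sub>\<infinity>x. (cmod (f x))\<^sup>2)"

definition l2_inner :: "('v \<Rightarrow> complex) \<Rightarrow> ('v \<Rightarrow> complex) \<Rightarrow> complex" where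
  "l2_inner f g = (\<Sum>\<^sub>\<infinity>x. f x * cnj (g x))"

text \<open>Projection-valued measures on the Borel subsets of the real line; countable additivity
  is in the strong operator topology, and implies \<open>E {} f = 0\<close>.\<close>

definition projection_valued_measure ::
    "(real set \<Rightarrow> ('v \<Rightarrow> complex) \<Rightarrow> 'v \<Rightarrow> complex) \<Rightarrow> bool" where
  "projection_valued_measure E \<longleftrightarrow>
     (\<forall>I\<in>sets borel. \<forall>f\<in>l2. E I f \<in> l2) \<and>
     (\<forall>I\<in>sets borel. \<forall>f\<in>l2. \<forall>g\<in>l2. \<forall>a b.
        E I (\<lambda>x. a * f x + b * g x) = (\<lambda>x. a * E I f x + b * E I g x)) \<and>
     (\<forall>I\<in>sets borel. \<forall>f\<in>l2. \<forall>g\<in>l2. l2_inner (E I f) g = l2_inner f (E I g)) \<and>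
     (\<forall>I\<in>sets borel. \<forall>J\<in>sets borel. \<forall>f\<in>l2. E I (E J f) = E (I \<inter> J) f) \<and>
     (\<forall>f\<in>l2. E UNIV f = f) \<and>
     (\<forall>A :: nat \<Rightarrow> real set. range A \<subseteq> sets borel \<longrightarrow> disjoint_family A \<longrightarrow>
        (\<forall>f\<in>l2. (\<lambda>N. l2_norm (\<lambda>x. (\<Sum>n<N. E (A n) f x) - E (\<Union>n. A n) f x))
                   \<longlonglongrightarrow> 0))"

text \<open>The scalar spectral measure \<open>I \<mapsto> \<langle>E\<^sub>I f, f\<rangle> = \<parallel>E\<^sub>I f\<parallel>\<^sup>2\<close>.\<close>

definition scalar_spectral_measure ::
    "(real set \<Rightarrow> ('v \<Rightarrow> complex) \<Rightarrow> 'v \<Rightarrow> complex) \<Rightarrow> ('v \<Rightarrow> complex) \<Rightarrow> real measure" where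
  "scalar_spectral_measure E f =
     measure_of UNIV (sets borel) (\<lambda>I. ennreal ((l2_norm (E I f))\<^sup>2))"

text \<open>\<open>E\<close> is the spectral resolution of the everywhere defined operator \<open>A\<close>, that is
  \<open>A = \<integral> \<lambda> dE(\<lambda>)\<close>. The first conjunct says that the domain of this integral
  is the whole space; the quadratic form determines the operator by polarization. By the
  spectral theorem, such an \<open>E\<close> exists for every bounded self-adjoint \<open>A\<close>, and its values
  on Borel sets and square-summable functions are unique.\<close>

definition spectral_resolution ::
    "(('v \<Rightarrow> complex) \<Rightarrow> 'v \<Rightarrow> complex) \<Rightarrow>
     (real set \<Rightarrow> ('v \<Rightarrow> complex) \<Rightarrow> 'v \<Rightarrow> complex) \<Rightarrow> bool" where
  "spectral_resolution A E \<longleftrightarrow>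
     projection_valued_measure E \<and>
     (\<forall>f\<in>l2. integrable (scalar_spectral_measure E f) (\<lambda>s. s\<^sup>2) \<and>
        l2_inner (A f) f = complex_of_real (\<integral>s. s \<partial>scalar_spectral_measure E f))"


section \<open>Spherical functions and the Plancherel measure\<close>

definition c_fun :: "complex \<Rightarrow> complex" where
  "c_fun z = 1 / 3 * ((2 powr (1 - z) - 2 powr (z - 1)) / (2 powr (- z) - 2 powr (z - 1)))"

definition spherical :: "complex \<Rightarrow> nat \<Rightarrow> complex" where
  "spherical z n =
     c_fun z * 2 powr (- of_nat n * z) + c_fun (1 - z) * 2 powr (- of_nat n * (1 - z))"

definition Sigma_spec :: "real set" where
  "Sigma_spec = {3 - 2 * sqrt 2 .. 3 + 2 * sqrt 2}"

definition lam :: "real \<Rightarrow> real" where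
  "lam t = 3 - 2 * sqrt 2 * cos (t * ln 2)"

text \<open>The inverse of \<open>lam\<close>, meaningful on the interior of \<open>Sigma_spec\<close>.\<close>

definition lam_inv :: "real \<Rightarrow> real" where
  "lam_inv = the_inv_into {0<..<pi / ln 2} lam"

definition crit :: "real \<Rightarrow> complex" where
  "crit t = 1 / 2 + \<i> * of_real t"

definition plancherel :: "real measure" where
  "plancherel =
     distr (density lborel (\<lambda>t. indicator {0..pi / ln 2} t *
              ennreal (ln 2 / (3 * pi) * inverse ((cmod (c_fun (crit t)))\<^sup>2)))) borel lam"

definition b_fun :: "real \<Rightarrow> real" where
  "b_fun s = 8 * ((- s\<^sup>2 + 6 * s) / (- s\<^sup>2 + 6 * s - 1))"


section \<open>The spectral components of a function\<close>

definition is_spectral_density ::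
    "(real set \<Rightarrow> ('v \<Rightarrow> complex) \<Rightarrow> 'v \<Rightarrow> complex) \<Rightarrow> ('v \<Rightarrow> complex) \<Rightarrow>
     (real \<Rightarrow> 'v \<Rightarrow> complex) \<Rightarrow> bool" where
  "is_spectral_density E f g \<longleftrightarrow>
     (\<forall>x. set_integrable plancherel Sigma_spec (\<lambda>s. g s x) \<and>
        (\<forall>I\<in>sets borel. I \<subseteq> Sigma_spec \<longrightarrow>
           E I f x = (LINT s:I|plancherel. g s x)))"

text \<open>For finitely supported \<open>f\<close> the component is given by the spherical functions. For other
  \<open>f\<close> it is a density, unique up to a \<open>plancherel\<close>-null set when the vertex type is countable;
  the choice operator picks a version.\<close>

definition spec_comp ::
    "('v \<Rightarrow> 'v \<Rightarrow> bool) \<Rightarrow> (real set \<Rightarrow> ('v \<Rightarrow> complex) \<Rightarrow> 'v \<Rightarrow> complex) \<Rightarrow>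
     real \<Rightarrow> ('v \<Rightarrow> complex) \<Rightarrow> 'v \<Rightarrow> complex" where
  "spec_comp adj E s f x =
     (if finite {y. f y \<noteq> 0}
      then \<Sum>y | f y \<noteq> 0. spherical (crit (lam_inv s)) (gdist adj x y) * f y
      else (SOME g. is_spectral_density E f g) s x)"


section \<open>The modified mean\<close>

definition ball_average :: "('v \<Rightarrow> 'v \<Rightarrow> bool) \<Rightarrow> 'v \<Rightarrow> ('v \<Rightarrow> complex) \<Rightarrow> nat \<Rightarrow> real" where
  "ball_average adj x0 h N = 1 / real N * (\<Sum>x | gdist adj x x0 \<le> N. (cmod (h x))\<^sup>2)"

definition modified_mean :: "('v \<Rightarrow> 'v \<Rightarrow> bool) \<Rightarrow> 'v \<Rightarrow> ('v \<Rightarrow> complex) \<Rightarrow> real" where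
  "modified_mean adj x0 h = lim (ball_average adj x0 h)"

end

theory Submission
  imports Defs "HOL-Real_Asymp.Real_Asymp"
begin

text \<open>Write \<open>\<mu> = 3 - \<lambda>\<close>, so that an eigenfunction of \<open>-\<Delta>\<close> at \<open>\<lambda>\<close> is a function whose sum over the
neighbours of \<open>x\<close> is \<open>\<mu> h(x)\<close>; the interior of \<open>\<Sigma>\<close> is \<open>\<mu>\<^sup>2 < 8\<close>.

The modified mean is governed by a monotone quantity. Root the tree at \<open>r\<close>, let \<open>a n\<close> be the sum of
\<open>\<bar>h\<bar>\<^sup>2\<close> over the sphere of radius \<open>n\<close> and \<open>b n\<close> the sum of \<open>Re (h(y) cnj (h(x)))\<close> over the edges from
that sphere outwards. The eigenvalue equation implies that \<open>a (n + 1) + a n - \<mu> / 2 * b n\<close> grows,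
when \<open>n\<close> is increased by one, by the sum over the new sphere of the squared deviations of \<open>h\<close> on the
children of a vertex from its average there (\<open>energy_eq\<close>, where the root enters with weight
\<open>3 / 2\<close>). For \<open>\<mu>\<^sup>2 < 8\<close> this energy dominates
\<open>a\<close> and \<open>b\<close>, and its sum over \<open>n \<le> N\<close> is \<open>2 - \<mu>\<^sup>2 / 4\<close> times the sum of \<open>\<bar>h\<bar>\<^sup>2\<close> over the ball, up to
boundary terms. Hence the ball averages converge as soon as they are bounded, and the limit is an
explicit Hilbert norm of \<open>h\<close>, namely \<open>b(\<lambda>) / 12\<close> times the sum of \<open>\<bar>h(r)\<bar>\<^sup>2\<close> and a multiple of the
total deviation (\<open>ball_average_tendsto\<close>). Balls about different vertices give the same limit.

For this norm the spherical functions are, up to the factor \<open>b(\<lambda>) / 12\<close>, a reproducing kernel: when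
the root is \<open>x\<close>, the function \<open>t \<phi>(d(\<cdot>, x))\<close> is constant on the children of every vertex, so adding it
to \<open>h\<close> only changes the term \<open>\<bar>h(x)\<bar>\<^sup>2\<close> (\<open>has_mean_add_sph\<close>). For finitely supported \<open>f\<close> the mean of \<open>P\<^sub>\<lambda> f\<close> is therefore
\<open>b(\<lambda>) / 12\<close> times the quadratic form of \<open>f\<close> with kernel \<open>\<phi>(d(x, y))\<close>. Since \<open>\<integral> \<phi>(n) dm\<close> is \<open>1\<close>
for \<open>n = 0\<close> and \<open>0\<close> otherwise (\<open>integral_sph\<close>), integrating gives the Plancherel formula for such \<open>f\<close>.

A general \<open>f\<close> is approximated by finitely supported \<open>F k\<close> so well that \<open>P\<^sub>\<lambda> (F k)\<close> converges at every
vertex for almost every \<open>\<lambda>\<close> (\<open>components_exists\<close>); the limit is again an eigenfunction. Fatou's lemma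
bounds the integral of its mean by \<open>\<parallel>f\<parallel>\<^sup>2\<close>, and positivity of the mean of the limit minus \<open>P\<^sub>\<lambda> (F k)\<close>
gives the reverse inequality (\<open>components_parseval\<close>).

It remains to see that this limit is the density of \<open>E\<^sub>I f(x)\<close>. If \<open>f\<close> lies in the range of
\<open>E\<^bsub>(-\<infinity>, b]\<^esub>\<close>, then for a suitable \<open>c\<close> the powers of \<open>-\<Delta> - c\<close> enlarge the norm of \<open>f\<close> by at most
\<open>(b - c)^n\<close>, whereas they multiply its component at \<open>\<lambda>\<close> by \<open>(\<lambda> - c)^n\<close>; so the components vanish for
\<open>\<lambda> > b\<close>, and symmetrically for the complementary projection (\<open>components_half_line\<close>). Thus
\<open>E\<^bsub>(-\<infinity>, b]\<^esub>\<close> cuts the components of \<open>f\<close> off at \<open>b\<close>, and Dynkin's theorem passes from half lines to all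
Borel sets (\<open>E_eq_integral\<close>).\<close>

section \<open>The 3-regular tree seen from a root\<close>

locale cubic_tree =
  fixes adj :: "'v \<Rightarrow> 'v \<Rightarrow> bool"
  assumes tree: "regular_tree 3 adj"
begin

abbreviation d :: "'v \<Rightarrow> 'v \<Rightarrow> nat" where "d \<equiv> gdist adj"

abbreviation nbrs :: "'v \<Rightarrow> 'v set" where "nbrs x \<equiv> {y. adj x y}"

lemma adj_sym: "adj x y \<Longrightarrow> adj y x"
  using tree by (auto simp: regular_tree_def symp_def)

lemma adj_irrefl: "\<not> adj x x"
  using tree by (auto simp: regular_tree_def irreflp_def)

lemma finite_nbrs [simp]: "finite (nbrs x)" and card_nbrs [simp]: "card (nbrs x) = 3"
  using tree by (auto simp: regular_tree_def)

lemma no_cycle: "\<not> is_cycle adj p"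
  using tree by (auto simp: regular_tree_def)

lemma walk_sym: "(adj ^^ n) x y \<Longrightarrow> (adj ^^ n) y x"
proof (induction n arbitrary: x y)
  case (Suc n)
  then obtain z where "(adj ^^ n) x z" "adj z y" by auto
  then show ?case
    using Suc.IH adj_sym relpowp_Suc_I2 by metis
qed auto

lemma gdist_walk: "(adj ^^ d x y) x y"
proof -
  have "adj\<^sup>*\<^sup>* x y" using tree by (auto simp: regular_tree_def)
  then obtain n where "(adj ^^ n) x y" using rtranclp_imp_relpowp by metis
  then show ?thesis unfolding gdist_def by (rule LeastI)
qed

lemma gdist_le: "(adj ^^ n) x y \<Longrightarrow> d x y \<le> n"
  unfolding gdist_def by (rule Least_le)

lemma gdist_sym: "d x y = d y x"
  by (intro antisym gdist_le) (rule walk_sym, rule gdist_walk)+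

lemma gdist_self [simp]: "d x x = 0"
  using gdist_le[of 0 x x] by simp

lemma gdist_0_iff [simp]: "d x y = 0 \<longleftrightarrow> x = y"
proof
  assume "d x y = 0"
  then have "(adj ^^ 0) x y" using gdist_walk[of x y] by metis
  then show "x = y" by simp
qed simp

lemma gdist_pos_iff [simp]: "0 < d x y \<longleftrightarrow> x \<noteq> y"
  using gdist_0_iff[of x y] by linarith

lemma gdist_triangle: "d x z \<le> d x y + d y z"
  by (rule gdist_le) (use gdist_walk[of x y] gdist_walk[of y z] in \<open>unfold relpowp_add, blast\<close>)

lemma gdist_adj: "adj x y \<Longrightarrow> d x y = 1"
proof -
  assume *: "adj x y"
  then have "d x y \<le> 1" by (intro gdist_le) (auto simp: OO_def)
  moreover have "x \<noteq> y" using * adj_irrefl by blast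
  ultimately show ?thesis using gdist_0_iff[of x y] by linarith
qed

lemma gdist_adj_le: "adj x y \<Longrightarrow> d y r \<le> d x r + 1"
  using gdist_triangle[of y r x] gdist_adj[of y x] adj_sym by fastforce

lemma exists_closer: assumes "x \<noteq> r" shows "\<exists>y. adj x y \<and> Suc (d y r) = d x r"
proof -
  obtain n where n: "d x r = Suc n" using assms by (cases "d x r") auto
  then obtain y where y: "adj x y" "(adj ^^ n) y r"
    using gdist_walk[of x r] by (metis relpowp_Suc_D2)
  have "d y r \<le> n" using y gdist_le by auto
  moreover have "Suc n \<le> d y r + 1" using gdist_adj_le[of y x r] y adj_sym n by auto
  ultimately show ?thesis using y n by auto
qed

text \<open>Moving towards \<open>r\<close> from the farther endpoint until the two ends meet yields a simple path whose
inner vertices are all closer to \<open>r\<close> than that endpoint. Closing it up through a common neighbour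
of the endpoints produces the cycles that a tree excludes.\<close>

lemma path_below:
  assumes "y \<noteq> y'"
  shows "\<exists>p. 2 \<le> length p \<and> distinct p \<and> successively adj p \<and> hd p = y \<and> last p = y' \<and>
           (\<forall>v\<in>set p. v = y \<or> v = y' \<or> d v r < max (d y r) (d y' r))"
  using assms
proof (induction "d y r + d y' r" arbitrary: y y' rule: less_induct)
  case less
  have *: "\<exists>p. 2 \<le> length p \<and> distinct p \<and> successively adj p \<and> hd p = y \<and> last p = y' \<and>
           (\<forall>v\<in>set p. v = y \<or> v = y' \<or> d v r < max (d y r) (d y' r))"
    if IH: "\<And>z. d z r < d y r \<Longrightarrow> z \<noteq> y' \<Longrightarrow>
           \<exists>p. 2 \<le> length p \<and> distinct p \<and> successively adj p \<and> hd p = z \<and> last p = y' \<and>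
           (\<forall>v\<in>set p. v = z \<or> v = y' \<or> d v r < max (d z r) (d y' r))"
     and le: "d y' r \<le> d y r" and ne: "y \<noteq> y'" for y y'
  proof -
    have "y \<noteq> r" using le ne by (metis gdist_0_iff gdist_self le_zero_eq)
    then obtain z where z: "adj y z" "Suc (d z r) = d y r" using exists_closer by blast
    show ?thesis
    proof (cases "z = y'")
      case True
      then show ?thesis using z ne by (intro exI[of _ "[y, y']"]) auto
    next
      case False
      then obtain p where p: "2 \<le> length p" "distinct p" "successively adj p" "hd p = z"
          "last p = y'" "\<forall>v\<in>set p. v = z \<or> v = y' \<or> d v r < max (d z r) (d y' r)"
        using IH[of z] z by auto
      have "y \<notin> set p" using p(6) z ne le by fastforce
      moreover have "p \<noteq> []" using p(1) by auto
      moreover have "\<forall>v\<in>set p. v = y' \<or> d v r < d y r" using p(6) z(2) le by fastforce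
      ultimately show ?thesis using p z le
        by (intro exI[of _ "y # p"]) (auto simp: successively_Cons)
    qed
  qed
  \<comment> \<open>The situation is symmetric in the endpoints up to reversing the path.\<close>
  show ?case
  proof (cases "d y' r \<le> d y r")
    case True
    show ?thesis
      by (rule * ) (use less.hyps less.prems True in auto)
  next
    case False
    have "\<exists>p. 2 \<le> length p \<and> distinct p \<and> successively adj p \<and> hd p = y' \<and> last p = y \<and>
           (\<forall>v\<in>set p. v = y' \<or> v = y \<or> d v r < max (d y' r) (d y r))"
    proof (rule * )
      fix z assume "d z r < d y' r" "z \<noteq> y"
      then show "\<exists>p. 2 \<le> length p \<and> distinct p \<and> successively adj p \<and> hd p = z \<and> last p = y \<and>
           (\<forall>v\<in>set p. v = z \<or> v = y \<or> d v r < max (d z r) (d y r))"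
        using less.hyps[of z y] by (simp add: add.commute)
    qed (use False less.prems in auto)
    then obtain p where p: "2 \<le> length p" "distinct p" "successively adj p" "hd p = y'"
      "last p = y" "\<forall>v\<in>set p. v = y' \<or> v = y \<or> d v r < max (d y' r) (d y r)" by blast
    have "successively adj (rev p)"
      using p(3) adj_sym by (simp add: successively_rev) (metis (mono_tags, lifting) successively_mono)
    then show ?thesis using p
      by (intro exI[of _ "rev p"]) (auto simp: hd_rev last_rev max.commute)
  qed
qed

text \<open>This is where acyclicity enters. It excludes a second parent as well as a neighbour on the same
sphere, so a vertex other than the root has one parent and all its other neighbours are children.\<close>

lemma unique_nbr_below:
  assumes "adj x y" "adj x y'" "d y r \<le> d x r" "d y' r \<le> d x r"
  shows "y = y'"
proof (rule ccontr)
  assume "y \<noteq> y'"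
  then obtain p where p: "2 \<le> length p" "distinct p" "successively adj p" "hd p = y"
      "last p = y'" "\<forall>v\<in>set p. v = y \<or> v = y' \<or> d v r < max (d y r) (d y' r)"
    using path_below by blast
  have "x \<notin> set p" using p(6) assms adj_irrefl by fastforce
  moreover have "p \<noteq> []" using p(1) by auto
  ultimately have "is_cycle adj (x # p)"
    using p assms adj_sym by (auto simp: is_cycle_def successively_Cons)
  then show False using no_cycle by blast
qed

definition children :: "'v \<Rightarrow> 'v \<Rightarrow> 'v set" where
  "children r x = {y. adj x y \<and> d y r = Suc (d x r)}"

definition parent :: "'v \<Rightarrow> 'v \<Rightarrow> 'v" where
  "parent r x = (SOME y. adj x y \<and> Suc (d y r) = d x r)"

definition sphere :: "'v \<Rightarrow> nat \<Rightarrow> 'v set" where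
  "sphere r n = {x. d x r = n}"

lemma parent: "x \<noteq> r \<Longrightarrow> adj x (parent r x) \<and> Suc (d (parent r x) r) = d x r"
  unfolding parent_def by (rule someI_ex) (rule exists_closer)

lemma finite_children [simp]: "finite (children r x)"
  by (rule finite_subset[OF _ finite_nbrs]) (auto simp: children_def)

lemma children_root: "children r r = nbrs r"
  using gdist_adj adj_sym by (fastforce simp: children_def)

lemma nbrs_nonroot:
  assumes "x \<noteq> r"
  shows "nbrs x = insert (parent r x) (children r x)" and "parent r x \<notin> children r x"
proof -
  show "parent r x \<notin> children r x" using parent[OF assms] by (auto simp: children_def)
  show "nbrs x = insert (parent r x) (children r x)"
  proof safe
    fix y assume y: "adj x y" "y \<notin> children r x"
    have "d y r \<le> d x r" using gdist_adj_le[of x y r] y by (auto simp: children_def)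
    then show "y = parent r x"
      using unique_nbr_below[OF y(1)] parent[OF assms] by auto
  qed (use parent[OF assms] in \<open>auto simp: children_def\<close>)
qed

lemma card_children: "card (children r x) = (if x = r then 3 else 2)"
proof (cases "x = r")
  case False
  have "card (nbrs x) = Suc (card (children r x))"
    unfolding nbrs_nonroot(1)[OF False] using nbrs_nonroot(2)[OF False] by simp
  then show ?thesis using False by simp
qed (simp add: children_root)

lemma parent_child: assumes "y \<in> children r x" shows "parent r y = x"
proof -
  have "adj y x" "d x r \<le> d y r" using assms adj_sym by (auto simp: children_def)
  moreover have "y \<noteq> r" using assms by (auto simp: children_def)
  ultimately show ?thesis using unique_nbr_below[of y "parent r y" x r] parent[of y r] by auto
qed

lemma sphere_0 [simp]: "sphere r 0 = {r}"
  by (auto simp: sphere_def)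

lemma sphere_Suc: "sphere r (Suc n) = (\<Union>x\<in>sphere r n. children r x)"
proof safe
  fix y assume "y \<in> sphere r (Suc n)"
  then have y: "d y r = Suc n" "y \<noteq> r" by (auto simp: sphere_def)
  then show "y \<in> (\<Union>x\<in>sphere r n. children r x)"
    using parent[OF y(2)] adj_sym by (auto simp: sphere_def children_def intro!: bexI[of _ "parent r y"])
qed (auto simp: sphere_def children_def)

lemma finite_sphere [simp]: "finite (sphere r n)"
  by (induction n) (auto simp: sphere_Suc)

text \<open>A sphere is the disjoint union of the sets of children of the previous one, so sums over edges can
be organised by either endpoint.\<close>

lemma sum_sphere_Suc:
  "(\<Sum>y\<in>sphere r (Suc n). g y (parent r y)) = (\<Sum>x\<in>sphere r n. \<Sum>y\<in>children r x. g y x)"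
proof -
  have "children r x \<inter> children r x' = {}" if "x \<noteq> x'" for x x'
    using that parent_child by blast
  then have "(\<Sum>y\<in>sphere r (Suc n). g y (parent r y)) =
      (\<Sum>x\<in>sphere r n. \<Sum>y\<in>children r x. g y (parent r y))"
    unfolding sphere_Suc by (intro sum.UNION_disjoint) auto
  also have "\<dots> = (\<Sum>x\<in>sphere r n. \<Sum>y\<in>children r x. g y x)"
    by (intro sum.cong refl) (simp add: parent_child)
  finally show ?thesis .
qed

definition nball :: "'v \<Rightarrow> nat \<Rightarrow> 'v set" where
  "nball r n = {x. d x r \<le> n}"

lemma nball_eq: "nball r n = (\<Union>k\<le>n. sphere r k)"
  by (auto simp: nball_def sphere_def)

lemma finite_nball [simp]: "finite (nball r n)"
  by (simp add: nball_eq)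

lemma sum_nball: "(\<Sum>x\<in>nball r n. g x) = (\<Sum>k\<le>n. \<Sum>x\<in>sphere r k. g x)"
  unfolding nball_eq by (intro sum.UNION_disjoint ballI finite_sphere) (auto simp: sphere_def)

lemma nball_mono: "m \<le> n \<Longrightarrow> nball r m \<subseteq> nball r n"
  by (auto simp: nball_def)

lemma nball_shift: "nball r n \<subseteq> nball r' (n + d r r')"
proof
  fix x assume "x \<in> nball r n"
  then show "x \<in> nball r' (n + d r r')"
    using gdist_triangle[of x r' r] by (auto simp: nball_def)
qed

lemma finite_subset_nball: assumes "finite X" shows "\<exists>n. X \<subseteq> nball r n"
proof (intro exI)
  show "X \<subseteq> nball r (\<Sum>x\<in>X. d x r)"
    using assms by (auto simp: nball_def intro: member_le_sum)
qed

lemma countable_vertices: "countable (UNIV :: 'v set)"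
proof -
  have "UNIV = (\<Union>n. nball undefined n)" by (auto simp: nball_def)
  then show ?thesis
    by (metis countable_UN countable_finite countableI_type finite_nball)
qed

end

section \<open>Eigenfunctions and their means over balls\<close>

lemma cesaro_mean:
  fixes w :: "nat \<Rightarrow> real"
  assumes "w \<longlonglongrightarrow> l"
  shows "(\<lambda>N. (\<Sum>n\<le>N. w n) / real N) \<longlonglongrightarrow> l"
proof (rule LIMSEQ_I)
  fix e :: real assume e: "0 < e"
  obtain M where M: "\<And>n. n \<ge> M \<Longrightarrow> \<bar>w n - l\<bar> < e / 2"
    using LIMSEQ_D[OF assms, of "e / 2"] e by auto
  define K where "K = (\<Sum>n<M. \<bar>w n - l\<bar>) + \<bar>l\<bar> + e / 2"
  have "\<bar>(\<Sum>n\<le>N. w n) / real N - l\<bar> < e" if N: "N \<ge> M + Suc (nat \<lceil>2 * K / e\<rceil>)" for N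
  proof -
    have Npos: "real N > 0" using N by simp
    have "2 * K / e < real N" using N by linarith
    then have KN: "K < e / 2 * real N" using e by (simp add: field_simps)
    have "(\<Sum>n\<le>N. w n) - real N * l = (\<Sum>n\<le>N. w n - l) + l"
      by (simp add: sum_subtractf algebra_simps)
    also have "\<bar>\<dots>\<bar> \<le> (\<Sum>n\<le>N. \<bar>w n - l\<bar>) + \<bar>l\<bar>"
      by (intro order_trans[OF abs_triangle_ineq] add_right_mono sum_abs)
    also have "(\<Sum>n\<le>N. \<bar>w n - l\<bar>) = (\<Sum>n<M. \<bar>w n - l\<bar>) + (\<Sum>n\<in>{M..N}. \<bar>w n - l\<bar>)"
      using N by (subst sum.union_disjoint[symmetric]) (auto intro!: sum.cong)
    also have "(\<Sum>n\<in>{M..N}. \<bar>w n - l\<bar>) \<le> (\<Sum>n\<in>{M..N}. e / 2)"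
      using M by (intro sum_mono) (auto intro: less_imp_le)
    also have "\<dots> \<le> (real N + 1) * (e / 2)"
      using e by (simp add: mult_right_mono)
    finally have "\<bar>(\<Sum>n\<le>N. w n) - real N * l\<bar> \<le> K + real N * (e / 2)"
      by (simp add: K_def algebra_simps add_divide_distrib)
    also have "\<dots> < e * real N" using KN by (simp add: algebra_simps)
    finally have "\<bar>(\<Sum>n\<le>N. w n) - real N * l\<bar> / real N < e"
      using Npos by (simp add: divide_less_eq)
    moreover have "\<bar>(\<Sum>n\<le>N. w n) - real N * l\<bar> / real N = \<bar>(\<Sum>n\<le>N. w n) / real N - l\<bar>"
    proof -
      have "(\<Sum>n\<le>N. w n) / real N - l = ((\<Sum>n\<le>N. w n) - real N * l) / real N"
        using Npos by (simp add: diff_divide_distrib)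
      then show ?thesis using Npos by (simp add: abs_divide)
    qed
    ultimately show ?thesis by simp
  qed
  then show "\<exists>no. \<forall>N\<ge>no. norm ((\<Sum>n\<le>N. w n) / real N - l) < e" by auto
qed

text \<open>The sum of the squared distances of the values of \<open>h\<close> on \<open>C\<close> to their average, written without
the average.\<close>

definition sq_dev :: "'a set \<Rightarrow> ('a \<Rightarrow> complex) \<Rightarrow> real" where
  "sq_dev C h = (\<Sum>y\<in>C. (cmod (h y))\<^sup>2) - (cmod (\<Sum>y\<in>C. h y))\<^sup>2 / real (card C)"

lemma cmod_sq_add: "(cmod (z + w))\<^sup>2 = (cmod z)\<^sup>2 + (cmod w)\<^sup>2 + 2 * Re (cnj w * z)"
  unfolding cmod_power2 by (simp add: power2_eq_square algebra_simps)

lemma sq_dev_shift: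
  assumes "finite C" "C \<noteq> {}"
  shows "sq_dev C (\<lambda>y. h y + c) = sq_dev C h"
proof -
  have k: "real (card C) > 0" using assms by (simp add: card_gt_0_iff)
  have "(\<Sum>y\<in>C. (cmod (h y + c))\<^sup>2) = (\<Sum>y\<in>C. (cmod (h y))\<^sup>2) + real (card C) * (cmod c)\<^sup>2
        + 2 * Re (cnj c * (\<Sum>y\<in>C. h y))"
    by (simp add: cmod_sq_add sum.distrib sum_distrib_left)
  moreover have "(cmod (\<Sum>y\<in>C. h y + c))\<^sup>2 = (cmod (\<Sum>y\<in>C. h y))\<^sup>2 + (real (card C))\<^sup>2 * (cmod c)\<^sup>2
        + 2 * (real (card C) * Re (cnj c * (\<Sum>y\<in>C. h y)))"
    by (simp add: sum.distrib cmod_sq_add norm_mult power_mult_distrib algebra_simps)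
  ultimately show ?thesis
    using k by (simp add: sq_dev_def field_simps power2_eq_square)
qed

lemma sq_dev_nonneg: assumes "finite C" shows "sq_dev C h \<ge> 0"
proof (cases "C = {}")
  case False
  define c where "c = (\<Sum>y\<in>C. h y) / of_nat (card C)"
  have "(\<Sum>y\<in>C. h y - c) = 0"
    using assms False by (simp add: sum_subtractf c_def)
  then have "sq_dev C (\<lambda>y. h y - c) \<ge> 0"
    by (simp add: sq_dev_def sum_nonneg)
  then show ?thesis using sq_dev_shift[OF assms False, of h "- c"] by simp
qed (simp add: sq_dev_def)

text \<open>The spherical function is a polynomial in \<open>\<mu>\<close>; its recursion is the eigenvalue equation for a
function of the distance to a vertex.\<close>

fun sph :: "real \<Rightarrow> nat \<Rightarrow> real" where
  "sph \<mu> 0 = 1"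
| "sph \<mu> (Suc 0) = \<mu> / 3"
| "sph \<mu> (Suc (Suc n)) = (\<mu> * sph \<mu> (Suc n) - sph \<mu> n) / 2"

text \<open>The modified mean of the spherical function, equal to \<open>b(\<lambda>) / 12\<close>.\<close>

definition mean_const :: "real \<Rightarrow> real" where
  "mean_const \<mu> = 2 / 3 * ((9 - \<mu>\<^sup>2) / (8 - \<mu>\<^sup>2))"

context cubic_tree
begin

definition eigen :: "real \<Rightarrow> ('v \<Rightarrow> complex) \<Rightarrow> bool" where
  "eigen \<mu> h \<longleftrightarrow> (\<forall>x. (\<Sum>y\<in>nbrs x. h y) = of_real \<mu> * h x)"

lemma eigen_add: "eigen \<mu> h \<Longrightarrow> eigen \<mu> k \<Longrightarrow> eigen \<mu> (\<lambda>x. h x + k x)"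
  by (simp add: eigen_def sum.distrib algebra_simps)

lemma eigen_scale: "eigen \<mu> h \<Longrightarrow> eigen \<mu> (\<lambda>x. c * h x)"
  by (simp add: eigen_def sum_distrib_left[symmetric])

lemma eigen_zero: "eigen \<mu> (\<lambda>x. 0)"
  by (simp add: eigen_def)

lemma eigen_children:
  assumes "eigen \<mu> h" "x \<noteq> r"
  shows "(\<Sum>y\<in>children r x. h y) = of_real \<mu> * h x - h (parent r x)"
  using assms nbrs_nonroot[OF assms(2)] unfolding eigen_def
  by (metis add_diff_cancel_left' finite_children sum.insert)

lemma eigen_children_root:
  "eigen \<mu> h \<Longrightarrow> (\<Sum>y\<in>children r r. h y) = of_real \<mu> * h r"
  by (simp add: children_root eigen_def)

lemma eigen_sph: "eigen \<mu> (\<lambda>x. of_real (sph \<mu> (d x y)))"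
  unfolding eigen_def
proof
  fix x
  have ch: "(\<Sum>z\<in>children y x. complex_of_real (sph \<mu> (d z y)))
      = of_nat (card (children y x)) * of_real (sph \<mu> (Suc (d x y)))"
    by (simp add: children_def)
  show "(\<Sum>z\<in>nbrs x. complex_of_real (sph \<mu> (d z y))) = of_real \<mu> * of_real (sph \<mu> (d x y))"
  proof (cases "x = y")
    case True
    then show ?thesis using ch by (simp add: children_root card_children)
  next
    case False
    obtain n where n: "d x y = Suc n" using False by (cases "d x y") auto
    then have "d (parent y x) y = n" using parent[OF False] by simp
    then have "(\<Sum>z\<in>nbrs x. complex_of_real (sph \<mu> (d z y)))
        = of_real (sph \<mu> n) + 2 * of_real (sph \<mu> (Suc (Suc n)))"
      using nbrs_nonroot[OF False] ch n False by (simp add: card_children del: sph.simps)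
    then show ?thesis using n by (simp flip: of_real_mult of_real_add of_real_diff)
  qed
qed

definition mass :: "'v \<Rightarrow> ('v \<Rightarrow> complex) \<Rightarrow> nat \<Rightarrow> real" where
  "mass r h n = (\<Sum>x\<in>sphere r n. (cmod (h x))\<^sup>2)"

definition cross :: "'v \<Rightarrow> ('v \<Rightarrow> complex) \<Rightarrow> nat \<Rightarrow> real" where
  "cross r h n = Re (\<Sum>x\<in>sphere r n. (\<Sum>y\<in>children r x. h y) * cnj (h x))"

text \<open>Every vertex but the root has two children. In all sums over children the root, which has three,
behaves like one and a half vertices.\<close>

definition root_wt :: "nat \<Rightarrow> real" where
  "root_wt n = (if n = 0 then 3 / 2 else 1)"

definition energy :: "real \<Rightarrow> 'v \<Rightarrow> ('v \<Rightarrow> complex) \<Rightarrow> nat \<Rightarrow> real" where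
  "energy \<mu> r h n = mass r h (Suc n) + root_wt n * mass r h n - \<mu> / 2 * cross r h n"

definition total_dev :: "'v \<Rightarrow> ('v \<Rightarrow> complex) \<Rightarrow> nat \<Rightarrow> real" where
  "total_dev r h n = (\<Sum>x\<in>nball r n. sq_dev (children r x) h)"

lemma mass_nonneg: "mass r h n \<ge> 0"
  by (simp add: mass_def sum_nonneg)

lemma mass_0: "mass r h 0 = (cmod (h r))\<^sup>2"
  by (simp add: mass_def)

lemma card_children_sphere: "x \<in> sphere r n \<Longrightarrow> real (card (children r x)) = 2 * root_wt n"
  by (auto simp: card_children sphere_def root_wt_def)

lemma children_nonempty [simp]: "children r x \<noteq> {}"
  using card_children[of r x] by (metis card.empty numeral_neq_zero zero_neq_numeral)

lemma sum_parent_mass: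
  "(\<Sum>x\<in>sphere r (Suc n). (cmod (h (parent r x)))\<^sup>2) = 2 * root_wt n * mass r h n"
  by (subst sum_sphere_Suc[where g = "\<lambda>x p. (cmod (h p))\<^sup>2"])
     (simp add: mass_def sum_distrib_left card_children_sphere)

lemma sum_parent_cross:
  "Re (\<Sum>x\<in>sphere r (Suc n). cnj (h (parent r x)) * h x) = cross r h n"
  by (subst sum_sphere_Suc[where g = "\<lambda>x p. cnj (h p) * h x"])
     (simp add: cross_def sum_distrib_left mult.commute)

lemma cross_0: "eigen \<mu> h \<Longrightarrow> cross r h 0 = \<mu> * mass r h 0"
  by (simp add: cross_def mass_def eigen_children_root)
     (unfold cmod_power2, simp add: power2_eq_square algebra_simps)

lemma sphere_Suc_ne: "x \<in> sphere r (Suc n) \<Longrightarrow> x \<noteq> r"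
  by (auto simp: sphere_def)

text \<open>Multiply the eigenvalue equation by \<open>cnj (h x)\<close> and sum over a sphere: the edges at a sphere go
either outwards or inwards.\<close>

lemma cross_Suc:
  assumes "eigen \<mu> h"
  shows "cross r h (Suc n) + cross r h n = \<mu> * mass r h (Suc n)"
proof -
  have "Re ((\<Sum>y\<in>children r x. h y) * cnj (h x))
      = \<mu> * (cmod (h x))\<^sup>2 - Re (cnj (h (parent r x)) * h x)" if "x \<in> sphere r (Suc n)" for x
    unfolding eigen_children[OF assms sphere_Suc_ne[OF that]] cmod_power2
    by (simp add: power2_eq_square algebra_simps)
  then have "cross r h (Suc n) = \<mu> * mass r h (Suc n) - cross r h n"
    unfolding sum_parent_cross[where n = n, symmetric] cross_def[of _ _ "Suc n"] mass_def Re_sum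
      sum_distrib_left sum_subtractf[symmetric]
    by (intro sum.cong refl) blast
  then show ?thesis by simp
qed

lemma mass_children:
  "mass r h (Suc n) = (\<Sum>x\<in>sphere r n. sq_dev (children r x) h)
     + (\<Sum>x\<in>sphere r n. (cmod (\<Sum>y\<in>children r x. h y))\<^sup>2) / (2 * root_wt n)"
proof -
  have "mass r h (Suc n) = (\<Sum>x\<in>sphere r n. \<Sum>y\<in>children r x. (cmod (h y))\<^sup>2)"
    unfolding mass_def by (rule sum_sphere_Suc[where g = "\<lambda>x p. (cmod (h x))\<^sup>2"])
  also have "\<dots> = (\<Sum>x\<in>sphere r n. sq_dev (children r x) h
       + (cmod (\<Sum>y\<in>children r x. h y))\<^sup>2 / (2 * root_wt n))"
    by (intro sum.cong refl) (simp add: sq_dev_def card_children_sphere)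
  finally show ?thesis by (simp add: sum.distrib sum_divide_distrib)
qed

lemma sum_children_sq:
  assumes "eigen \<mu> h"
  shows "(\<Sum>x\<in>sphere r (Suc n). (cmod (\<Sum>y\<in>children r x. h y))\<^sup>2)
       = \<mu>\<^sup>2 * mass r h (Suc n) - 2 * \<mu> * cross r h n + 2 * root_wt n * mass r h n"
proof -
  have "(cmod (\<Sum>y\<in>children r x. h y))\<^sup>2 = \<mu>\<^sup>2 * (cmod (h x))\<^sup>2
       - 2 * \<mu> * Re (cnj (h (parent r x)) * h x) + (cmod (h (parent r x)))\<^sup>2"
    if "x \<in> sphere r (Suc n)" for x
    unfolding eigen_children[OF assms sphere_Suc_ne[OF that]] cmod_power2
    by (simp add: power2_eq_square algebra_simps)
  then show ?thesis
    unfolding sum_parent_cross[where n = n, symmetric] sum_parent_mass[symmetric]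
    unfolding mass_def Re_sum sum_distrib_left sum_subtractf[symmetric] sum.distrib[symmetric]
    by (intro sum.cong refl) blast
qed

text \<open>The masses of the next sphere consist of deviations and of squared sums over children; the
eigenvalue equation expresses the latter through the two previous spheres, and in the increment of
the energy everything but the deviations cancels.\<close>

lemma energy_eq:
  assumes "eigen \<mu> h"
  shows "energy \<mu> r h n = (9 - \<mu>\<^sup>2) / 6 * (cmod (h r))\<^sup>2 + total_dev r h n"
proof (induction n)
  case 0
  have "(cmod (of_real \<mu> * h r))\<^sup>2 = \<mu>\<^sup>2 * (cmod (h r))\<^sup>2"
    by (simp add: norm_mult power_mult_distrib)
  then have "mass r h (Suc 0) = sq_dev (children r r) h + \<mu>\<^sup>2 * (cmod (h r))\<^sup>2 / 3"
    using mass_children[of r h 0] eigen_children_root[OF assms, of r] by (simp add: root_wt_def)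
  then show ?case
    by (simp add: energy_def cross_0[OF assms] mass_0 total_dev_def sum_nball root_wt_def
          power2_eq_square algebra_simps diff_divide_distrib)
next
  case (Suc n)
  have "mass r h (Suc (Suc n)) = (\<Sum>x\<in>sphere r (Suc n). sq_dev (children r x) h)
      + (\<mu>\<^sup>2 * mass r h (Suc n) - 2 * \<mu> * cross r h n + 2 * root_wt n * mass r h n) / 2"
    using mass_children[of r h "Suc n"] sum_children_sq[OF assms, of r n] by (simp add: root_wt_def)
  moreover have "\<mu> * cross r h (Suc n) = \<mu> * (\<mu> * mass r h (Suc n) - cross r h n)"
    using arg_cong[OF cross_Suc[OF assms, of r n], of "\<lambda>c. c - cross r h n"] by simp
  ultimately have "energy \<mu> r h (Suc n) - energy \<mu> r h n
      = (\<Sum>x\<in>sphere r (Suc n). sq_dev (children r x) h)"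
    by (simp add: energy_def root_wt_def[of "Suc n"] power2_eq_square field_simps)
  moreover have "total_dev r h (Suc n) = total_dev r h n
      + (\<Sum>x\<in>sphere r (Suc n). sq_dev (children r x) h)"
    by (simp add: total_dev_def sum_nball)
  ultimately show ?case using Suc by simp
qed

lemma total_dev_mono: "incseq (total_dev r h)"
  unfolding total_dev_def
  by (intro monoI sum_mono2 nball_mono) (auto intro: sq_dev_nonneg)

lemma total_dev_nonneg: "total_dev r h n \<ge> 0"
  unfolding total_dev_def by (intro sum_nonneg sq_dev_nonneg) auto

text \<open>The weights in the inequality of arithmetic and geometric means compensate for the two edges that
leave each vertex of the inner sphere.\<close>

lemma abs_cross_le: "\<bar>cross r h n\<bar> \<le> (mass r h (Suc n) + root_wt n * mass r h n) / sqrt 2"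
proof -
  have s2: "sqrt 2 * sqrt 2 = (2::real)" by simp
  have amgm: "cmod a * cmod b \<le> ((cmod a)\<^sup>2 + (cmod b)\<^sup>2 / 2) / sqrt 2" for a b
  proof -
    have "0 \<le> (sqrt 2 * cmod a - cmod b)\<^sup>2" by simp
    also have "\<dots> = 2 * ((cmod a)\<^sup>2 + (cmod b)\<^sup>2 / 2) - 2 * sqrt 2 * (cmod a * cmod b)"
      by (simp add: power2_diff power_mult_distrib algebra_simps)
    finally show ?thesis by (simp add: field_simps)
  qed
  have "\<bar>cross r h n\<bar> \<le> cmod (\<Sum>x\<in>sphere r n. \<Sum>y\<in>children r x. h y * cnj (h x))"
    unfolding cross_def sum_distrib_right by (rule abs_Re_le_cmod)
  also have "\<dots> \<le> (\<Sum>x\<in>sphere r n. \<Sum>y\<in>children r x. cmod (h y * cnj (h x)))"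
    by (intro order_trans[OF norm_sum] sum_mono norm_sum)
  also have "\<dots> \<le> (\<Sum>x\<in>sphere r n. \<Sum>y\<in>children r x. ((cmod (h y))\<^sup>2 + (cmod (h x))\<^sup>2 / 2) / sqrt 2)"
    by (intro sum_mono) (simp add: norm_mult amgm)
  also have "\<dots> = ((\<Sum>x\<in>sphere r n. \<Sum>y\<in>children r x. (cmod (h y))\<^sup>2) + root_wt n * mass r h n) / sqrt 2"
    by (simp add: sum.distrib flip: sum_divide_distrib)
       (simp add: card_children_sphere mass_def sum_distrib_left sum_distrib_right mult_ac)
  also have "(\<Sum>x\<in>sphere r n. \<Sum>y\<in>children r x. (cmod (h y))\<^sup>2) = mass r h (Suc n)"
    unfolding mass_def by (rule sum_sphere_Suc[where g = "\<lambda>x p. (cmod (h x))\<^sup>2", symmetric])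
  finally show ?thesis .
qed

lemma root_wt_nonneg: "root_wt n \<ge> 0" by (simp add: root_wt_def)

text \<open>The bound on the cross term makes the energy equivalent to the mass of two consecutive spheres
as soon as \<open>\<bar>\<mu>\<bar> < 2 \<surd>2\<close>.\<close>

lemma energy_bounds:
  assumes "\<mu>\<^sup>2 < 8"
  shows "(1 - \<bar>\<mu>\<bar> / (2 * sqrt 2)) * (mass r h (Suc n) + root_wt n * mass r h n) \<le> energy \<mu> r h n"
    and "energy \<mu> r h n \<le> 2 * (mass r h (Suc n) + root_wt n * mass r h n)"
    and "0 < 1 - \<bar>\<mu>\<bar> / (2 * sqrt 2)"
proof -
  let ?M = "mass r h (Suc n) + root_wt n * mass r h n"
  have M: "?M \<ge> 0" using mass_nonneg root_wt_nonneg by simp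
  have "\<bar>\<mu>\<bar> < sqrt 8" using assms real_less_rsqrt[of "\<bar>\<mu>\<bar>" 8] by simp
  also have "sqrt 8 = 2 * sqrt (2::real)" using real_sqrt_mult[of 4 2] by simp
  finally have mu: "\<bar>\<mu>\<bar> < 2 * sqrt 2" .
  then show "0 < 1 - \<bar>\<mu>\<bar> / (2 * sqrt 2)" by (simp add: field_simps)
  have "\<bar>\<mu> / 2 * cross r h n\<bar> = \<bar>\<mu>\<bar> / 2 * \<bar>cross r h n\<bar>" by (simp add: abs_mult)
  also have "\<dots> \<le> \<bar>\<mu>\<bar> / 2 * (?M / sqrt 2)"
    by (intro mult_left_mono abs_cross_le) auto
  also have "\<dots> = \<bar>\<mu>\<bar> / (2 * sqrt 2) * ?M" by simp
  finally have *: "\<bar>\<mu> / 2 * cross r h n\<bar> \<le> \<bar>\<mu>\<bar> / (2 * sqrt 2) * ?M" .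
  moreover have "\<bar>\<mu>\<bar> / (2 * sqrt 2) * ?M \<le> 1 * ?M"
    using mu M by (intro mult_right_mono) (auto simp: field_simps)
  ultimately show "(1 - \<bar>\<mu>\<bar> / (2 * sqrt 2)) * ?M \<le> energy \<mu> r h n" "energy \<mu> r h n \<le> 2 * ?M"
    unfolding energy_def by (auto simp: algebra_simps abs_le_iff)
qed

text \<open>Adding up \<open>cross_Suc\<close> turns the sum of the cross terms into a sum of masses, except for one term
on the last sphere.\<close>

lemma sum_energy:
  assumes "eigen \<mu> h"
  shows "(\<Sum>n\<le>N. energy \<mu> r h n) = (2 - \<mu>\<^sup>2 / 4) * (\<Sum>n\<le>N. mass r h n)
       + mass r h (Suc N) - mass r h 0 / 2 - \<mu> / 4 * cross r h N"
proof (induction N)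
  case 0
  show ?case by (simp add: energy_def cross_0[OF assms] root_wt_def power2_eq_square algebra_simps)
next
  case (Suc N)
  have "cross r h (Suc N) = \<mu> * mass r h (Suc N) - cross r h N"
    using cross_Suc[OF assms, of r N] by simp
  then have c: "\<mu> * cross r h (Suc N) = \<mu> * (\<mu> * mass r h (Suc N) - cross r h N)" by simp
  show ?case using Suc c
    by (simp add: energy_def[of _ _ _ "Suc N"] root_wt_def power2_eq_square algebra_simps
        add_divide_distrib diff_divide_distrib)
qed

lemma ball_average_mass: "ball_average adj r h N = (\<Sum>n\<le>N. mass r h n) / real N"
  unfolding ball_average_def mass_def sum_nball[symmetric] by (simp add: nball_def)

text \<open>The energies converge, so their Cesaro means do; by \<open>sum_energy\<close> these means are the ball averages
up to terms on the last sphere, which are bounded and so vanish after division by \<open>N\<close>.\<close>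

lemma ball_average_tendsto:
  assumes "eigen \<mu> h" "\<mu>\<^sup>2 < 8" "total_dev r h \<longlonglongrightarrow> v"
  shows "ball_average adj r h \<longlonglongrightarrow> mean_const \<mu> * ((cmod (h r))\<^sup>2 + 6 / (9 - \<mu>\<^sup>2) * v)"
proof -
  define W where "W = (9 - \<mu>\<^sup>2) / 6 * (cmod (h r))\<^sup>2 + v"
  have lim: "energy \<mu> r h \<longlonglongrightarrow> W"
    unfolding energy_eq[OF assms(1), abs_def] W_def by (intro tendsto_intros assms)
  then have "Bseq (energy \<mu> r h)" by (rule convergent_imp_Bseq[OF convergentI])
  then obtain K where K: "K > 0" "\<And>n. energy \<mu> r h n \<le> K"
    by (metis Bseq_def abs_le_D1 real_norm_def)
  define q where "q = 1 - \<bar>\<mu>\<bar> / (2 * sqrt 2)"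
  have q: "q > 0" unfolding q_def by (rule energy_bounds(3)[OF assms(2)])
  have M: "mass r h (Suc n) + root_wt n * mass r h n \<le> K / q" for n
    using order_trans[OF energy_bounds(1)[OF assms(2)] K(2)] q
    by (simp add: q_def field_simps)
  have m_le: "\<bar>mass r h (Suc n)\<bar> \<le> K / q" for n
    using M[of n] mass_nonneg[of r h n] mass_nonneg[of r h "Suc n"] root_wt_nonneg[of n]
    by (smt (verit) mult_nonneg_nonneg)
  have c_le: "\<bar>cross r h n\<bar> \<le> K / q" for n
  proof -
    have "\<bar>cross r h n\<bar> \<le> (K / q) / sqrt 2"
      using abs_cross_le[of r h n] M[of n] by (meson divide_right_mono order_trans real_sqrt_ge_0_iff zero_le_numeral)
    also have "\<dots> \<le> (K / q) / 1" using K q by (intro divide_left_mono) auto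
    finally show ?thesis by simp
  qed
  have inv: "(\<lambda>N. 1 / real N) \<longlonglongrightarrow> 0" by (rule lim_1_over_n)
  have vanish: "(\<lambda>N. u N / real N) \<longlonglongrightarrow> 0" if "\<And>n. \<bar>u n\<bar> \<le> K / q" for u :: "nat \<Rightarrow> real"
  proof (rule tendsto_0_le[OF inv, of _ "K / q"])
    show "\<forall>\<^sub>F N in sequentially. norm (u N / real N) \<le> norm (1 / real N) * (K / q)"
    proof (intro always_eventually allI)
      fix N
      show "norm (u N / real N) \<le> norm (1 / real N) * (K / q)"
        using divide_right_mono[OF that[of N], of "real N"] by (simp add: field_simps)
    qed
  qed
  have c: "2 - \<mu>\<^sup>2 / 4 > 0" using assms(2) by simp
  have "(\<lambda>N. ((\<Sum>n\<le>N. energy \<mu> r h n) / real N - mass r h (Suc N) / real N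
      + mass r h 0 / 2 * (1 / real N) + \<mu> / 4 * (cross r h N / real N)) / (2 - \<mu>\<^sup>2 / 4))
      \<longlonglongrightarrow> (W - 0 + mass r h 0 / 2 * 0 + \<mu> / 4 * 0) / (2 - \<mu>\<^sup>2 / 4)"
    using c by (intro tendsto_intros cesaro_mean lim vanish inv m_le c_le) auto
  moreover have "((\<Sum>n\<le>N. energy \<mu> r h n) / real N - mass r h (Suc N) / real N
      + mass r h 0 / 2 * (1 / real N) + \<mu> / 4 * (cross r h N / real N)) / (2 - \<mu>\<^sup>2 / 4)
      = ball_average adj r h N" for N
  proof -
    have "(\<Sum>n\<le>N. energy \<mu> r h n) / real N - mass r h (Suc N) / real N
      + mass r h 0 / 2 * (1 / real N) + \<mu> / 4 * (cross r h N / real N)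
      = ((\<Sum>n\<le>N. energy \<mu> r h n) - mass r h (Suc N) + mass r h 0 / 2 + \<mu> / 4 * cross r h N) / real N"
      by (simp add: add_divide_distrib diff_divide_distrib)
    also have "\<dots> = (2 - \<mu>\<^sup>2 / 4) * (\<Sum>n\<le>N. mass r h n) / real N"
      by (simp add: sum_energy[OF assms(1)])
    finally show ?thesis using c by (simp add: ball_average_mass)
  qed
  moreover have "(W - 0 + mass r h 0 / 2 * 0 + \<mu> / 4 * 0) / (2 - \<mu>\<^sup>2 / 4)
      = mean_const \<mu> * ((cmod (h r))\<^sup>2 + 6 / (9 - \<mu>\<^sup>2) * v)"
  proof -
    have "W = (9 - \<mu>\<^sup>2) / 6 * ((cmod (h r))\<^sup>2 + 6 / (9 - \<mu>\<^sup>2) * v)"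
      using assms(2) by (simp add: W_def distrib_left)
    moreover have *: "(9 - \<mu>\<^sup>2) / 6 * X / (2 - \<mu>\<^sup>2 / 4) = mean_const \<mu> * X" for X
    proof -
      have "2 - \<mu>\<^sup>2 / 4 = (8 - \<mu>\<^sup>2) / 4" by simp
      then show ?thesis unfolding mean_const_def using assms(2) by (simp add: divide_simps)
    qed
    ultimately show ?thesis by (simp only: * diff_zero mult_zero_right add_0_right)
  qed
  ultimately show ?thesis by simp
qed

text \<open>Since the energy is monotone, its value at \<open>N\<close> is at most its average over \<open>{N..2*N}\<close>, which the
mass of a ball of radius \<open>2 * N + 1\<close> controls.\<close>

lemma total_dev_bounded:
  assumes "eigen \<mu> h" "\<mu>\<^sup>2 < 8" "\<And>N. ball_average adj r h N \<le> K"
  shows "total_dev r h N \<le> 10 * K"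
proof -
  have E0: "energy \<mu> r h n \<ge> 0" for n
    using energy_eq[OF assms(1), of r n] total_dev_nonneg[of r h n] assms(2) by simp
  have mono: "energy \<mu> r h N \<le> energy \<mu> r h n" if "N \<le> n" for n
    using energy_eq[OF assms(1)] incseqD[OF total_dev_mono that, of r h] by simp
  let ?S = "\<lambda>M. \<Sum>n\<le>M. mass r h n"
  have "real (N + 1) * energy \<mu> r h N = (\<Sum>n\<in>{N..2*N}. energy \<mu> r h N)" by simp
  also have "\<dots> \<le> (\<Sum>n\<in>{N..2*N}. energy \<mu> r h n)" by (intro sum_mono mono) auto
  also have "\<dots> \<le> (\<Sum>n\<le>2*N. energy \<mu> r h n)" by (intro sum_mono2) (auto simp: E0)
  also have "\<dots> \<le> (\<Sum>n\<le>2*N. 2 * mass r h (Suc n) + 3 * mass r h n)"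
  proof (intro sum_mono)
    fix n
    have "root_wt n * mass r h n \<le> 3 / 2 * mass r h n"
      by (intro mult_right_mono mass_nonneg) (simp add: root_wt_def)
    then show "energy \<mu> r h n \<le> 2 * mass r h (Suc n) + 3 * mass r h n"
      using energy_bounds(2)[OF assms(2), of r h n] by simp
  qed
  also have "\<dots> = 2 * (\<Sum>n\<le>2*N. mass r h (Suc n)) + 3 * ?S (2 * N)"
    by (simp add: sum.distrib sum_distrib_left)
  also have "\<dots> \<le> 2 * ?S (Suc (2 * N)) + 3 * ?S (Suc (2 * N))"
    unfolding sum.atMost_Suc_shift[of "mass r h" "2 * N"]
    using mass_nonneg[of r h 0] mass_nonneg[of r h "Suc (2 * N)"]
      sum.atMost_Suc_shift[of "mass r h" "2 * N"] sum.atMost_Suc[of "mass r h" "2 * N"]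
    by auto
  also have "\<dots> = 5 * ?S (Suc (2 * N))" by simp
  also have "?S (Suc (2 * N)) \<le> K * real (Suc (2 * N))"
    using assms(3)[of "Suc (2 * N)"] by (simp add: ball_average_mass divide_le_eq)
  finally have le: "real (N + 1) * energy \<mu> r h N \<le> 5 * (K * real (Suc (2 * N)))" by simp
  have "0 \<le> ball_average adj r h 0" by (simp add: ball_average_mass)
  then have "K \<ge> 0" using assms(3)[of 0] by simp
  then have "5 * (K * real (Suc (2 * N))) \<le> real (N + 1) * (10 * K)" by (simp add: algebra_simps)
  then have "real (N + 1) * energy \<mu> r h N \<le> real (N + 1) * (10 * K)" using le by linarith
  then have "energy \<mu> r h N \<le> 10 * K" by (simp add: mult_le_cancel_left_pos del: of_nat_add of_nat_Suc)
  moreover have "(9 - \<mu>\<^sup>2) / 6 * (cmod (h r))\<^sup>2 \<ge> 0" using assms(2) by simp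
  ultimately show ?thesis using energy_eq[OF assms(1), of r N] by linarith
qed

lemma ball_average_base:
  assumes "ball_average adj r h \<longlonglongrightarrow> l"
  shows "ball_average adj r' h \<longlonglongrightarrow> l"
proof -
  define k where "k = d r r'"
  define S where "S = (\<lambda>r N. \<Sum>x\<in>nball r N. (cmod (h x))\<^sup>2)"
  have avg: "ball_average adj r h N = S r N / real N" for r N
    by (simp add: ball_average_def S_def nball_def)
  have le1: "S r N \<le> S r' (N + k)" and le2: "S r' N \<le> S r (N + k)" for N
    unfolding S_def k_def using nball_shift[of r N r'] nball_shift[of r' N r] gdist_sym[of r r']
    by (auto intro!: sum_mono2)
  have r1: "(\<lambda>M. real M / real (M + k)) \<longlonglongrightarrow> 1"
    by real_asymp
  have r2: "(\<lambda>M. real (M + 2 * k) / real (M + k)) \<longlonglongrightarrow> 1"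
    by real_asymp
  have "(\<lambda>M. ball_average adj r' h (M + k)) \<longlonglongrightarrow> l"
  proof (rule tendsto_sandwich)
    show "(\<lambda>M. real M / real (M + k) * ball_average adj r h M) \<longlonglongrightarrow> l"
      using tendsto_mult[OF r1 assms] by simp
    show "(\<lambda>M. real (M + 2 * k) / real (M + k) * ball_average adj r h (M + 2 * k)) \<longlonglongrightarrow> l"
      using tendsto_mult[OF r2 LIMSEQ_ignore_initial_segment[OF assms]] by simp
    show "\<forall>\<^sub>F M in sequentially. real M / real (M + k) * ball_average adj r h M
        \<le> ball_average adj r' h (M + k)"
      using eventually_gt_at_top[of 0]
      by eventually_elim (use le1 in \<open>auto simp: avg intro: divide_right_mono\<close>)
    show "\<forall>\<^sub>F M in sequentially. ball_average adj r' h (M + k)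
        \<le> real (M + 2 * k) / real (M + k) * ball_average adj r h (M + 2 * k)"
      using eventually_gt_at_top[of 0]
    proof eventually_elim
      case (elim M)
      have "S r' (M + k) \<le> S r (M + 2 * k)" using le2[of "M + k"] by (simp add: mult_2 add.assoc)
      then show ?case using elim by (auto simp: avg intro!: divide_right_mono)
    qed
  qed
  then show ?thesis by (rule LIMSEQ_offset)
qed

text \<open>The mean is divided by that of a spherical function, so that \<open>\<phi>(d(\<cdot>, x))\<close> has mean \<open>1\<close>. All
vertices are admitted as centres of the balls because the reproducing property below is read off
with the centre at the vertex in question.\<close>

definition has_mean :: "real \<Rightarrow> ('v \<Rightarrow> complex) \<Rightarrow> real \<Rightarrow> bool" where
  "has_mean \<mu> h m \<longleftrightarrow> (\<forall>r. ball_average adj r h \<longlonglongrightarrow> mean_const \<mu> * m)"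

lemma has_meanI:
  assumes "eigen \<mu> h" "\<mu>\<^sup>2 < 8" "total_dev r h \<longlonglongrightarrow> v"
  shows "has_mean \<mu> h ((cmod (h r))\<^sup>2 + 6 / (9 - \<mu>\<^sup>2) * v)"
  unfolding has_mean_def using ball_average_base[OF ball_average_tendsto[OF assms]] by blast

lemma has_mean_total_dev:
  assumes "eigen \<mu> h" "\<mu>\<^sup>2 < 8" "has_mean \<mu> h m"
  obtains v where "total_dev r h \<longlonglongrightarrow> v" "m = (cmod (h r))\<^sup>2 + 6 / (9 - \<mu>\<^sup>2) * v" "v \<ge> 0"
proof -
  have lim: "ball_average adj r h \<longlonglongrightarrow> mean_const \<mu> * m" using assms(3) by (auto simp: has_mean_def)
  then obtain K where "\<And>N. ball_average adj r h N \<le> K"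
    by (metis Bseq_def abs_le_D1 convergentI convergent_imp_Bseq real_norm_def)
  then have "total_dev r h n \<le> 10 * K" for n by (intro total_dev_bounded[OF assms(1,2)]) auto
  then obtain v where v: "total_dev r h \<longlonglongrightarrow> v"
    using incseq_convergent[OF total_dev_mono] by blast
  have "mean_const \<mu> * m = mean_const \<mu> * ((cmod (h r))\<^sup>2 + 6 / (9 - \<mu>\<^sup>2) * v)"
    by (rule LIMSEQ_unique[OF lim ball_average_tendsto[OF assms(1,2) v]])
  moreover have "mean_const \<mu> \<noteq> 0" using assms(2) by (simp add: mean_const_def)
  moreover have "v \<ge> 0" by (rule LIMSEQ_le_const[OF v]) (use total_dev_nonneg in auto)
  ultimately show ?thesis using that v by auto
qed

lemma has_mean_ge:
  assumes "eigen \<mu> h" "\<mu>\<^sup>2 < 8" "has_mean \<mu> h m"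
  shows "(cmod (h x))\<^sup>2 \<le> m"
  by (rule has_mean_total_dev[OF assms, of x]) (use assms(2) in simp)

lemma has_mean_zero: "has_mean \<mu> (\<lambda>x. 0) 0"
  by (simp add: has_mean_def ball_average_def[abs_def])

text \<open>The reproducing property: with the root at \<open>x\<close> the added function is constant on the children of
each vertex, so the deviations do not see it and only \<open>\<bar>h(x)\<bar>\<^sup>2\<close> changes, to \<open>\<bar>h(x) + t\<bar>\<^sup>2\<close>.\<close>

lemma has_mean_add_sph:
  assumes "eigen \<mu> h" "\<mu>\<^sup>2 < 8" "has_mean \<mu> h m"
  shows "has_mean \<mu> (\<lambda>y. h y + of_real (sph \<mu> (d y x)) * t)
           (m + 2 * Re (cnj t * h x) + (cmod t)\<^sup>2)"
proof (rule has_mean_total_dev[OF assms, of x])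
  fix v assume v: "total_dev x h \<longlonglongrightarrow> v" "m = (cmod (h x))\<^sup>2 + 6 / (9 - \<mu>\<^sup>2) * v"
  let ?k = "\<lambda>y. h y + of_real (sph \<mu> (d y x)) * t"
  have "eigen \<mu> ?k"
    using eigen_add[OF assms(1) eigen_scale[OF eigen_sph, of \<mu> t x]] by (simp add: mult.commute)
  moreover have "sq_dev (children x z) ?k = sq_dev (children x z) h" for z
  proof -
    have "sq_dev (children x z) ?k
        = sq_dev (children x z) (\<lambda>y. h y + of_real (sph \<mu> (Suc (d z x))) * t)"
      by (simp add: sq_dev_def children_def)
    also have "\<dots> = sq_dev (children x z) h" by (rule sq_dev_shift) auto
    finally show ?thesis .
  qed
  then have "total_dev x ?k = total_dev x h" by (simp add: total_dev_def fun_eq_iff)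
  ultimately have "has_mean \<mu> ?k ((cmod (?k x))\<^sup>2 + 6 / (9 - \<mu>\<^sup>2) * v)"
    using v(1) assms(2) by (intro has_meanI) auto
  then show ?thesis by (simp add: cmod_sq_add v(2) algebra_simps)
qed

lemma has_mean_add_finite:
  assumes "finite X" "eigen \<mu> h" "\<mu>\<^sup>2 < 8" "has_mean \<mu> h m"
  shows "eigen \<mu> (\<lambda>x. h x + (\<Sum>y\<in>X. of_real (sph \<mu> (d x y)) * u y)) \<and>
     has_mean \<mu> (\<lambda>x. h x + (\<Sum>y\<in>X. of_real (sph \<mu> (d x y)) * u y))
       (m + 2 * Re (\<Sum>x\<in>X. cnj (u x) * h x)
          + Re (\<Sum>x\<in>X. \<Sum>y\<in>X. cnj (u x) * of_real (sph \<mu> (d x y)) * u y))"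
  using assms(1)
proof (induction X)
  case empty
  then show ?case using assms by simp
next
  case (insert a X)
  let ?k = "\<lambda>x. h x + (\<Sum>y\<in>X. of_real (sph \<mu> (d x y)) * u y)"
  have k: "eigen \<mu> ?k" using insert by blast
  have eq: "(\<lambda>x. h x + (\<Sum>y\<in>insert a X. of_real (sph \<mu> (d x y)) * u y))
      = (\<lambda>x. ?k x + of_real (sph \<mu> (d x a)) * u a)"
    using insert by (auto simp: fun_eq_iff)
  have e: "eigen \<mu> (\<lambda>x. ?k x + of_real (sph \<mu> (d x a)) * u a)"
    using eigen_add[OF k eigen_scale[OF eigen_sph, of \<mu> "u a" a]] by (simp add: mult.commute)
  have m: "has_mean \<mu> (\<lambda>x. ?k x + of_real (sph \<mu> (d x a)) * u a)
     (m + 2 * Re (\<Sum>x\<in>X. cnj (u x) * h x)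
          + Re (\<Sum>x\<in>X. \<Sum>y\<in>X. cnj (u x) * of_real (sph \<mu> (d x y)) * u y)
        + 2 * Re (cnj (u a) * ?k a) + (cmod (u a))\<^sup>2)"
    using insert by (intro has_mean_add_sph k assms) auto
  have "(\<Sum>x\<in>insert a X. \<Sum>y\<in>insert a X. cnj (u x) * of_real (sph \<mu> (d x y)) * u y)
      = (\<Sum>x\<in>X. \<Sum>y\<in>X. cnj (u x) * of_real (sph \<mu> (d x y)) * u y)
       + cnj (u a) * u a + (\<Sum>y\<in>X. cnj (u a) * of_real (sph \<mu> (d a y)) * u y)
       + cnj (\<Sum>y\<in>X. cnj (u a) * of_real (sph \<mu> (d a y)) * u y)"
    using insert by (simp add: sum.distrib gdist_sym[of _ a] algebra_simps)
  then have f1: "Re (\<Sum>x\<in>insert a X. \<Sum>y\<in>insert a X. cnj (u x) * of_real (sph \<mu> (d x y)) * u y)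
      = Re (\<Sum>x\<in>X. \<Sum>y\<in>X. cnj (u x) * of_real (sph \<mu> (d x y)) * u y)
       + Re (cnj (u a) * u a) + 2 * Re (\<Sum>y\<in>X. cnj (u a) * of_real (sph \<mu> (d a y)) * u y)"
    by (simp only: plus_complex.simps cnj.simps)
  have f2: "(\<Sum>y\<in>X. cnj (u a) * of_real (sph \<mu> (d a y)) * u y)
      = cnj (u a) * (\<Sum>y\<in>X. of_real (sph \<mu> (d a y)) * u y)"
    by (simp add: sum_distrib_left mult.assoc)
  have f3: "Re (cnj (u a) * u a) = (cmod (u a))\<^sup>2"
    unfolding cmod_power2 by (simp add: power2_eq_square)
  have f4: "Re (\<Sum>x\<in>insert a X. cnj (u x) * h x)
      = Re (cnj (u a) * h a) + Re (\<Sum>x\<in>X. cnj (u x) * h x)"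
    using insert by (simp del: Re_sum)
  have f5: "Re (cnj (u a) * ?k a) = Re (cnj (u a) * h a)
      + Re (cnj (u a) * (\<Sum>y\<in>X. of_real (sph \<mu> (d a y)) * u y))"
    by (simp only: distrib_left plus_complex.simps)
  have f6: "m + 2 * Re (\<Sum>x\<in>X. cnj (u x) * h x)
          + Re (\<Sum>x\<in>X. \<Sum>y\<in>X. cnj (u x) * of_real (sph \<mu> (d x y)) * u y)
        + 2 * Re (cnj (u a) * ?k a) + (cmod (u a))\<^sup>2
      = m + 2 * Re (\<Sum>x\<in>insert a X. cnj (u x) * h x)
        + Re (\<Sum>x\<in>insert a X. \<Sum>y\<in>insert a X. cnj (u x) * of_real (sph \<mu> (d x y)) * u y)"
    unfolding f5 f4 f1 f2 f3 by (simp only: distrib_left add_ac)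
  show ?case unfolding eq using e m[unfolded f6] by blast
qed

end

section \<open>Spherical functions and the Plancherel measure\<close>

lemma powr_two_crit:
  fixes z :: complex and a b \<theta> :: real
  assumes "z * of_real (ln 2) = of_real a + \<i> * of_real \<theta>"
  shows "2 powr z = of_real (exp a) * cis \<theta>"
proof -
  have "2 powr z = exp (of_real a + \<i> * of_real \<theta>)"
    using assms Ln_of_real[of 2] by (simp add: powr_def)
  then show ?thesis by (simp add: exp_add cis_conv_exp exp_of_real)
qed

lemma exp_half_ln2: "exp (ln 2 / 2) = sqrt (2::real)" "exp (- (ln 2 / 2)) = 1 / sqrt (2::real)"
proof -
  have "(exp (ln 2 / 2))\<^sup>2 = (2::real)" by (simp flip: exp_double)
  then show *: "exp (ln 2 / 2) = sqrt (2::real)" by (metis exp_ge_zero real_sqrt_unique)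
  then show "exp (- (ln 2 / 2)) = 1 / sqrt (2::real)" by (simp add: exp_minus inverse_eq_divide)
qed

lemma c_fun_crit:
  fixes t :: real
  defines "u \<equiv> cis (- (t * ln 2))"
  shows "c_fun (crit t) = (2 * u - cnj u) / (3 * (u - cnj u))"
    and "c_fun (1 - crit t) = (2 * cnj u - u) / (3 * (cnj u - u))"
proof -
  define \<theta> where "\<theta> = t * ln 2"
  have cu: "cnj u = cis \<theta>" by (simp add: u_def \<theta>_def cis_cnj)
  have u: "u = cis (- \<theta>)" by (simp add: u_def \<theta>_def)
  define w :: complex where "w = of_real (sqrt 2)"
  have w: "w * w = 2" "w \<noteq> 0" by (auto simp: w_def simp flip: of_real_mult)
  have alg: "1 / 3 * ((w * a - b / w) / (a / w - b / w)) = (2 * a - b) / (3 * (a - b))" for a b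
  proof -
    have "w * a - b / w = (2 * a - b) / w" using w by (simp add: field_simps)
    moreover have "a / w - b / w = (a - b) / w" by (simp add: diff_divide_distrib)
    ultimately show ?thesis using w by simp
  qed
  have sq: "of_real (sqrt 2) = w" "of_real (1 / sqrt 2) = 1 / w" by (auto simp: w_def)
  have p: "2 powr (1 - crit t) = w * u" "2 powr (crit t - 1) = cnj u / w"
    "2 powr (- crit t) = u / w" "2 powr (crit t) = w * cnj u"
    using powr_two_crit[of "1 - crit t" "ln 2 / 2" "- \<theta>"]
      powr_two_crit[of "crit t - 1" "- (ln 2 / 2)" "\<theta>"]
      powr_two_crit[of "- crit t" "- (ln 2 / 2)" "- \<theta>"]
      powr_two_crit[of "crit t" "ln 2 / 2" "\<theta>"]
    unfolding exp_half_ln2 sq cu u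
    by (simp_all add: crit_def \<theta>_def algebra_simps cis_cnj)
  show "c_fun (crit t) = (2 * u - cnj u) / (3 * (u - cnj u))"
    unfolding c_fun_def p alg ..
  show "c_fun (1 - crit t) = (2 * cnj u - u) / (3 * (cnj u - u))"
    using alg[of "cnj u" u] p by (simp add: c_fun_def)
qed

definition angles :: "real set" where "angles = {0<..<pi / ln 2}"

lemma angle: "t \<in> angles \<Longrightarrow> 0 < t * ln 2 \<and> t * ln 2 < pi"
  by (auto simp: angles_def field_simps)

lemma sin_angle_pos: "t \<in> angles \<Longrightarrow> 0 < sin (t * ln 2)"
  using angle[of t] by (intro sin_gt_zero) auto

lemma cis_diff_nonzero:
  "t \<in> angles \<Longrightarrow> cis (- (t * ln 2)) - cnj (cis (- (t * ln 2))) \<noteq> 0"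
  using sin_angle_pos[of t] by (simp add: complex_eq_iff)

text \<open>Both \<open>u / \<surd>2\<close> and \<open>cnj u / \<surd>2\<close> solve the characteristic equation \<open>2 w\<^sup>2 + 1 = \<mu> w\<close> of the
recursion, and the coefficients given by the c-function fit the two initial values.\<close>

lemma spherical_eq_sph:
  assumes "t \<in> angles"
  shows "spherical (crit t) n = of_real (sph (3 - lam t) n)"
proof -
  define u where "u = cis (- (t * ln 2))"
  define v where "v = cnj u"
  have uv: "u * v = 1" by (simp add: u_def v_def cis_cnj cis_mult)
  have ne: "u - v \<noteq> 0" using cis_diff_nonzero[OF assms] by (simp add: u_def v_def)
  define w :: complex where "w = of_real (sqrt 2)"
  have w: "w * w = 2" "w \<noteq> 0" by (auto simp: w_def simp flip: of_real_mult)
  have mu: "of_real (3 - lam t) = w * (u + v)"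
    by (simp add: lam_def w_def u_def v_def complex_eq_iff)
  define A where "A = (2 * u - v) / (3 * (u - v))"
  define B where "B = (2 * v - u) / (3 * (v - u))"
  have AB: "A = (2 * u - v) / 3 / (u - v)" "B = - ((2 * v - u) / 3 / (u - v))"
    using ne unfolding A_def B_def by (auto simp: divide_simps) (simp add: algebra_simps)
  have pw: "2 powr (- of_nat n * crit t) = (u / w) ^ n"
       "2 powr (- of_nat n * (1 - crit t)) = (v / w) ^ n" for n
  proof -
    have e: "exp (- (real n * ln 2 / 2)) = (1 / sqrt 2) ^ n"
      unfolding exp_half_ln2(2)[symmetric] exp_of_nat_mult[symmetric] by simp
    have cu: "cis (- (real n * (t * ln 2))) = u ^ n"
      using Complex.DeMoivre[of "- (t * ln 2)" n] by (simp add: u_def)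
    have cv: "cis (real n * (t * ln 2)) = v ^ n"
      using Complex.DeMoivre[of "t * ln 2" n] by (simp add: u_def v_def cis_cnj)
    have "2 powr (- of_nat n * crit t) = of_real (exp (- (real n * ln 2 / 2))) * cis (- (real n * (t * ln 2)))"
      by (rule powr_two_crit) (simp add: crit_def algebra_simps)
    then show "2 powr (- of_nat n * crit t) = (u / w) ^ n"
      unfolding e cu by (simp add: w_def power_divide)
    have "2 powr (- of_nat n * (1 - crit t)) = of_real (exp (- (real n * ln 2 / 2))) * cis (real n * (t * ln 2))"
      by (rule powr_two_crit) (simp add: crit_def algebra_simps)
    then show "2 powr (- of_nat n * (1 - crit t)) = (v / w) ^ n"
      unfolding e cv by (simp add: w_def power_divide)
  qed
  have sp: "spherical (crit t) n = A * (u / w) ^ n + B * (v / w) ^ n" for n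
    unfolding spherical_def pw
    using c_fun_crit[of t] by (simp add: A_def B_def u_def v_def)
  have q: "(u / w)\<^sup>2 = (w * (u + v) * (u / w) - 1) / 2" "(v / w)\<^sup>2 = (w * (u + v) * (v / w) - 1) / 2"
    using w uv by (auto simp: power2_eq_square field_simps)
  show ?thesis
  proof (induction "3 - lam t" n rule: sph.induct)
    case 1
    have "A + B = 1" using ne unfolding AB by (simp add: divide_simps)
    then show ?case by (simp add: sp)
  next
    case 2
    have AuBv: "A * u + B * v = 2 / 3 * (u + v)"
    proof -
      have "A * u + B * v = ((2 * u - v) * u - (2 * v - u) * v) / 3 / (u - v)"
        unfolding AB by (simp add: algebra_simps add_divide_distrib diff_divide_distrib)
      also have "(2 * u - v) * u - (2 * v - u) * v = 2 * (u + v) * (u - v)"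
        by (simp add: algebra_simps)
      also have "2 * (u + v) * (u - v) / 3 / (u - v) = 2 / 3 * (u + v) * (u - v) / (u - v)"
        by (simp only: divide_inverse mult_ac)
      also have "\<dots> = 2 / 3 * (u + v)" by (rule nonzero_mult_div_cancel_right[OF ne])
      finally show ?thesis .
    qed
    have "A * (u / w) + B * (v / w) = (A * u + B * v) / w" by (simp add: add_divide_distrib)
    also have "\<dots> = 2 / 3 * (u + v) / w" unfolding AuBv ..
    also have "\<dots> = w * (u + v) / 3" unfolding w(1)[symmetric] using w(2) by simp
    finally show ?case unfolding sp mu sph.simps of_real_divide by simp
  next
    case (3 n)
    have "spherical (crit t) (Suc (Suc n)) = A * (u / w) ^ n * (u / w)\<^sup>2 + B * (v / w) ^ n * (v / w)\<^sup>2"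
      unfolding sp power_Suc power2_eq_square by (simp only: mult_ac)
    also have "\<dots> = (w * (u + v) * spherical (crit t) (Suc n) - spherical (crit t) n) / 2"
      unfolding sp q power_Suc by (simp add: algebra_simps add_divide_distrib diff_divide_distrib)
    finally show ?case unfolding 3 mu[symmetric] by simp
  qed
qed

lemma inj_on_lam: "inj_on lam {0..pi / ln 2}"
proof (rule inj_onI)
  fix t t' assume t: "t \<in> {0..pi / ln 2}" "t' \<in> {0..pi / ln 2}" "lam t = lam t'"
  have "t * ln 2 = t' * ln 2"
    by (rule cos_inj_pi) (use t in \<open>auto simp: lam_def field_simps\<close>)
  then show "t = t'" by simp
qed

definition spec_interior :: "real set" where "spec_interior = {3 - 2 * sqrt 2<..<3 + 2 * sqrt 2}"

lemma spec_interior_iff: "s \<in> spec_interior \<longleftrightarrow> (3 - s)\<^sup>2 < 8"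
proof -
  have "(3 - s)\<^sup>2 < 8 \<longleftrightarrow> \<bar>3 - s\<bar> < sqrt 8"
    by (metis abs_ge_zero power2_abs real_less_lsqrt real_less_rsqrt real_sqrt_less_iff real_sqrt_abs)
  also have "sqrt 8 = 2 * sqrt (2::real)" using real_sqrt_mult[of 4 2] by simp
  finally show ?thesis by (auto simp: spec_interior_def)
qed

lemma spec_interior_subset: "spec_interior \<subseteq> Sigma_spec"
  by (auto simp: spec_interior_def Sigma_spec_def)

lemma lam_angles: "t \<in> angles \<Longrightarrow> lam t \<in> spec_interior"
proof -
  assume t: "t \<in> angles"
  have "(cos (t * ln 2))\<^sup>2 < 1"
    using sin_angle_pos[OF t] by (simp add: cos_squared_eq)
  then show ?thesis by (simp add: spec_interior_iff lam_def power_mult_distrib)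
qed

lemma lam_inv:
  assumes "s \<in> spec_interior"
  shows "lam_inv s \<in> angles" and "lam (lam_inv s) = s"
proof -
  define x where "x = (3 - s) / (2 * sqrt 2)"
  have x: "-1 < x" "x < 1" using assms by (auto simp: x_def spec_interior_def field_simps)
  have "cos (arccos x) = x" using x by simp
  then have "arccos x \<noteq> 0" "arccos x \<noteq> pi" using x by (metis cos_zero less_irrefl, metis cos_pi less_irrefl)
  then have "0 < arccos x" "arccos x < pi"
    using arccos_lbound[of x] arccos_ubound[of x] x by auto
  then have t: "arccos x / ln 2 \<in> angles" by (simp add: angles_def divide_strict_right_mono)
  moreover have "lam (arccos x / ln 2) = s" using x by (simp add: lam_def x_def)
  moreover have inj: "inj_on lam angles"
    by (rule inj_on_subset[OF inj_on_lam]) (auto simp: angles_def)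
  ultimately have "s \<in> lam ` angles" by force
  then show "lam_inv s \<in> angles" "lam (lam_inv s) = s"
    using the_inv_into_into[OF inj, of s angles] f_the_inv_into_f[OF inj, of s]
    by (auto simp: lam_inv_def angles_def)
qed

lemma spherical_lam_inv:
  "s \<in> spec_interior \<Longrightarrow> spherical (crit (lam_inv s)) n = of_real (sph (3 - s) n)"
  using spherical_eq_sph[OF lam_inv(1)] lam_inv(2) by simp

definition weight :: "real \<Rightarrow> real" where
  "weight t = ln 2 / (3 * pi) * inverse ((cmod (c_fun (crit t)))\<^sup>2)"

lemma weight_eq:
  "weight t = ln 2 / (3 * pi) * (36 * (sin (t * ln 2))\<^sup>2 / (1 + 8 * (sin (t * ln 2))\<^sup>2))"
proof -
  define \<theta> where "\<theta> = t * ln 2"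
  have "(cmod (c_fun (crit t)))\<^sup>2
      = ((cos \<theta>)\<^sup>2 + 9 * (sin \<theta>)\<^sup>2) / (9 * (4 * (sin \<theta>)\<^sup>2))"
    unfolding c_fun_crit norm_divide norm_mult power_divide power_mult_distrib cmod_power2
    by (simp add: \<theta>_def power_mult_distrib)
  also have "\<dots> = (1 + 8 * (sin \<theta>)\<^sup>2) / (36 * (sin \<theta>)\<^sup>2)"
    by (simp add: cos_squared_eq)
  finally show ?thesis by (simp add: weight_def \<theta>_def)
qed

lemma weight_nonneg: "0 \<le> weight t"
  by (simp add: weight_def)

lemma continuous_weight: "continuous_on UNIV weight"
proof -
  have "1 + 8 * (sin (t * ln 2))\<^sup>2 \<noteq> 0" for t :: real
    by (smt (verit) zero_le_power2)
  then show ?thesis unfolding weight_eq[abs_def] by (intro continuous_intros) auto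
qed

lemma weight_measurable [measurable]: "weight \<in> borel_measurable borel"
  by (rule borel_measurable_continuous_onI[OF continuous_weight])

lemma lam_measurable [measurable]: "lam \<in> borel_measurable borel"
  unfolding lam_def[abs_def] by (intro borel_measurable_continuous_onI continuous_intros)

lemma plancherel_eq:
  "plancherel = distr (density lborel (\<lambda>t. ennreal (indicator {0..pi / ln 2} t * weight t))) borel lam"
  unfolding plancherel_def weight_def[symmetric]
  by (intro arg_cong[where f = "\<lambda>M. distr M borel lam"] density_cong)
     (auto simp: indicator_def)

lemma sets_plancherel [measurable_cong, simp]: "sets plancherel = sets borel"
  by (simp add: plancherel_def)

lemma space_plancherel [simp]: "space plancherel = UNIV"
  by (simp add: plancherel_def)

lemma AE_plancherelI:
  assumes "Measurable.pred borel P" "finite Z" "\<And>t. t \<in> {0..pi / ln 2} - Z \<Longrightarrow> P (lam t)"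
  shows "AE s in plancherel. P s"
proof -
  have "AE t in lborel. t \<notin> Z"
    using assms(2) by (intro AE_not_in finite_imp_null_set_lborel)
  then have "AE t in lborel. 0 < ennreal (indicator {0..pi / ln 2} t * weight t) \<longrightarrow> P (lam t)"
    by eventually_elim (use assms(3) in \<open>auto simp: indicator_def\<close>)
  then have "AE t in density lborel (\<lambda>t. ennreal (indicator {0..pi / ln 2} t * weight t)). P (lam t)"
    by (subst AE_density) auto
  then show ?thesis
    unfolding plancherel_eq using assms(1) by (subst AE_distr_iff) (auto simp: pred_def)
qed

lemma AE_spec_interior: "AE s in plancherel. s \<in> spec_interior"
proof (rule AE_plancherelI[where Z = "{0, pi / ln 2}"])
  show "Measurable.pred borel (\<lambda>s. s \<in> spec_interior)" by (simp add: spec_interior_def)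
qed (auto intro!: lam_angles simp: angles_def)

lemma AE_neq: "AE s in plancherel. s \<noteq> a"
proof (rule AE_plancherelI[where Z = "{0..pi / ln 2} \<inter> lam -` {a}"])
  show "finite ({0..pi / ln 2} \<inter> lam -` {a})"
    using inj_on_lam by (auto intro!: finite_vimage_IntI simp: Int_commute)
qed auto

lemma integral_plancherel:
  fixes g :: "real \<Rightarrow> 'a::{banach, second_countable_topology}"
  assumes [measurable]: "g \<in> borel_measurable borel"
  shows "(LINT s|plancherel. g s) = (LINT t:{0..pi / ln 2}|lborel. weight t *\<^sub>R g (lam t))"
proof -
  have "(LINT s|plancherel. g s)
     = (LINT t|density lborel (\<lambda>t. ennreal (indicator {0..pi / ln 2} t * weight t)). g (lam t))"
    unfolding plancherel_eq by (rule integral_distr) auto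
  also have "\<dots> = (LINT t|lborel. (indicator {0..pi / ln 2} t * weight t) *\<^sub>R g (lam t))"
    by (rule integral_density) (auto simp: weight_nonneg indicator_def)
  finally show ?thesis by (simp add: set_lebesgue_integral_def)
qed

lemma finite_measure_plancherel: "finite_measure plancherel"
proof
  have cont: "continuous_on {0..pi / ln 2} weight"
    by (rule continuous_on_subset[OF continuous_weight]) auto
  have "emeasure plancherel (space plancherel)
      = (\<integral>\<^sup>+t. ennreal (indicator {0..pi / ln 2} t * weight t) \<partial>lborel)"
    by (simp add: plancherel_eq emeasure_distr emeasure_density)
  also have "\<dots> < \<infinity>"
    using borel_integrable_atLeastAtMost'[OF cont]
    unfolding set_integrable_def by (subst (asm) integrable_iff_bounded) (auto simp: weight_nonneg)
  finally show "emeasure plancherel (space plancherel) \<noteq> \<infinity>" by simp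
qed

interpretation plancherel: finite_measure plancherel
  by (rule finite_measure_plancherel)

lemma continuous_sph: "continuous_on A (\<lambda>s. sph (g s) n)" if "continuous_on A g"
  using that by (induction "0::real" n rule: sph.induct) (auto intro!: continuous_intros)

lemma sph_measurable [measurable]:
  assumes "g \<in> borel_measurable M" shows "(\<lambda>s. sph (g s) n) \<in> borel_measurable M"
  using measurable_compose[OF assms borel_measurable_continuous_onI[OF continuous_sph[OF continuous_on_id]]]
  by simp

lemma abs_sph_le: "\<bar>\<mu>\<bar> \<le> 3 \<Longrightarrow> \<bar>sph \<mu> n\<bar> \<le> 3 ^ n"
proof (induction \<mu> n rule: sph.induct)
  case (3 \<mu> n)
  have "\<bar>\<mu> * sph \<mu> (Suc n)\<bar> \<le> 3 * 3 ^ Suc n"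
    unfolding abs_mult using 3 by (intro mult_mono) auto
  then have "\<bar>\<mu> * sph \<mu> (Suc n) - sph \<mu> n\<bar> \<le> 3 * 3 ^ Suc n + 3 ^ n"
    using 3 by linarith
  then show ?case by simp
qed auto

text \<open>Up to a constant, \<open>wave k\<close> is \<open>2^(k/2)\<close> times the spherical function times the Plancherel weight.
As the real part of \<open>u^k (1 - u\<^sup>2) / (2 - u\<^sup>2)\<close> on the unit circle it has an absolutely convergent
cosine expansion with frequencies \<open>k, k + 2, \<dots>\<close>, which is why its integral vanishes for
\<open>k > 0\<close>.\<close>

definition wave :: "nat \<Rightarrow> real \<Rightarrow> real" where
  "wave k t = Re (cis (- (t * ln 2)) ^ k * (1 - (cis (- (t * ln 2)))\<^sup>2) / (2 - (cis (- (t * ln 2)))\<^sup>2))"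

lemma cis_denominator: "2 - (cis a)\<^sup>2 \<noteq> 0"
proof
  assume "2 - (cis a)\<^sup>2 = 0"
  then have "(cis a)\<^sup>2 = 2" by simp
  then have "cmod ((cis a)\<^sup>2) = 2" by simp
  then show False by (simp add: norm_power)
qed

lemma wave_recurrence: "wave (Suc (Suc k)) t = 2 * cos (t * ln 2) * wave (Suc k) t - wave k t"
proof -
  define u where "u = cis (- (t * ln 2))"
  define X where "X = (1 - u\<^sup>2) / (2 - u\<^sup>2)"
  have u: "u ^ Suc (Suc k) = of_real (2 * cos (t * ln 2)) * u ^ Suc k - u ^ k"
  proof -
    have "u * u = of_real (2 * cos (t * ln 2)) * u - 1"
      using sin_cos_squared_add[of "t * ln 2"]
      by (simp add: u_def complex_eq_iff power2_eq_square algebra_simps)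
    then have "u ^ k * (u * u) = u ^ k * (of_real (2 * cos (t * ln 2)) * u - 1)" by simp
    then show ?thesis by (simp add: algebra_simps)
  qed
  have "wave j t = Re (u ^ j * X)" for j by (simp add: wave_def u_def X_def)
  moreover have "u ^ Suc (Suc k) * X = of_real (2 * cos (t * ln 2)) * (u ^ Suc k * X) - u ^ k * X"
    unfolding u by (simp add: algebra_simps)
  moreover have "Re (of_real c * z - w) = c * Re z - Re w" for c z w by simp
  ultimately show ?thesis by presburger
qed

lemma wave_two_step:
  "2 * wave k t - wave (Suc (Suc k)) t = cos (real k * (t * ln 2)) - cos (real (Suc (Suc k)) * (t * ln 2))"
proof -
  define u where "u = cis (- (t * ln 2))"
  have "2 * wave k t - wave (Suc (Suc k)) t = Re ((2 - u\<^sup>2) * (u ^ k * (1 - u\<^sup>2) / (2 - u\<^sup>2)))"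
  proof -
    have "wave j t = Re (u ^ j * (1 - u\<^sup>2) / (2 - u\<^sup>2))" for j by (simp add: wave_def u_def)
    moreover have "2 * (u ^ k * (1 - u\<^sup>2) / (2 - u\<^sup>2)) - u ^ Suc (Suc k) * (1 - u\<^sup>2) / (2 - u\<^sup>2)
        = (2 - u\<^sup>2) * (u ^ k * (1 - u\<^sup>2) / (2 - u\<^sup>2))"
    proof -
      have "u ^ Suc (Suc k) * (1 - u\<^sup>2) / (2 - u\<^sup>2) = u\<^sup>2 * (u ^ k * (1 - u\<^sup>2) / (2 - u\<^sup>2))"
        by (simp add: power2_eq_square mult.assoc)
      then show ?thesis by (simp only: left_diff_distrib)
    qed
    moreover have "Re (2 * z) = 2 * Re z" for z by simp
    ultimately show ?thesis by (metis minus_complex.simps(1))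
  qed
  also have "(2 - u\<^sup>2) * (u ^ k * (1 - u\<^sup>2) / (2 - u\<^sup>2)) = u ^ k - u ^ Suc (Suc k)"
  proof -
    have "(2 - u\<^sup>2) * (u ^ k * (1 - u\<^sup>2) / (2 - u\<^sup>2)) = u ^ k * (1 - u\<^sup>2)"
      using cis_denominator[of "- (t * ln 2)"] by (simp add: u_def)
    then show ?thesis by (simp add: power2_eq_square algebra_simps)
  qed
  also have "Re (u ^ k - u ^ Suc (Suc k)) = cos (real k * (t * ln 2)) - cos (real (Suc (Suc k)) * (t * ln 2))"
    unfolding u_def Complex.DeMoivre by (simp del: of_nat_Suc)
  finally show ?thesis .
qed

lemma wave_0_1:
  "wave 0 t = 6 * (sin (t * ln 2))\<^sup>2 / (1 + 8 * (sin (t * ln 2))\<^sup>2)"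
  "wave (Suc 0) t = 8 * (sin (t * ln 2))\<^sup>2 * cos (t * ln 2) / (1 + 8 * (sin (t * ln 2))\<^sup>2)"
proof -
  define S where "S = sin (t * ln 2)"
  define C where "C = cos (t * ln 2)"
  have C2: "C * C = 1 - S * S"
    using sin_cos_squared_add[of "t * ln 2"] by (simp add: C_def S_def power2_eq_square)
  have u: "cis (- (t * ln 2)) = Complex C (- S)" by (simp add: complex_eq_iff C_def S_def)
  have u2: "(cis (- (t * ln 2)))\<^sup>2 = Complex (1 - 2 * (S * S)) (- 2 * C * S)"
    unfolding u using C2 by (simp add: complex_eq_iff power2_eq_square)
  have CCx: "C * (C * x) = x - S * (S * x)" for x
    using arg_cong[OF C2, of "\<lambda>z. z * x"] by (simp add: algebra_simps)
  have den: "(1 + 2 * (S * S))\<^sup>2 + (2 * C * S)\<^sup>2 = 1 + 8 * S\<^sup>2"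
    by (simp add: power2_eq_square algebra_simps C2 CCx)
  show "wave 0 t = 6 * (sin (t * ln 2))\<^sup>2 / (1 + 8 * (sin (t * ln 2))\<^sup>2)"
  proof -
    have "wave 0 t = (2 * (S * S) * (1 + 2 * (S * S)) + 2 * C * S * (2 * C * S))
        / ((1 + 2 * (S * S))\<^sup>2 + (2 * C * S)\<^sup>2)"
      unfolding wave_def u2 by (simp add: Re_divide)
    also have "2 * (S * S) * (1 + 2 * (S * S)) + 2 * C * S * (2 * C * S) = 6 * S\<^sup>2"
      by (simp add: power2_eq_square algebra_simps C2 CCx)
    finally show ?thesis unfolding den by (simp add: S_def)
  qed
  show "wave (Suc 0) t = 8 * (sin (t * ln 2))\<^sup>2 * cos (t * ln 2) / (1 + 8 * (sin (t * ln 2))\<^sup>2)"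
  proof -
    have "wave (Suc 0) t = ((C * (2 * (S * S)) + S * (2 * C * S)) * (1 + 2 * (S * S))
          + (C * (2 * C * S) - S * (2 * (S * S))) * (2 * C * S))
        / ((1 + 2 * (S * S))\<^sup>2 + (2 * C * S)\<^sup>2)"
      unfolding wave_def u2 unfolding u by (simp add: Re_divide)
    also have "(C * (2 * (S * S)) + S * (2 * C * S)) * (1 + 2 * (S * S))
          + (C * (2 * C * S) - S * (2 * (S * S))) * (2 * C * S) = 8 * S\<^sup>2 * C"
      by (simp add: power2_eq_square algebra_simps C2 CCx)
    finally show ?thesis unfolding den by (simp add: S_def C_def)
  qed
qed

lemma weight_sph:
  "weight t * sph (3 - lam t) n = 2 * ln 2 / pi * (1 / sqrt 2) ^ n * wave n t"
proof (induction "3 - lam t" n rule: sph.induct)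
  case 1
  show ?case by (simp add: weight_eq wave_0_1)
next
  case 2
  have "3 - lam t = 2 * sqrt 2 * cos (t * ln 2)" by (simp add: lam_def)
  moreover have "1 / sqrt 2 = sqrt 2 / (2::real)" by (simp add: field_simps)
  ultimately show ?case unfolding weight_eq wave_0_1 sph.simps power_Suc power_0
    by (simp only:) simp
next
  case (3 n)
  have mu: "3 - lam t = 1 / sqrt 2 * (4 * cos (t * ln 2))"
    by (simp add: lam_def field_simps)
  have r: "1 / sqrt 2 * (1 / sqrt 2) = (1 / 2 :: real)" by simp
  have "weight t * sph (3 - lam t) (Suc (Suc n))
      = ((3 - lam t) * (weight t * sph (3 - lam t) (Suc n)) - weight t * sph (3 - lam t) n) / 2"
    by (simp add: algebra_simps)
  also have "\<dots> = 2 * ln 2 / pi * (1 / sqrt 2) ^ n *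
      (1 / sqrt 2 * (1 / sqrt 2) * (2 * cos (t * ln 2) * wave (Suc n) t) - wave n t / 2)"
    unfolding 3 unfolding mu by (simp add: algebra_simps add_divide_distrib diff_divide_distrib)
  also have "\<dots> = 2 * ln 2 / pi * ((1 / sqrt 2) ^ n * (1 / sqrt 2 * (1 / sqrt 2))) * wave (Suc (Suc n)) t"
    unfolding r wave_recurrence by (simp add: algebra_simps)
  finally show ?case by (simp add: mult.assoc)
qed

lemma abs_wave_le: "\<bar>wave k t\<bar> \<le> 2"
proof -
  define u where "u = cis (- (t * ln 2))"
  have u: "cmod u = 1" by (simp add: u_def)
  have "\<bar>wave k t\<bar> \<le> cmod (u ^ k * (1 - u\<^sup>2) / (2 - u\<^sup>2))"
    unfolding wave_def u_def by (rule abs_Re_le_cmod)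
  also have "\<dots> = cmod (1 - u\<^sup>2) / cmod (2 - u\<^sup>2)"
    by (simp add: norm_mult norm_divide norm_power u)
  also have "\<dots> \<le> 2 / 1"
  proof (rule frac_le)
    show "cmod (1 - u\<^sup>2) \<le> 2"
      using norm_triangle_ineq4[of 1 "u\<^sup>2"] by (simp add: norm_power u)
    show "1 \<le> cmod (2 - u\<^sup>2)"
      using norm_triangle_ineq2[of 2 "u\<^sup>2"] by (simp add: norm_power u)
  qed auto
  finally show ?thesis by simp
qed

lemma continuous_wave: "continuous_on UNIV (wave k)"
  unfolding wave_def[abs_def] using cis_denominator
  by (auto intro!: continuous_intros)

lemma set_integrable_Icc:
  "continuous_on UNIV f \<Longrightarrow> set_integrable lborel {a..b::real} (f :: real \<Rightarrow> real)"
  by (rule borel_integrable_atLeastAtMost', rule continuous_on_subset) auto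

lemma integral_cos:
  "(LINT t:{0..pi / ln 2}|lborel. cos (real k * (t * ln 2))) = (if k = 0 then pi / ln 2 else 0)"
proof (cases "k = 0")
  case True
  then show ?thesis by (simp add: set_lebesgue_integral_def)
next
  case False
  have "(LINT t:{0..pi / ln 2}|lborel. cos (real k * (t * ln 2)))
      = sin (real k * (pi / ln 2 * ln 2)) / (real k * ln 2) - sin (real k * (0 * ln 2)) / (real k * ln 2)"
    unfolding set_lebesgue_integral_def
    by (rule integral_FTC_Icc)
       (use False in \<open>auto intro!: derivative_eq_intros continuous_intros
          simp: has_real_derivative_iff_has_vector_derivative[symmetric]\<close>)
  then show ?thesis using False by simp
qed

text \<open>Instead of expanding, use that \<open>2 wave k - wave (k + 2)\<close> is a difference of two cosines. For
\<open>k > 0\<close> both integrate to zero, so the bounded integrals satisfy \<open>I k = I (k + 2 m) / 2^m\<close> for all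
\<open>m\<close> and must vanish.\<close>

lemma integral_wave:
  "(LINT t:{0..pi / ln 2}|lborel. wave k t) = (if k = 0 then pi / (2 * ln 2) else 0)"
proof -
  define I where "I = (\<lambda>k. LINT t:{0..pi / ln 2}|lborel. wave k t)"
  have int: "set_integrable lborel {0..pi / ln 2} (wave k)" for k
    by (rule set_integrable_Icc[OF continuous_wave])
  have "2 * I k - I (Suc (Suc k)) = (LINT t:{0..pi / ln 2}|lborel. 2 * wave k t - wave (Suc (Suc k)) t)" for k
    unfolding I_def by (subst set_integral_diff) (auto intro!: set_integrable_mult_right int)
  also have "\<dots> k = (LINT t:{0..pi / ln 2}|lborel. cos (real k * (t * ln 2)))
       - (LINT t:{0..pi / ln 2}|lborel. cos (real (Suc (Suc k)) * (t * ln 2)))" for k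
    unfolding wave_two_step
    by (rule set_integral_diff) (auto intro!: set_integrable_Icc continuous_intros)
  finally have rec: "2 * I k - I (Suc (Suc k)) = (if k = 0 then pi / ln 2 else 0)" for k
    by (simp add: integral_cos del: of_nat_Suc)
  have bound: "\<bar>I k\<bar> \<le> 2 * (pi / ln 2)" for k
  proof -
    have "\<bar>I k\<bar> \<le> (LINT t:{0..pi / ln 2}|lborel. \<bar>wave k t\<bar>)"
      unfolding I_def using set_integral_norm_bound[OF int] by simp
    also have "\<dots> \<le> (LINT t:{0..pi / ln 2}|lborel. 2)"
      using int by (intro set_integral_mono set_integrable_abs) (auto intro: abs_wave_le set_integrable_Icc)
    finally show ?thesis by (simp add: set_lebesgue_integral_def mult.commute)
  qed
  have step: "I k = (1 / 2) ^ m * I (k + 2 * m)" if "k \<noteq> 0" for k m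
  proof (induction m)
    case (Suc m)
    then show ?case using rec[of "k + 2 * m"] that by simp
  qed simp
  have zero: "I k = 0" if "k \<noteq> 0" for k
  proof -
    have "(\<lambda>m. (1 / 2) ^ m * I (k + 2 * m)) \<longlonglongrightarrow> 0"
    proof (rule tendsto_0_le)
      show "(\<lambda>m. (1 / 2 :: real) ^ m) \<longlonglongrightarrow> 0" by (rule LIMSEQ_realpow_zero) auto
      show "\<forall>\<^sub>F m in sequentially. norm ((1 / 2) ^ m * I (k + 2 * m)) \<le> norm ((1 / 2 :: real) ^ m) * (2 * (pi / ln 2))"
        unfolding real_norm_def abs_mult
        using bound by (intro always_eventually allI mult_left_mono) auto
    qed
    moreover have "(\<lambda>m. (1 / 2) ^ m * I (k + 2 * m)) = (\<lambda>m. I k)" using step[OF that] by auto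
    ultimately show ?thesis by (simp add: LIMSEQ_const_iff)
  qed
  have "I 0 = pi / (2 * ln 2)" using rec[of 0] zero[of 2] by (simp add: numeral_2_eq_2)
  then show ?thesis using zero unfolding I_def by auto
qed

lemma integral_sph:
  "(LINT s|plancherel. sph (3 - s) n) = (if n = 0 then 1 else 0)"
proof -
  have "(LINT s|plancherel. sph (3 - s) n)
      = (LINT t:{0..pi / ln 2}|lborel. 2 * ln 2 / pi * (1 / sqrt 2) ^ n * wave n t)"
    by (simp add: integral_plancherel weight_sph)
  also have "\<dots> = 2 * ln 2 / pi * (1 / sqrt 2) ^ n * (LINT t:{0..pi / ln 2}|lborel. wave n t)"
    by simp
  finally show ?thesis by (simp add: integral_wave)
qed

lemma measure_plancherel_UNIV: "measure plancherel UNIV = 1"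
  using integral_sph[of 0] by simp

section \<open>Square-summable functions\<close>

lemma l2_norm_nonneg [simp]: "0 \<le> l2_norm f"
  by (simp add: l2_norm_def infsum_nonneg)

lemma l2_norm_sq: "(l2_norm f)\<^sup>2 = (\<Sum>\<^sub>\<infinity>x. (cmod (f x))\<^sup>2)"
  by (simp add: l2_norm_def infsum_nonneg)

lemma l2_scale: assumes "f \<in> l2" shows "(\<lambda>x. c * f x) \<in> l2"
  using assms by (auto simp: l2_def norm_mult power_mult_distrib intro: summable_on_cmult_right)

lemma l2_add: assumes "f \<in> l2" "g \<in> l2" shows "(\<lambda>x. f x + g x) \<in> l2"
proof -
  have "(cmod (f x + g x))\<^sup>2 \<le> 2 * (cmod (f x))\<^sup>2 + 2 * (cmod (g x))\<^sup>2" for x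
  proof -
    have "(cmod (f x + g x))\<^sup>2 \<le> (cmod (f x) + cmod (g x))\<^sup>2"
      by (intro power_mono norm_triangle_ineq) auto
    also have "\<dots> \<le> 2 * (cmod (f x))\<^sup>2 + 2 * (cmod (g x))\<^sup>2"
      using zero_le_power2[of "cmod (f x) - cmod (g x)"] by (simp add: power2_sum power2_diff)
    finally show ?thesis .
  qed
  moreover have "(\<lambda>x. 2 * (cmod (f x))\<^sup>2 + 2 * (cmod (g x))\<^sup>2) summable_on UNIV"
    using assms by (intro summable_on_add summable_on_cmult_right) (auto simp: l2_def)
  ultimately show ?thesis unfolding l2_def by (auto intro: summable_on_comparison_test)
qed

lemma l2_lincomb: "f \<in> l2 \<Longrightarrow> g \<in> l2 \<Longrightarrow> (\<lambda>x. a * f x + b * g x) \<in> l2"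
  by (intro l2_add l2_scale)

lemma l2_diff: assumes "f \<in> l2" "g \<in> l2" shows "(\<lambda>x. f x - g x) \<in> l2"
  using l2_lincomb[OF assms, of 1 "-1"] by simp

lemma l2_finite: "finite {x. f x \<noteq> 0} \<Longrightarrow> f \<in> l2"
  unfolding l2_def mem_Collect_eq
  by (rule summable_on_cong_neutral[THEN iffD1, OF _ _ _ summable_on_finite]) auto

lemma l2_zero [simp]: "(\<lambda>x. 0) \<in> l2"
  by (simp add: l2_def)

lemma l2_norm_zero [simp]: "l2_norm (\<lambda>x. 0) = 0"
  by (simp add: l2_norm_def)

lemma l2_norm_pointwise: assumes "f \<in> l2" shows "cmod (f x) \<le> l2_norm f"
proof -
  have "(cmod (f x))\<^sup>2 \<le> (\<Sum>\<^sub>\<infinity>x. (cmod (f x))\<^sup>2)"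
    using finite_sum_le_infsum[of "\<lambda>x. (cmod (f x))\<^sup>2" UNIV "{x}"] assms by (simp add: l2_def)
  then show ?thesis by (simp add: l2_norm_def real_le_rsqrt)
qed

lemma l2_norm_zero_iff: assumes "f \<in> l2" shows "l2_norm f = 0 \<longleftrightarrow> f = (\<lambda>x. 0)"
proof
  assume "l2_norm f = 0"
  then show "f = (\<lambda>x. 0)" using l2_norm_pointwise[OF assms] by (auto simp: fun_eq_iff)
qed simp

lemma l2_inner_summable:
  assumes "f \<in> l2" "g \<in> l2" shows "(\<lambda>x. norm (f x * cnj (g x))) summable_on UNIV"
proof -
  have "cmod (f x * cnj (g x)) \<le> (cmod (f x))\<^sup>2 + (cmod (g x))\<^sup>2" for x
    using zero_le_power2[of "cmod (f x) - cmod (g x)"] zero_le_power2[of "cmod (f x)"]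
      zero_le_power2[of "cmod (g x)"] unfolding norm_mult complex_mod_cnj power2_diff
    by linarith
  moreover have "(\<lambda>x. (cmod (f x))\<^sup>2 + (cmod (g x))\<^sup>2) summable_on UNIV"
    using assms by (intro summable_on_add) (auto simp: l2_def)
  ultimately show ?thesis by (auto intro: summable_on_comparison_test)
qed

lemma l2_inner_summable': "f \<in> l2 \<Longrightarrow> g \<in> l2 \<Longrightarrow> (\<lambda>x. f x * cnj (g x)) summable_on UNIV"
  by (rule Infinite_Sum.abs_summable_summable[OF l2_inner_summable])

lemma l2_inner_cnj: "l2_inner g f = cnj (l2_inner f g)"
  unfolding l2_inner_def by (simp flip: infsum_cnj add: mult.commute)

lemma l2_inner_add_left:
  assumes "f \<in> l2" "g \<in> l2" "h \<in> l2"
  shows "l2_inner (\<lambda>x. a * f x + b * g x) h = a * l2_inner f h + b * l2_inner g h"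
proof -
  have "l2_inner (\<lambda>x. a * f x + b * g x) h
      = (\<Sum>\<^sub>\<infinity>x. a * (f x * cnj (h x)) + b * (g x * cnj (h x)))"
    by (simp add: l2_inner_def algebra_simps)
  also have "\<dots> = a * l2_inner f h + b * l2_inner g h"
    using assms unfolding l2_inner_def
    by (subst infsum_add) (auto simp: infsum_cmult_right l2_inner_summable'
        intro: summable_on_cmult_right l2_inner_summable')
  finally show ?thesis .
qed

lemma l2_inner_add_right:
  assumes "f \<in> l2" "g \<in> l2" "h \<in> l2"
  shows "l2_inner h (\<lambda>x. a * f x + b * g x) = cnj a * l2_inner h f + cnj b * l2_inner h g"
  using l2_inner_add_left[OF assms, of a b] l2_inner_cnj
  by (metis complex_cnj_add complex_cnj_mult)

lemma l2_inner_self: "f \<in> l2 \<Longrightarrow> l2_inner f f = of_real ((l2_norm f)\<^sup>2)"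
  unfolding l2_inner_def l2_norm_sq complex_norm_square[symmetric]
  by (rule infsumI, rule has_sum_of_real) (simp add: l2_def)

lemma l2_norm_add_sq:
  assumes "f \<in> l2" "g \<in> l2"
  shows "(l2_norm (\<lambda>x. f x + c * g x))\<^sup>2
     = (l2_norm f)\<^sup>2 + (cmod c)\<^sup>2 * (l2_norm g)\<^sup>2 + 2 * Re (cnj c * l2_inner f g)"
proof -
  have l: "(\<lambda>x. 1 * f x + c * g x) \<in> l2" using assms by (rule l2_lincomb)
  have "complex_of_real ((l2_norm (\<lambda>x. 1 * f x + c * g x))\<^sup>2)
      = l2_inner f f + c * l2_inner g f + cnj c * l2_inner f g + c * cnj c * l2_inner g g"
    unfolding l2_inner_self[OF l, symmetric] l2_inner_add_left[OF assms l]
      l2_inner_add_right[OF assms assms(1)] l2_inner_add_right[OF assms assms(2)]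
    by (simp add: algebra_simps)
  also have "\<dots> = l2_inner f f + of_real ((cmod c)\<^sup>2) * l2_inner g g
      + (cnj c * l2_inner f g + cnj (cnj c * l2_inner f g))"
    unfolding complex_norm_square by (simp add: l2_inner_cnj[of g f])
  finally have "Re (complex_of_real ((l2_norm (\<lambda>x. 1 * f x + c * g x))\<^sup>2))
    = Re (l2_inner f f + of_real ((cmod c)\<^sup>2) * l2_inner g g
      + (cnj c * l2_inner f g + cnj (cnj c * l2_inner f g)))" by (rule arg_cong)
  then show ?thesis by (simp add: l2_inner_self assms)
qed

lemma l2_norm_scale: "f \<in> l2 \<Longrightarrow> l2_norm (\<lambda>x. c * f x) = cmod c * l2_norm f"
  unfolding l2_norm_def
  by (simp add: norm_mult power_mult_distrib infsum_cmult_right' real_sqrt_mult)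

lemma l2_cauchy_schwarz:
  assumes "f \<in> l2" "g \<in> l2"
  shows "cmod (l2_inner f g) \<le> l2_norm f * l2_norm g"
proof (cases "l2_norm g = 0")
  case True
  then have "g = (\<lambda>x. 0)" using l2_norm_zero_iff[OF assms(2)] by simp
  then show ?thesis by (simp add: l2_inner_def)
next
  case False
  define z where "z = l2_inner f g"
  define G where "G = (l2_norm g)\<^sup>2"
  have G: "G > 0" using False by (simp add: G_def)
  have "0 \<le> (l2_norm f)\<^sup>2 + (cmod (- z / of_real G))\<^sup>2 * G + 2 * Re (cnj (- z / of_real G) * z)"
    unfolding G_def z_def l2_norm_add_sq[OF assms, symmetric] by simp
  also have "Re (cnj (- z / of_real G) * z) = - (cmod z)\<^sup>2 / G"
    unfolding cmod_power2 by (simp add: power2_eq_square add_divide_distrib diff_divide_distrib)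
  also have "(cmod (- z / of_real G))\<^sup>2 * G = (cmod z)\<^sup>2 / G"
    using G by (simp add: norm_divide power_divide power2_eq_square)
  finally have "(cmod z)\<^sup>2 \<le> (l2_norm f)\<^sup>2 * G" using G by (simp add: field_simps)
  then have "(cmod z)\<^sup>2 \<le> (l2_norm f * l2_norm g)\<^sup>2" by (simp add: G_def power_mult_distrib)
  then show ?thesis unfolding z_def by (rule power2_le_imp_le) simp
qed

lemma l2_norm_triangle:
  assumes "f \<in> l2" "g \<in> l2"
  shows "l2_norm (\<lambda>x. f x + g x) \<le> l2_norm f + l2_norm g"
proof -
  have "(l2_norm (\<lambda>x. f x + 1 * g x))\<^sup>2 \<le> (l2_norm f)\<^sup>2 + (l2_norm g)\<^sup>2 + 2 * (l2_norm f * l2_norm g)"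
    unfolding l2_norm_add_sq[OF assms]
    using complex_Re_le_cmod[of "l2_inner f g"] l2_cauchy_schwarz[OF assms] by simp
  then have "(l2_norm (\<lambda>x. f x + g x))\<^sup>2 \<le> (l2_norm f + l2_norm g)\<^sup>2"
    by (simp add: power2_sum)
  then show ?thesis by (rule power2_le_imp_le) simp
qed

lemma l2_norm_diff_triangle:
  assumes "f \<in> l2" "g \<in> l2" "h \<in> l2"
  shows "l2_norm (\<lambda>x. f x - h x) \<le> l2_norm (\<lambda>x. f x - g x) + l2_norm (\<lambda>x. g x - h x)"
  using l2_norm_triangle[OF l2_diff[OF assms(1,2)] l2_diff[OF assms(2,3)]] by simp

lemma l2_norm_uminus: "l2_norm (\<lambda>x. - f x) = l2_norm f"
  by (simp add: l2_norm_def)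

lemma l2_norm_minus_commute: "l2_norm (\<lambda>x. f x - g x) = l2_norm (\<lambda>x. g x - f x)"
  by (simp add: l2_norm_def norm_minus_commute)

lemma l2_norm_diff_ge:
  assumes "f \<in> l2" "g \<in> l2"
  shows "\<bar>l2_norm f - l2_norm g\<bar> \<le> l2_norm (\<lambda>x. f x - g x)"
  using l2_norm_diff_triangle[OF assms(1,2) l2_zero] l2_norm_diff_triangle[OF assms(2,1) l2_zero]
    l2_norm_minus_commute[of f g] by simp

lemma l2_tendsto_norm:
  assumes "\<And>k. F k \<in> l2" "f \<in> l2" "(\<lambda>k. l2_norm (\<lambda>x. f x - F k x)) \<longlonglongrightarrow> 0"
  shows "(\<lambda>k. l2_norm (F k)) \<longlonglongrightarrow> l2_norm f"
  by (rule LIM_zero_cancel, rule tendsto_0_le[OF assms(3), of _ 1])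
     (use l2_norm_diff_ge[OF assms(1) assms(2)] in \<open>auto simp: l2_norm_minus_commute[of f]\<close>)

lemma l2_tendsto_pointwise:
  assumes "\<And>k. F k \<in> l2" "f \<in> l2" "(\<lambda>k. l2_norm (\<lambda>x. f x - F k x)) \<longlonglongrightarrow> 0"
  shows "(\<lambda>k. F k x) \<longlonglongrightarrow> f x"
  by (rule LIM_zero_cancel, rule tendsto_0_le[OF assms(3), of _ 1])
     (use l2_norm_pointwise[OF l2_diff[OF assms(2) assms(1)]] in \<open>auto simp: norm_minus_commute\<close>)

lemma l2_tendsto_inner:
  assumes "\<And>k. F k \<in> l2" "f \<in> l2" "g \<in> l2" "(\<lambda>k. l2_norm (\<lambda>x. f x - F k x)) \<longlonglongrightarrow> 0"
  shows "(\<lambda>k. l2_inner (F k) g) \<longlonglongrightarrow> l2_inner f g"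
proof (rule LIM_zero_cancel, rule tendsto_0_le[OF assms(4), of _ "l2_norm g"], intro always_eventually allI)
  fix k
  have "l2_inner (F k) g - l2_inner f g = l2_inner (\<lambda>x. F k x - f x) g"
    using l2_inner_add_left[OF assms(1,2,3), of 1 _ "-1"] by simp
  then show "norm (l2_inner (F k) g - l2_inner f g) \<le> norm (l2_norm (\<lambda>x. f x - F k x)) * l2_norm g"
    using l2_cauchy_schwarz[OF l2_diff[OF assms(1,2)] assms(3), of k]
    by (simp add: l2_norm_minus_commute[of f])
qed

definition restr :: "'v set \<Rightarrow> ('v \<Rightarrow> complex) \<Rightarrow> 'v \<Rightarrow> complex" where
  "restr X f x = (if x \<in> X then f x else 0)"

lemma restr_finite: "finite X \<Longrightarrow> finite {x. restr X f x \<noteq> 0}"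
  by (rule finite_subset[of _ X]) (auto simp: restr_def)

section \<open>The Laplacian on square-summable functions\<close>

context cubic_tree
begin

lemma nball_filterlim: "filterlim (nball r) (finite_subsets_at_top UNIV) sequentially"
  unfolding filterlim_def le_filter_def
proof (intro allI impI)
  fix P :: "'v set \<Rightarrow> bool" assume "eventually P (finite_subsets_at_top UNIV)"
  then obtain X where X: "finite X" "\<And>Y. finite Y \<Longrightarrow> X \<subseteq> Y \<Longrightarrow> P Y"
    by (auto simp: eventually_finite_subsets_at_top)
  obtain n where n: "X \<subseteq> nball r n" using finite_subset_nball[OF X(1)] by blast
  have "P (nball r k)" if "k \<ge> n" for k
    using X(2)[of "nball r k"] n nball_mono[OF that] by force
  then show "eventually P (filtermap (nball r) sequentially)"
    by (auto simp: eventually_filtermap eventually_at_top_linorder)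
qed

lemma restr_nball_tendsto:
  assumes "f \<in> l2"
  shows "(\<lambda>n. l2_norm (\<lambda>x. f x - restr (nball r n) f x)) \<longlonglongrightarrow> 0"
proof -
  let ?S = "\<Sum>\<^sub>\<infinity>x. (cmod (f x))\<^sup>2"
  have sm: "(\<lambda>x. (cmod (f x))\<^sup>2) summable_on UNIV" using assms by (simp add: l2_def)
  have "((\<lambda>x. (cmod (f x))\<^sup>2) has_sum ?S) UNIV" using sm by simp
  then have lim: "(\<lambda>n. \<Sum>x\<in>nball r n. (cmod (f x))\<^sup>2) \<longlonglongrightarrow> ?S"
    unfolding has_sum_def by (rule filterlim_compose[OF _ nball_filterlim])
  have eq: "l2_norm (\<lambda>x. f x - restr (nball r n) f x) = sqrt (?S - (\<Sum>x\<in>nball r n. (cmod (f x))\<^sup>2))" for n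
  proof -
    have "(\<Sum>\<^sub>\<infinity>x. (cmod (f x - restr (nball r n) f x))\<^sup>2) = (\<Sum>\<^sub>\<infinity>x\<in>UNIV - nball r n. (cmod (f x))\<^sup>2)"
      by (rule infsum_cong_neutral) (auto simp: restr_def)
    also have "\<dots> = ?S - (\<Sum>\<^sub>\<infinity>x\<in>nball r n. (cmod (f x))\<^sup>2)"
      using sm by (intro infsum_Diff) auto
    finally show ?thesis by (simp add: l2_norm_def)
  qed
  have "(\<lambda>n. sqrt (?S - (\<Sum>x\<in>nball r n. (cmod (f x))\<^sup>2))) \<longlonglongrightarrow> sqrt (?S - ?S)"
    by (intro tendsto_intros lim)
  then show ?thesis by (simp add: eq)
qed

definition edges :: "('v \<times> 'v) set" where "edges = (SIGMA x:UNIV. nbrs x)"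

lemma bij_swap_edges: "bij_betw prod.swap edges edges"
  by (rule bij_betwI[where g = prod.swap]) (auto simp: edges_def dest: adj_sym)

lemma edge_summable:
  assumes "u summable_on UNIV" "\<And>x. 0 \<le> (u x :: real)"
  shows "(\<lambda>(x, y). u x) summable_on edges" and "(\<lambda>(x, y). u y) summable_on edges"
proof -
  have "(\<lambda>p. norm ((\<lambda>(x, y). u x) p)) summable_on edges"
    unfolding edges_def using assms
    by (subst Infinite_Sum.abs_summable_on_Sigma_iff) (auto simp: summable_on_cmult_right)
  then show *: "(\<lambda>(x, y). u x) summable_on edges" by (rule Infinite_Sum.abs_summable_summable)
  have "(\<lambda>p. (\<lambda>(x, y). u x) (prod.swap p)) summable_on edges"
    using summable_on_reindex_bij_betw[OF bij_swap_edges] * by blast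
  then show "(\<lambda>(x, y). u y) summable_on edges" by (simp add: case_prod_unfold)
qed

text \<open>A sum over oriented edges does not change when all edges are reversed. This gives both the bound
and the symmetry of the sum over neighbours.\<close>

lemma edge_sum_swap:
  fixes F :: "'v \<Rightarrow> 'v \<Rightarrow> 'b::banach"
  assumes "(\<lambda>(x, y). F x y) summable_on edges"
  shows "(\<Sum>\<^sub>\<infinity>x. \<Sum>y\<in>nbrs x. F x y) = (\<Sum>\<^sub>\<infinity>x. \<Sum>y\<in>nbrs x. F y x)"
    and "(\<lambda>x. \<Sum>y\<in>nbrs x. F x y) summable_on UNIV"
proof -
  have 2: "(\<lambda>(x, y). F y x) summable_on edges"
    using summable_on_reindex_bij_betw[OF bij_swap_edges, of "\<lambda>(x, y). F x y"] assms
    by (simp add: case_prod_unfold)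
  have "infsum (\<lambda>(x, y). F x y) edges = infsum (\<lambda>(x, y). F y x) edges"
    using infsum_reindex_bij_betw[OF bij_swap_edges, of "\<lambda>(x, y). F x y"]
    by (simp add: case_prod_unfold)
  then show "(\<Sum>\<^sub>\<infinity>x. \<Sum>y\<in>nbrs x. F x y) = (\<Sum>\<^sub>\<infinity>x. \<Sum>y\<in>nbrs x. F y x)"
    using infsum_Sigma'_banach[of F UNIV nbrs] infsum_Sigma'_banach[of "\<lambda>x y. F y x" UNIV nbrs]
      assms 2 by (simp add: edges_def)
  show "(\<lambda>x. \<Sum>y\<in>nbrs x. F x y) summable_on UNIV"
    using summable_on_Sigma_banach[of F UNIV nbrs] assms by (simp add: edges_def)
qed

definition nbsum :: "('v \<Rightarrow> complex) \<Rightarrow> 'v \<Rightarrow> complex" where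
  "nbsum f x = (\<Sum>y\<in>nbrs x. f y)"

abbreviation A :: "('v \<Rightarrow> complex) \<Rightarrow> 'v \<Rightarrow> complex" where
  "A \<equiv> neg_laplacian adj"

lemma A_eq: "A f = (\<lambda>x. 3 * f x + (- 1) * nbsum f x)"
  by (simp add: fun_eq_iff neg_laplacian_def graph_laplacian_def nbsum_def sum_subtractf)

lemma nbsum_l2:
  assumes "f \<in> l2" shows "nbsum f \<in> l2" and "l2_norm (nbsum f) \<le> 3 * l2_norm f"
proof -
  let ?u = "\<lambda>y. (cmod (f y))\<^sup>2"
  have u: "?u summable_on UNIV" using assms by (simp add: l2_def)
  note e = edge_summable[OF u zero_le_power2]
  have le: "(cmod (nbsum f x))\<^sup>2 \<le> 3 * (\<Sum>y\<in>nbrs x. ?u y)" for x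
    using sq_dev_nonneg[of "nbrs x" f] by (simp add: sq_dev_def nbsum_def)
  have s: "(\<lambda>x. 3 * (\<Sum>y\<in>nbrs x. ?u y)) summable_on UNIV"
    using edge_sum_swap(2)[OF e(2)] by (rule summable_on_cmult_right)
  show l: "nbsum f \<in> l2"
    unfolding l2_def using s le by (auto intro: summable_on_comparison_test)
  have "(l2_norm (nbsum f))\<^sup>2 \<le> (\<Sum>\<^sub>\<infinity>x. 3 * (\<Sum>y\<in>nbrs x. ?u y))"
    unfolding l2_norm_sq using l s le by (intro infsum_mono) (auto simp: l2_def)
  also have "\<dots> = 3 * (\<Sum>\<^sub>\<infinity>x. \<Sum>y\<in>nbrs x. ?u y)" by (rule infsum_cmult_right')
  also have "(\<Sum>\<^sub>\<infinity>x. \<Sum>y\<in>nbrs x. ?u y) = (\<Sum>\<^sub>\<infinity>x. \<Sum>y\<in>nbrs x. ?u x)"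
    by (rule edge_sum_swap(1)[OF e(2)])
  also have "\<dots> = 3 * (l2_norm f)\<^sup>2" by (simp add: l2_norm_sq infsum_cmult_right')
  finally have "(l2_norm (nbsum f))\<^sup>2 \<le> (3 * l2_norm f)\<^sup>2" by (simp add: power_mult_distrib)
  then show "l2_norm (nbsum f) \<le> 3 * l2_norm f" by (rule power2_le_imp_le) simp
qed

lemma nbsum_symmetric:
  assumes "f \<in> l2" "g \<in> l2" shows "l2_inner (nbsum f) g = l2_inner f (nbsum g)"
proof -
  have u: "(\<lambda>y. (cmod (f y))\<^sup>2) summable_on UNIV" "(\<lambda>y. (cmod (g y))\<^sup>2) summable_on UNIV"
    using assms by (auto simp: l2_def)
  have "(\<lambda>(x, y). (cmod (g x))\<^sup>2 + (cmod (f y))\<^sup>2) summable_on edges"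
    using summable_on_add[OF edge_summable(1)[OF u(2)] edge_summable(2)[OF u(1)]]
    by (simp add: case_prod_unfold)
  moreover have "cmod (f y * cnj (g x)) \<le> (cmod (g x))\<^sup>2 + (cmod (f y))\<^sup>2" for x y
    using zero_le_power2[of "cmod (f y) - cmod (g x)"] zero_le_power2[of "cmod (f y)"]
      zero_le_power2[of "cmod (g x)"] unfolding norm_mult complex_mod_cnj power2_diff
    by linarith
  ultimately have "(\<lambda>p. norm ((\<lambda>(x, y). f y * cnj (g x)) p)) summable_on edges"
    by (elim summable_on_comparison_test) (simp_all add: case_prod_unfold del: norm_mult)
  then have "(\<Sum>\<^sub>\<infinity>x. \<Sum>y\<in>nbrs x. f y * cnj (g x)) = (\<Sum>\<^sub>\<infinity>x. \<Sum>y\<in>nbrs x. f x * cnj (g y))"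
    by (rule edge_sum_swap(1)[where F = "\<lambda>x y. f y * cnj (g x)", OF Infinite_Sum.abs_summable_summable])
  then show ?thesis
    by (simp add: l2_inner_def nbsum_def sum_distrib_left sum_distrib_right)
qed

lemma A_l2: assumes "f \<in> l2" shows "A f \<in> l2" and "l2_norm (A f) \<le> 6 * l2_norm f"
proof -
  note n = nbsum_l2[OF assms]
  show "A f \<in> l2" unfolding A_eq using assms n by (intro l2_lincomb)
  have "l2_norm (A f) \<le> l2_norm (\<lambda>x. 3 * f x) + l2_norm (\<lambda>x. (- 1) * nbsum f x)"
    unfolding A_eq using assms n by (intro l2_norm_triangle l2_scale)
  then show "l2_norm (A f) \<le> 6 * l2_norm f"
    using n by (simp add: l2_norm_scale[OF assms] l2_norm_uminus)
qed

lemma A_symmetric: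
  assumes "f \<in> l2" "g \<in> l2" shows "l2_inner (A f) g = l2_inner f (A g)"
  unfolding A_eq
  using assms nbsum_l2[OF assms(1)] nbsum_l2[OF assms(2)]
  by (simp only: l2_inner_add_left l2_inner_add_right nbsum_symmetric) simp

lemma A_lincomb: "A (\<lambda>x. a * f x + b * g x) = (\<lambda>x. a * A f x + b * A g x)"
  by (simp add: A_eq nbsum_def fun_eq_iff sum.distrib sum_distrib_left algebra_simps)

lemma A_form_bound: "f \<in> l2 \<Longrightarrow> cmod (l2_inner (A f) f) \<le> 6 * (l2_norm f)\<^sup>2"
  using order_trans[OF l2_cauchy_schwarz[OF A_l2(1), of f f] mult_right_mono[OF A_l2(2)]]
  by (simp add: power2_eq_square mult.assoc)

lemma A_finite: assumes "finite {x. f x \<noteq> 0}" shows "finite {x. A f x \<noteq> 0}"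
proof (rule finite_subset)
  show "{x. A f x \<noteq> 0} \<subseteq> {x. f x \<noteq> 0} \<union> (\<Union>x\<in>{x. f x \<noteq> 0}. nbrs x)"
  proof
    fix x assume "x \<in> {x. A f x \<noteq> 0}"
    then have "f x \<noteq> 0 \<or> nbsum f x \<noteq> 0" by (auto simp: A_eq)
    then show "x \<in> {x. f x \<noteq> 0} \<union> (\<Union>x\<in>{x. f x \<noteq> 0}. nbrs x)"
    proof
      assume "nbsum f x \<noteq> 0"
      then obtain y where "adj x y" "f y \<noteq> 0"
        unfolding nbsum_def using sum.not_neutral_contains_not_neutral by blast
      then show ?thesis using adj_sym by blast
    qed blast
  qed
qed (use assms in auto)

end

section \<open>Spectral components\<close>

lemma l2_inner_finite:
  assumes "finite X" "{x. u x \<noteq> 0} \<subseteq> X"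
  shows "l2_inner u g = (\<Sum>x\<in>X. u x * cnj (g x))"
proof -
  have "(\<Sum>\<^sub>\<infinity>x. u x * cnj (g x)) = (\<Sum>\<^sub>\<infinity>x\<in>X. u x * cnj (g x))"
    by (rule infsum_cong_neutral) (use assms(2) in auto)
  then show ?thesis using assms(1) by (simp add: l2_inner_def)
qed

lemma l2_norm_finite:
  assumes "finite X" "{x. u x \<noteq> 0} \<subseteq> X"
  shows "(l2_norm u)\<^sup>2 = (\<Sum>x\<in>X. (cmod (u x))\<^sup>2)"
proof -
  have "(\<Sum>\<^sub>\<infinity>x. (cmod (u x))\<^sup>2) = (\<Sum>\<^sub>\<infinity>x\<in>X. (cmod (u x))\<^sup>2)"
    by (rule infsum_cong_neutral) (use assms(2) in auto)
  then show ?thesis using assms(1) by (simp add: l2_norm_sq)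
qed

lemma finite_lincomb_support:
  "finite {x. u x \<noteq> 0} \<Longrightarrow> finite {x. v x \<noteq> 0} \<Longrightarrow> finite {x. a * u x + b * v x \<noteq> (0::complex)}"
  by (rule finite_subset[of _ "{x. u x \<noteq> 0} \<union> {x. v x \<noteq> 0}"]) auto

lemma integrable_sph: "integrable plancherel (\<lambda>s. sph (3 - s) n)"
proof (rule plancherel.integrable_const_bound[where B = "3 ^ n"])
  show "AE s in plancherel. norm (sph (3 - s) n) \<le> 3 ^ n"
    using AE_spec_interior
  proof eventually_elim
    case (elim s)
    have "(3 - s)\<^sup>2 \<le> 3\<^sup>2" using elim by (simp add: spec_interior_iff)
    then show ?case using abs_sph_le[of "3 - s" n] abs_le_square_iff[of "3 - s" 3] by simp
  qed
qed simp

text \<open>The Plancherel measure has total mass one, so \<open>\<bar>w\<bar> \<le> (e + \<bar>w\<bar>\<^sup>2 / e) / 2\<close> replaces the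
Cauchy--Schwarz inequality.\<close>

lemma integral_norm_le:
  fixes w :: "real \<Rightarrow> complex"
  assumes [measurable]: "w \<in> borel_measurable borel"
    and "(\<integral>\<^sup>+s. ennreal ((cmod (w s))\<^sup>2) \<partial>plancherel) \<le> ennreal (e\<^sup>2)" "0 < e"
  shows "integrable plancherel w" and "cmod (LINT s|plancherel. w s) \<le> e"
proof -
  have le: "cmod z \<le> (e + (cmod z)\<^sup>2 / e) / 2" for z
    using zero_le_power2[of "cmod z - e"] assms(3)
    by (simp add: power2_diff power2_eq_square field_simps)
  have fin: "(\<integral>\<^sup>+s. ennreal ((cmod (w s))\<^sup>2) \<partial>plancherel) < \<infinity>"
    using assms(2) by (simp add: order_le_less_trans ennreal_less_top)
  have sq: "integrable plancherel (\<lambda>s. (cmod (w s))\<^sup>2)"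
    by (rule integrableI_nonneg) (use fin in auto)
  then have dom: "integrable plancherel (\<lambda>s. (e + (cmod (w s))\<^sup>2 / e) / 2)" by simp
  show int: "integrable plancherel w"
    by (rule Bochner_Integration.integrable_bound[OF dom])
       (use le order_trans[OF le abs_ge_self] in auto)
  have "ennreal (LINT s|plancherel. (cmod (w s))\<^sup>2) \<le> ennreal (e\<^sup>2)"
    using assms(2) nn_integral_eq_integral[OF sq] by simp
  then have sqle: "(LINT s|plancherel. (cmod (w s))\<^sup>2) \<le> e\<^sup>2" by simp
  have "cmod (LINT s|plancherel. w s) \<le> (LINT s|plancherel. cmod (w s))"
    by (rule integral_norm_bound)
  also have "\<dots> \<le> (LINT s|plancherel. (e + (cmod (w s))\<^sup>2 / e) / 2)"
    using int dom le by (intro integral_mono) auto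
  also have "\<dots> = (e + (LINT s|plancherel. (cmod (w s))\<^sup>2) / e) / 2"
    using sq measure_plancherel_UNIV by simp
  also have "\<dots> \<le> (e + e\<^sup>2 / e) / 2"
    using sqle assms(3) by (intro divide_right_mono add_left_mono) auto
  also have "\<dots> = e" using assms(3) by (simp add: power2_eq_square)
  finally show "cmod (LINT s|plancherel. w s) \<le> e" .
qed

lemma summable_convergent:
  fixes u :: "nat \<Rightarrow> complex"
  assumes "\<And>k. 4 ^ k * (cmod (u (Suc k) - u k))\<^sup>2 \<le> K" shows "convergent u"
proof -
  have K: "K \<ge> 0" using order_trans[OF _ assms[of 0]] by simp
  have "cmod (u (Suc k) - u k) \<le> sqrt K * (1 / 2) ^ k" for k
  proof -
    have "(2 ^ k * cmod (u (Suc k) - u k))\<^sup>2 \<le> (sqrt K)\<^sup>2"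
    proof -
      have "(2 ^ k * cmod (u (Suc k) - u k))\<^sup>2 = (2\<^sup>2) ^ k * (cmod (u (Suc k) - u k))\<^sup>2"
        unfolding power_mult_distrib power_mult[symmetric] by (simp only: mult.commute)
      then show ?thesis using assms[of k] K by simp
    qed
    then have "2 ^ k * cmod (u (Suc k) - u k) \<le> sqrt K" by (rule power2_le_imp_le) (use K in simp)
    then have "(1 / 2) ^ k * (2 ^ k * cmod (u (Suc k) - u k)) \<le> (1 / 2) ^ k * sqrt K"
      by (rule mult_left_mono) simp
    also have "(1 / 2) ^ k * (2 ^ k * cmod (u (Suc k) - u k)) = (1 / 2 * 2) ^ k * cmod (u (Suc k) - u k)"
      by (simp only: power_mult_distrib mult.assoc)
    finally show ?thesis by (simp add: mult.commute[of "sqrt K"])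
  qed
  then have "summable (\<lambda>k. u (Suc k) - u k)"
    by (rule summable_comparison_test'[where g = "\<lambda>k. sqrt K * (1 / 2) ^ k", rotated])
       (intro summable_mult summable_geometric, simp)
  then have "convergent (\<lambda>n. \<Sum>k<n. u (Suc k) - u k)"
    by (simp add: summable_iff_convergent)
  then have "convergent (\<lambda>n. u n - u 0)" by (simp add: sum_lessThan_telescope)
  then have "convergent (\<lambda>n. (u n - u 0) + u 0)" by (intro convergent_add convergent_const)
  then show ?thesis by simp
qed

context cubic_tree
begin

definition component :: "real \<Rightarrow> ('v \<Rightarrow> complex) \<Rightarrow> 'v \<Rightarrow> complex" where
  "component s u x = (\<Sum>y | u y \<noteq> 0. of_real (sph (3 - s) (d x y)) * u y)"

lemma component_superset:
  assumes "finite X" "{y. u y \<noteq> 0} \<subseteq> X"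
  shows "component s u x = (\<Sum>y\<in>X. of_real (sph (3 - s) (d x y)) * u y)"
  unfolding component_def using assms by (intro sum.mono_neutral_left) auto

lemma component_lincomb:
  assumes "finite {y. u y \<noteq> 0}" "finite {y. v y \<noteq> 0}"
  shows "component s (\<lambda>y. a * u y + b * v y) x = a * component s u x + b * component s v x"
proof -
  let ?X = "{y. u y \<noteq> 0} \<union> {y. v y \<noteq> 0}"
  have X: "finite ?X" using assms by simp
  have "{y. a * u y + b * v y \<noteq> 0} \<subseteq> ?X" by auto
  from component_superset[OF X this] component_superset[OF X, of u] component_superset[OF X, of v] show ?thesis
    by (simp add: sum_distrib_left sum.distrib[symmetric] algebra_simps)
qed

lemma component_eq_inner:
  assumes "finite X" "{y. u y \<noteq> 0} \<subseteq> X" "\<And>y. y \<in> X \<Longrightarrow> k y = of_real (sph (3 - s) (d x y))"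
  shows "component s u x = l2_inner u k"
  unfolding component_superset[OF assms(1,2)] l2_inner_finite[OF assms(1,2)]
  using assms(3) by (intro sum.cong) auto

text \<open>Symmetry of \<open>A\<close> moves it to the kernel, which is an eigenfunction. The kernel is not
square-summable, but it may be cut off outside the support of \<open>u\<close> and its neighbours.\<close>

lemma component_A:
  assumes "finite {y. u y \<noteq> 0}"
  shows "component s (A u) x = of_real s * component s u x"
proof -
  define X where "X = {y. u y \<noteq> 0} \<union> (\<Union>y\<in>{y. u y \<noteq> 0}. nbrs y)"
  define k where "k = restr X (\<lambda>y. of_real (sph (3 - s) (d y x)))"
  have X: "finite X" "{y. u y \<noteq> 0} \<subseteq> X" using assms by (auto simp: X_def)
  have kX: "k y = of_real (sph (3 - s) (d x y))" if "y \<in> X" for y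
    using that by (simp add: k_def restr_def gdist_sym)
  have AX: "{y. A u y \<noteq> 0} \<subseteq> X"
  proof
    fix y assume y: "y \<in> {y. A u y \<noteq> 0}"
    show "y \<in> X"
    proof (rule ccontr)
      assume "y \<notin> X"
      then have "u y = 0" "\<forall>z\<in>nbrs y. u z = 0" by (auto simp: X_def dest: adj_sym)
      then show False using y by (simp add: A_eq nbsum_def)
    qed
  qed
  have k: "k \<in> l2" unfolding k_def by (intro l2_finite restr_finite X)
  have Ak: "A k y = of_real s * of_real (sph (3 - s) (d x y))" if "u y \<noteq> 0" for y
  proof -
    have "nbrs y \<subseteq> X" using that by (auto simp: X_def)
    then have "nbsum k y = (\<Sum>z\<in>nbrs y. of_real (sph (3 - s) (d z x)))"
      unfolding nbsum_def by (intro sum.cong refl) (auto simp: k_def restr_def)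
    also have "\<dots> = of_real (3 - s) * of_real (sph (3 - s) (d y x))"
      using eigen_sph by (simp add: eigen_def)
    finally show ?thesis
      using kX[of y] that by (simp add: A_eq X_def gdist_sym[of y] algebra_simps)
  qed
  have "component s (A u) x = l2_inner (A u) k" by (rule component_eq_inner[OF X(1) AX kX])
  also have "\<dots> = l2_inner u (A k)" by (rule A_symmetric[OF l2_finite[OF assms] k])
  also have "\<dots> = (\<Sum>y | u y \<noteq> 0. u y * (of_real s * of_real (sph (3 - s) (d x y))))"
    unfolding l2_inner_finite[OF assms order_refl] by (intro sum.cong refl) (simp add: Ak)
  also have "\<dots> = of_real s * component s u x"
    by (simp add: component_def sum_distrib_left mult_ac)
  finally show ?thesis .
qed

text \<open>The squared length of \<open>u\<close> in the reproducing kernel space of eigenfunctions, which is the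
normalised mean of \<open>component s u\<close> for finitely supported \<open>u\<close>.\<close>

definition gram :: "real \<Rightarrow> ('v \<Rightarrow> complex) \<Rightarrow> real" where
  "gram s u = Re (\<Sum>x | u x \<noteq> 0. \<Sum>y | u y \<noteq> 0. cnj (u x) * of_real (sph (3 - s) (d x y)) * u y)"

lemma component_measurable [measurable]: "(\<lambda>s. component s u x) \<in> borel_measurable borel"
  unfolding component_def by measurable

lemma gram_measurable [measurable]: "(\<lambda>s. gram s u) \<in> borel_measurable borel"
  unfolding gram_def by measurable

lemma eigen_component: "eigen (3 - s) (component s u)"
proof -
  have "eigen \<mu> (\<lambda>x. \<Sum>y\<in>X. of_real (sph \<mu> (d x y)) * u y)" if "finite X" for \<mu> X
    using that
  proof (induction X)
    case (insert a X)
    then show ?case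
      using eigen_add[OF eigen_scale[OF eigen_sph, of \<mu> "u a" a] insert.IH] by (simp add: mult.commute)
  qed (simp add: eigen_zero)
  then show ?thesis
    by (cases "finite {y. u y \<noteq> 0}") (simp_all add: component_def[abs_def] eigen_zero)
qed

lemma has_mean_minus_component:
  assumes "finite {y. u y \<noteq> 0}" "eigen (3 - s) h" "s \<in> spec_interior" "has_mean (3 - s) h m"
  shows "has_mean (3 - s) (\<lambda>x. h x - component s u x) (m - 2 * Re (\<Sum>x | u x \<noteq> 0. cnj (u x) * h x) + gram s u)"
    and "eigen (3 - s) (\<lambda>x. h x - component s u x)"
  using has_mean_add_finite[OF assms(1,2) _ assms(4), of "\<lambda>x. - u x"] assms(3)
  by (simp_all add: spec_interior_iff component_def gram_def sum_negf del: Re_sum)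

lemma has_mean_component:
  assumes "finite {y. u y \<noteq> 0}" "s \<in> spec_interior"
  shows "has_mean (3 - s) (component s u) (gram s u)"
  using has_mean_add_finite[OF assms(1) eigen_zero _ has_mean_zero, of "3 - s" u] assms(2)
  by (simp add: spec_interior_iff component_def[abs_def] gram_def del: Re_sum)

lemma gram_integral:
  assumes "finite {y. u y \<noteq> 0}"
  shows "integrable plancherel (\<lambda>s. gram s u)" and "(LINT s|plancherel. gram s u) = (l2_norm u)\<^sup>2"
proof -
  let ?X = "{y. u y \<noteq> 0}"
  have g: "gram s u = (\<Sum>x\<in>?X. \<Sum>y\<in>?X. Re (cnj (u x) * u y) * sph (3 - s) (d x y))" for s
    unfolding gram_def Re_sum by (intro sum.cong refl) (simp add: algebra_simps)
  show "integrable plancherel (\<lambda>s. gram s u)"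
    unfolding g using integrable_sph by (intro Bochner_Integration.integrable_sum) auto
  have "(LINT s|plancherel. gram s u)
      = (\<Sum>x\<in>?X. \<Sum>y\<in>?X. Re (cnj (u x) * u y) * (LINT s|plancherel. sph (3 - s) (d x y)))"
    unfolding g using integrable_sph
    by (subst Bochner_Integration.integral_sum | intro Bochner_Integration.integrable_sum sum.cong refl
         integrable_mult_right integral_mult_right)+ auto
  also have "\<dots> = (\<Sum>x\<in>?X. \<Sum>y\<in>?X. if x = y then Re (cnj (u x) * u y) else 0)"
    by (intro sum.cong refl) (simp add: integral_sph)
  also have "\<dots> = (\<Sum>x\<in>?X. (cmod (u x))\<^sup>2)"
    unfolding cmod_power2 using assms by (simp add: sum.delta power2_eq_square)
  finally show "(LINT s|plancherel. gram s u) = (l2_norm u)\<^sup>2"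
    using l2_norm_finite[OF assms order_refl] by simp
qed

lemma AE_gram_ge:
  assumes "finite {y. u y \<noteq> 0}"
  shows "AE s in plancherel. \<forall>x. (cmod (component s u x))\<^sup>2 \<le> gram s u"
  using AE_spec_interior
proof eventually_elim
  case (elim s)
  then show ?case
    using has_mean_ge[OF eigen_component _ has_mean_component[OF assms elim]] by (simp add: spec_interior_iff)
qed

lemma AE_gram_nonneg:
  assumes "finite {y. u y \<noteq> 0}" shows "AE s in plancherel. 0 \<le> gram s u"
  using AE_gram_ge[OF assms] by eventually_elim (meson order_trans zero_le_power2)

lemma nn_integral_gram:
  assumes "finite {y. u y \<noteq> 0}"
  shows "(\<integral>\<^sup>+s. ennreal (gram s u) \<partial>plancherel) = ennreal ((l2_norm u)\<^sup>2)"
  using gram_integral[OF assms] AE_gram_nonneg[OF assms] by (simp add: nn_integral_eq_integral)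

lemma component_bound:
  assumes "finite {y. u y \<noteq> 0}"
  shows "(\<integral>\<^sup>+s. ennreal ((cmod (component s u x))\<^sup>2) \<partial>plancherel) \<le> ennreal ((l2_norm u)\<^sup>2)"
  unfolding nn_integral_gram[OF assms, symmetric]
  by (rule nn_integral_mono_AE) (use AE_gram_ge[OF assms] in \<open>eventually_elim, auto intro: ennreal_leI\<close>)

lemma component_integral:
  assumes "finite {y. u y \<noteq> 0}"
  shows "(LINT s|plancherel. component s u x) = u x"
proof -
  have "(LINT s|plancherel. component s u x)
      = (\<Sum>y | u y \<noteq> 0. (LINT s|plancherel. of_real (sph (3 - s) (d x y)) * u y))"
    unfolding component_def using integrable_sph
    by (intro Bochner_Integration.integral_sum integrable_mult_left integrable_of_real)
  also have "\<dots> = (\<Sum>y | u y \<noteq> 0. if x = y then u y else 0)"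
    by (intro sum.cong refl) (simp add: integral_sph integral_complex_of_real)
  finally show ?thesis using assms by (simp add: sum.delta)
qed

text \<open>The almost everywhere limit of the components of finitely supported approximations. The
approximating sequence is left open, so that the relation is linear in the pair of \<open>f\<close> and \<open>g\<close>;
it determines \<open>g\<close> almost everywhere, by \<open>components_unique\<close>.\<close>

definition has_components :: "('v \<Rightarrow> complex) \<Rightarrow> (real \<Rightarrow> 'v \<Rightarrow> complex) \<Rightarrow> bool" where
  "has_components f g \<longleftrightarrow> (\<forall>x. (\<lambda>s. g s x) \<in> borel_measurable borel) \<and>
     (\<exists>F. (\<forall>k::nat. finite {x. F k x \<noteq> 0}) \<and> (\<lambda>k. l2_norm (\<lambda>x. f x - F k x)) \<longlonglongrightarrow> 0 \<and>
        (AE s in plancherel. \<forall>x. (\<lambda>k. component s (F k) x) \<longlonglongrightarrow> g s x))"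

lemma components_measurable: "has_components f g \<Longrightarrow> (\<lambda>s. g s x) \<in> borel_measurable borel"
  by (simp add: has_components_def)

lemma components_finite:
  assumes "finite {x. u x \<noteq> 0}" shows "has_components u (\<lambda>s. component s u)"
  unfolding has_components_def
  by (intro conjI allI component_measurable exI[of _ "\<lambda>k. u"]) (use assms in auto)

lemma components_lincomb:
  assumes "f \<in> l2" "f' \<in> l2" "has_components f g" "has_components f' g'"
  shows "has_components (\<lambda>x. a * f x + b * f' x) (\<lambda>s x. a * g s x + b * g' s x)"
proof -
  obtain F where F: "\<And>k::nat. finite {x. F k x \<noteq> 0}" "(\<lambda>k. l2_norm (\<lambda>x. f x - F k x)) \<longlonglongrightarrow> 0"
    "AE s in plancherel. \<forall>x. (\<lambda>k. component s (F k) x) \<longlonglongrightarrow> g s x" using assms(3) by (auto simp: has_components_def)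
  obtain F' where F': "\<And>k::nat. finite {x. F' k x \<noteq> 0}" "(\<lambda>k. l2_norm (\<lambda>x. f' x - F' k x)) \<longlonglongrightarrow> 0"
    "AE s in plancherel. \<forall>x. (\<lambda>k. component s (F' k) x) \<longlonglongrightarrow> g' s x" using assms(4) by (auto simp: has_components_def)
  show ?thesis unfolding has_components_def
  proof (intro conjI allI exI[of _ "\<lambda>k x. a * F k x + b * F' k x"])
    show "(\<lambda>s. a * g s x + b * g' s x) \<in> borel_measurable borel" for x
      using assms(3,4)[THEN components_measurable, of x] by measurable
    show "finite {x. a * F k x + b * F' k x \<noteq> 0}" for k
      by (intro finite_lincomb_support F F')
    have l: "(\<lambda>x. f x - F k x) \<in> l2" "(\<lambda>x. f' x - F' k x) \<in> l2" for k
      by (intro l2_diff assms l2_finite F F')+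
    show "(\<lambda>k. l2_norm (\<lambda>x. a * f x + b * f' x - (a * F k x + b * F' k x))) \<longlonglongrightarrow> 0"
    proof (rule tendsto_sandwich[OF _ _ tendsto_const])
      show "(\<lambda>k. cmod a * l2_norm (\<lambda>x. f x - F k x) + cmod b * l2_norm (\<lambda>x. f' x - F' k x)) \<longlonglongrightarrow> 0"
        using tendsto_add[OF tendsto_mult_left[OF F(2), of "cmod a"] tendsto_mult_left[OF F'(2), of "cmod b"]]
        by simp
      have "l2_norm (\<lambda>x. a * f x + b * f' x - (a * F k x + b * F' k x))
          \<le> cmod a * l2_norm (\<lambda>x. f x - F k x) + cmod b * l2_norm (\<lambda>x. f' x - F' k x)" for k
        using l2_norm_triangle[OF l2_scale[OF l(1)] l2_scale[OF l(2)], of a k b k]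
        unfolding l2_norm_scale[OF l(1)] l2_norm_scale[OF l(2)] by (simp add: algebra_simps)
      then show "\<forall>\<^sub>F k in sequentially. l2_norm (\<lambda>x. a * f x + b * f' x - (a * F k x + b * F' k x))
          \<le> cmod a * l2_norm (\<lambda>x. f x - F k x) + cmod b * l2_norm (\<lambda>x. f' x - F' k x)" by simp
    qed simp
    show "AE s in plancherel. \<forall>x. (\<lambda>k. component s (\<lambda>x. a * F k x + b * F' k x) x) \<longlonglongrightarrow> a * g s x + b * g' s x"
      using F(3) F'(3)
      by eventually_elim (auto simp: component_lincomb[OF F(1) F'(1)] intro!: tendsto_intros)
  qed
qed

lemma components_A:
  assumes "f \<in> l2" "has_components f g" shows "has_components (A f) (\<lambda>s x. of_real s * g s x)"
proof -
  obtain F where F: "\<And>k::nat. finite {x. F k x \<noteq> 0}" "(\<lambda>k. l2_norm (\<lambda>x. f x - F k x)) \<longlonglongrightarrow> 0"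
    "AE s in plancherel. \<forall>x. (\<lambda>k. component s (F k) x) \<longlonglongrightarrow> g s x" using assms(2) by (auto simp: has_components_def)
  have l: "(\<lambda>x. f x - F k x) \<in> l2" for k by (intro l2_diff assms l2_finite F)
  show ?thesis unfolding has_components_def
  proof (intro conjI allI exI[of _ "\<lambda>k. A (F k)"])
    show "(\<lambda>s. of_real s * g s x) \<in> borel_measurable borel" for x
      using assms(2)[THEN components_measurable, of x] by measurable
    show "finite {x. A (F k) x \<noteq> 0}" for k by (rule A_finite[OF F(1)])
    show "(\<lambda>k. l2_norm (\<lambda>x. A f x - A (F k) x)) \<longlonglongrightarrow> 0"
    proof (rule tendsto_0_le[OF F(2), of _ 6], intro always_eventually allI)
      fix k
      have "(\<lambda>x. A f x - A (F k) x) = A (\<lambda>x. f x - F k x)"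
        using A_lincomb[of 1 f "-1" "F k"] by simp
      then show "norm (l2_norm (\<lambda>x. A f x - A (F k) x)) \<le> norm (l2_norm (\<lambda>x. f x - F k x)) * 6"
        using A_l2(2)[OF l[of k]] by simp
    qed
    show "AE s in plancherel. \<forall>x. (\<lambda>k. component s (A (F k)) x) \<longlonglongrightarrow> of_real s * g s x"
      using F(3) by eventually_elim (auto simp: component_A[OF F(1)] intro!: tendsto_intros)
  qed
qed

text \<open>Evaluation at \<open>x\<close> is bounded by the mean, so the corresponding bound for finitely supported
functions passes to the limit by Fatou's lemma.\<close>

lemma components_bound:
  assumes "f \<in> l2" "has_components f g"
  shows "(\<integral>\<^sup>+s. ennreal ((cmod (g s x))\<^sup>2) \<partial>plancherel) \<le> ennreal ((l2_norm f)\<^sup>2)"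
proof -
  obtain F where F: "\<And>k::nat. finite {x. F k x \<noteq> 0}" "(\<lambda>k. l2_norm (\<lambda>x. f x - F k x)) \<longlonglongrightarrow> 0"
    "AE s in plancherel. \<forall>x. (\<lambda>k. component s (F k) x) \<longlonglongrightarrow> g s x" using assms(2) by (auto simp: has_components_def)
  have n: "(\<lambda>k. ennreal ((l2_norm (F k))\<^sup>2)) \<longlonglongrightarrow> ennreal ((l2_norm f)\<^sup>2)"
    by (intro tendsto_ennrealI tendsto_power l2_tendsto_norm[OF l2_finite[OF F(1)] assms(1) F(2)])
  have "(\<integral>\<^sup>+s. ennreal ((cmod (g s x))\<^sup>2) \<partial>plancherel)
      = (\<integral>\<^sup>+s. liminf (\<lambda>k. ennreal ((cmod (component s (F k) x))\<^sup>2)) \<partial>plancherel)"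
  proof (rule nn_integral_cong_AE, use F(3) in eventually_elim)
    case (elim s)
    have "(\<lambda>k. ennreal ((cmod (component s (F k) x))\<^sup>2)) \<longlonglongrightarrow> ennreal ((cmod (g s x))\<^sup>2)"
      using elim by (intro tendsto_ennrealI tendsto_power tendsto_norm) blast
    then show ?case using lim_imp_Liminf[OF sequentially_bot] by metis
  qed
  also have "\<dots> \<le> liminf (\<lambda>k. \<integral>\<^sup>+s. ennreal ((cmod (component s (F k) x))\<^sup>2) \<partial>plancherel)"
    by (rule nn_integral_liminf) measurable
  also have "\<dots> \<le> liminf (\<lambda>k. ennreal ((l2_norm (F k))\<^sup>2))"
    by (intro Liminf_mono always_eventually allI component_bound F)
  also have "\<dots> = ennreal ((l2_norm f)\<^sup>2)" by (rule lim_imp_Liminf[OF sequentially_bot n])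
  finally show ?thesis .
qed

lemma components_integrable:
  assumes "f \<in> l2" "has_components f g" "l2_norm f \<le> e" "0 < e"
  shows "integrable plancherel (\<lambda>s. g s x)" and "cmod (LINT s|plancherel. g s x) \<le> e"
proof -
  have "(\<integral>\<^sup>+s. ennreal ((cmod (g s x))\<^sup>2) \<partial>plancherel) \<le> ennreal (e\<^sup>2)"
    by (rule order_trans[OF components_bound[OF assms(1,2)]]) (use assms(3) in \<open>auto intro!: ennreal_leI power_mono\<close>)
  from integral_norm_le[OF components_measurable[OF assms(2)] this assms(4)]
  show "integrable plancherel (\<lambda>s. g s x)" "cmod (LINT s|plancherel. g s x) \<le> e" by auto
qed

lemma components_integrable': "f \<in> l2 \<Longrightarrow> has_components f g \<Longrightarrow> integrable plancherel (\<lambda>s. g s x)"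
  by (rule components_integrable[where e = "l2_norm f + 1"]) (auto simp: add_nonneg_pos)

text \<open>Both sides depend continuously on \<open>f\<close>, and for finitely supported functions they agree.\<close>

lemma components_integral:
  assumes "f \<in> l2" "has_components f g" shows "(LINT s|plancherel. g s x) = f x"
proof -
  obtain F where F: "\<And>k::nat. finite {x. F k x \<noteq> 0}" "(\<lambda>k. l2_norm (\<lambda>x. f x - F k x)) \<longlonglongrightarrow> 0"
    using assms(2) by (auto simp: has_components_def)
  have "(\<lambda>k. F k x) \<longlonglongrightarrow> (LINT s|plancherel. g s x)"
  proof (rule LIMSEQ_I)
    fix e :: real assume e: "0 < e"
    obtain K where K: "\<And>k. k \<ge> K \<Longrightarrow> l2_norm (\<lambda>x. f x - F k x) < e / 2"
      using LIMSEQ_D[OF F(2), of "e / 2"] e by auto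
    have "cmod (F k x - (LINT s|plancherel. g s x)) < e" if "k \<ge> K" for k
    proof -
      have r: "has_components (\<lambda>x. f x - F k x) (\<lambda>s x. g s x - component s (F k) x)"
        using components_lincomb[OF assms(1) l2_finite[OF F(1)] assms(2) components_finite[OF F(1)], of 1 "-1"] by simp
      have "cmod (LINT s|plancherel. g s x - component s (F k) x) \<le> e / 2"
        by (rule components_integrable[OF l2_diff[OF assms(1) l2_finite[OF F(1)]] r])
           (use K[OF that] e in auto)
      also have "(LINT s|plancherel. g s x - component s (F k) x) = (LINT s|plancherel. g s x) - F k x"
        using components_integrable'[OF assms] components_integrable'[OF l2_finite[OF F(1)] components_finite[OF F(1)]]
        by (simp add: component_integral[OF F(1)])
      finally show ?thesis using e by (simp add: norm_minus_commute)
    qed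
    then show "\<exists>no. \<forall>k\<ge>no. norm (F k x - (LINT s|plancherel. g s x)) < e" by auto
  qed
  moreover have "(\<lambda>k. F k x) \<longlonglongrightarrow> f x"
    by (rule l2_tendsto_pointwise[OF l2_finite[OF F(1)] assms(1) F(2)])
  ultimately show ?thesis by (rule LIMSEQ_unique)
qed

lemma AE_all_vertices: "(\<And>x. AE s in M. Q s (x::'v)) \<Longrightarrow> AE s in M. \<forall>x. Q s x"
  using AE_ball_countable'[OF _ countable_vertices, where M = M and P = "\<lambda>x s. Q s x"] by simp

lemma components_zero_AE:
  assumes "f \<in> l2" "has_components f g" "l2_norm f = 0" shows "AE s in plancherel. \<forall>x. g s x = 0"
proof (rule AE_all_vertices)
  fix x
  note [measurable] = components_measurable[OF assms(2), of x]
  have "(\<integral>\<^sup>+s. ennreal ((cmod (g s x))\<^sup>2) \<partial>plancherel) = 0"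
    using components_bound[OF assms(1,2), of x] assms(3) by simp
  then have "AE s in plancherel. ennreal ((cmod (g s x))\<^sup>2) = 0"
    by (subst (asm) nn_integral_0_iff_AE) auto
  then show "AE s in plancherel. g s x = 0"
    by eventually_elim (simp add: ennreal_eq_0_iff)
qed

lemma components_unique:
  assumes "f \<in> l2" "has_components f g" "has_components f g'" shows "AE s in plancherel. \<forall>x. g s x = g' s x"
proof -
  have "has_components (\<lambda>x. 0) (\<lambda>s x. g s x - g' s x)"
    using components_lincomb[OF assms(1,1,2,3), of 1 "-1"] by simp
  then have "AE s in plancherel. \<forall>x. g s x - g' s x = 0" by (rule components_zero_AE[rotated]) auto
  then show ?thesis by simp
qed

lemma components_eigen: assumes "has_components f g" shows "AE s in plancherel. eigen (3 - s) (g s)"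
proof -
  obtain F where F: "AE s in plancherel. \<forall>x. (\<lambda>k::nat. component s (F k) x) \<longlonglongrightarrow> g s x"
    using assms by (auto simp: has_components_def)
  then show ?thesis
  proof eventually_elim
    case (elim s)
    show ?case unfolding eigen_def
    proof
      fix x
      have "(\<lambda>k. \<Sum>y\<in>nbrs x. component s (F k) y) \<longlonglongrightarrow> (\<Sum>y\<in>nbrs x. g s y)"
        using elim by (intro tendsto_sum) blast
      moreover have "(\<lambda>k. of_real (3 - s) * component s (F k) x) \<longlonglongrightarrow> of_real (3 - s) * g s x"
        using elim by (intro tendsto_mult tendsto_const) blast
      ultimately show "(\<Sum>y\<in>nbrs x. g s y) = of_real (3 - s) * g s x"
        using eigen_component[of s] LIMSEQ_unique unfolding eigen_def by auto
    qed
  qed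
qed

text \<open>Restricting \<open>f\<close> to balls that exhaust the tree fast enough makes the weighted squares of
consecutive differences integrable in total; hence they are bounded almost everywhere, and the
differences decay geometrically.\<close>

lemma components_exists:
  assumes "f \<in> l2" shows "\<exists>g. has_components f g"
proof -
  have "\<exists>n. l2_norm (\<lambda>x. f x - restr (nball undefined n) f x) < (1 / 4) ^ k" for k :: nat
    using LIMSEQ_D[OF restr_nball_tendsto[OF assms], of "(1 / 4) ^ k"] by auto
  then obtain n where n: "\<And>k::nat. l2_norm (\<lambda>x. f x - restr (nball undefined (n k)) f x) < (1 / 4) ^ k"
    by metis
  define F where "F = (\<lambda>k. restr (nball undefined (n k)) f)"
  have fin: "finite {x. F k x \<noteq> 0}" for k unfolding F_def by (intro restr_finite) simp
  have l: "F k \<in> l2" for k by (intro l2_finite fin)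
  have lim: "(\<lambda>k. l2_norm (\<lambda>x. f x - F k x)) \<longlonglongrightarrow> 0"
  proof (rule tendsto_0_le)
    show "(\<lambda>k. (1 / 4 :: real) ^ k) \<longlonglongrightarrow> 0" by (rule LIMSEQ_realpow_zero) auto
    show "\<forall>\<^sub>F k in sequentially. norm (l2_norm (\<lambda>x. f x - F k x)) \<le> norm ((1 / 4 :: real) ^ k) * 1"
      using less_imp_le[OF n] by (simp add: F_def)
  qed
  have step: "l2_norm (\<lambda>x. F (Suc k) x - F k x) \<le> 2 * (1 / 4) ^ k" for k
  proof -
    have "l2_norm (\<lambda>x. F (Suc k) x - F k x)
        \<le> l2_norm (\<lambda>x. F (Suc k) x - f x) + l2_norm (\<lambda>x. f x - F k x)"
      by (intro l2_norm_diff_triangle l assms)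
    also have "\<dots> \<le> (1 / 4) ^ Suc k + (1 / 4) ^ k"
      using n[of k] n[of "Suc k"] unfolding F_def by (subst l2_norm_minus_commute) linarith
    also have "\<dots> \<le> 2 * (1 / 4) ^ k" by simp
    finally show ?thesis .
  qed
  have conv: "AE s in plancherel. convergent (\<lambda>k. component s (F k) x)" for x
  proof -
    define D where "D = (\<lambda>k s. 4 ^ k * (cmod (component s (F (Suc k)) x - component s (F k) x))\<^sup>2)"
    have [measurable]: "D k \<in> borel_measurable borel" for k unfolding D_def by measurable
    have Dint: "(\<integral>\<^sup>+s. ennreal (D k s) \<partial>plancherel) \<le> ennreal (4 * (1 / 4) ^ k)" for k
    proof -
      have eq: "component s (F (Suc k)) x - component s (F k) x = component s (\<lambda>y. F (Suc k) y - F k y) x" for s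
        using component_lincomb[OF fin fin, of s 1 "Suc k" "-1" k x] by simp
      have "(\<integral>\<^sup>+s. ennreal (D k s) \<partial>plancherel)
          = ennreal (4 ^ k) * (\<integral>\<^sup>+s. ennreal ((cmod (component s (\<lambda>y. F (Suc k) y - F k y) x))\<^sup>2) \<partial>plancherel)"
        unfolding D_def eq by (subst nn_integral_cmult[symmetric]) (auto simp: ennreal_mult)
      also have "\<dots> \<le> ennreal (4 ^ k) * ennreal ((l2_norm (\<lambda>y. F (Suc k) y - F k y))\<^sup>2)"
        using finite_lincomb_support[OF fin fin, of 1 "Suc k" "-1" k]
        by (intro mult_left_mono component_bound) auto
      also have "\<dots> \<le> ennreal (4 ^ k) * ennreal ((2 * (1 / 4) ^ k)\<^sup>2)"
        by (intro mult_left_mono ennreal_leI power_mono step) auto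
      also have "\<dots> = ennreal (4 * (1 / 4) ^ k)"
      proof -
        have "4 ^ k * (2 * (1 / 4) ^ k)\<^sup>2 = 4 * (1 / 4 :: real) ^ k"
          by (simp add: power2_eq_square field_simps)
        then show ?thesis by (simp flip: ennreal_mult)
      qed
      finally show ?thesis .
    qed
    have "(\<integral>\<^sup>+s. (\<Sum>k. ennreal (D k s)) \<partial>plancherel) = (\<Sum>k. \<integral>\<^sup>+s. ennreal (D k s) \<partial>plancherel)"
      by (rule nn_integral_suminf) measurable
    also have "\<dots> \<le> (\<Sum>k. ennreal (4 * (1 / 4) ^ k))" by (intro suminf_le Dint) auto
    also have "\<dots> = ennreal (\<Sum>k. 4 * (1 / 4) ^ k)"
      by (intro suminf_ennreal2 summable_mult summable_geometric) auto
    also have "\<dots> < \<infinity>" by simp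
    finally have "AE s in plancherel. (\<Sum>k. ennreal (D k s)) \<noteq> \<infinity>"
      by (intro nn_integral_PInf_AE) (auto simp: top.not_eq_extremum)
    then show ?thesis
    proof eventually_elim
      case (elim s)
      define K where "K = enn2real (\<Sum>k. ennreal (D k s))"
      have "ennreal (D k s) \<le> (\<Sum>k. ennreal (D k s))" for k
        using sum_le_suminf[of "\<lambda>k. ennreal (D k s)" "{k}"] by simp
      then have "ennreal (D k s) \<le> ennreal K" for k using elim by (simp add: K_def less_top)
      then have "D k s \<le> K" for k by (simp add: K_def)
      then show ?case unfolding D_def by (rule summable_convergent)
    qed
  qed
  have "has_components f (\<lambda>s x. lim (\<lambda>k. component s (F k) x))"
    unfolding has_components_def
  proof (intro conjI allI exI[of _ F] fin lim)
    show "(\<lambda>s. lim (\<lambda>k. component s (F k) x)) \<in> borel_measurable borel" for x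
      by (intro borel_measurable_lim_metric component_measurable)
    show "AE s in plancherel. \<forall>x. (\<lambda>k. component s (F k) x) \<longlonglongrightarrow> lim (\<lambda>k. component s (F k) x)"
      by (rule AE_all_vertices) (use conv in \<open>simp add: convergent_LIMSEQ_iff\<close>)
  qed
  then show ?thesis by blast
qed

end

section \<open>The Plancherel formula for the mean\<close>

context cubic_tree
begin

definition norm_upto :: "'v \<Rightarrow> real \<Rightarrow> ('v \<Rightarrow> complex) \<Rightarrow> nat \<Rightarrow> real" where
  "norm_upto r s h n = (cmod (h r))\<^sup>2 + 6 / (9 - (3 - s)\<^sup>2) * total_dev r h n"

text \<open>The normalised mean of an eigenfunction, written as a supremum of continuous functions of finitely
many values of \<open>h\<close>. In this form it is lower semicontinuous for pointwise convergence and makes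
sense before the ball averages are known to converge.\<close>

definition mean_norm :: "'v \<Rightarrow> real \<Rightarrow> ('v \<Rightarrow> complex) \<Rightarrow> ennreal" where
  "mean_norm r s h = (SUP n. ennreal (norm_upto r s h n))"

lemma norm_upto_mono: assumes "s \<in> spec_interior" shows "incseq (norm_upto r s h)"
proof -
  have "0 \<le> 6 / (9 - (3 - s)\<^sup>2)" using assms by (simp add: spec_interior_iff)
  then show ?thesis
    unfolding norm_upto_def by (intro monoI add_left_mono mult_left_mono) (auto intro: incseqD[OF total_dev_mono])
qed

lemma mean_norm_eq:
  assumes "s \<in> spec_interior" "eigen (3 - s) h" "has_mean (3 - s) h m"
  shows "mean_norm r s h = ennreal m"
proof -
  obtain v where v: "total_dev r h \<longlonglongrightarrow> v" "m = (cmod (h r))\<^sup>2 + 6 / (9 - (3 - s)\<^sup>2) * v"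
    using has_mean_total_dev[OF assms(2) _ assms(3), of r] assms(1) by (auto simp: spec_interior_iff)
  have "(\<lambda>n. ennreal (norm_upto r s h n)) \<longlonglongrightarrow> ennreal m"
    unfolding v(2) norm_upto_def by (intro tendsto_ennrealI tendsto_intros v)
  moreover have "(\<lambda>n. ennreal (norm_upto r s h n)) \<longlonglongrightarrow> mean_norm r s h"
    unfolding mean_norm_def using norm_upto_mono[OF assms(1), of r h]
    by (intro LIMSEQ_SUP) (auto simp: mono_def intro: ennreal_leI)
  ultimately show ?thesis by (rule LIMSEQ_unique[symmetric])
qed

lemma has_mean_mean_norm:
  assumes "s \<in> spec_interior" "eigen (3 - s) h" "mean_norm r s h \<noteq> \<infinity>"
  shows "has_mean (3 - s) h (enn2real (mean_norm r s h))"
proof -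
  have s: "(3 - s)\<^sup>2 < 8" using assms(1) by (simp add: spec_interior_iff)
  then have c: "0 < 6 / (9 - (3 - s)\<^sup>2)" by simp
  have "total_dev r h n \<le> enn2real (mean_norm r s h) / (6 / (9 - (3 - s)\<^sup>2))" for n
  proof -
    have "ennreal (norm_upto r s h n) \<le> mean_norm r s h" unfolding mean_norm_def by (rule SUP_upper) simp
    then have "ennreal (norm_upto r s h n) \<le> ennreal (enn2real (mean_norm r s h))" using assms(3) by (simp add: less_top)
    then have "norm_upto r s h n \<le> enn2real (mean_norm r s h)" by simp
    then have "6 / (9 - (3 - s)\<^sup>2) * total_dev r h n \<le> enn2real (mean_norm r s h)"
      unfolding norm_upto_def using zero_le_power2[of "cmod (h r)"] by linarith
    then show ?thesis unfolding pos_le_divide_eq[OF c] by (simp only: mult.commute)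
  qed
  then obtain v where "total_dev r h \<longlonglongrightarrow> v"
    using incseq_convergent[OF total_dev_mono] by blast
  from has_meanI[OF assms(2) s this] have m: "has_mean (3 - s) h ((cmod (h r))\<^sup>2 + 6 / (9 - (3 - s)\<^sup>2) * v)" .
  moreover have "0 \<le> (cmod (h r))\<^sup>2 + 6 / (9 - (3 - s)\<^sup>2) * v"
    using has_mean_ge[OF assms(2) s m, of r] zero_le_power2 order_trans by blast
  ultimately show ?thesis using mean_norm_eq[OF assms(1,2) m, of r] by simp
qed

lemma mean_norm_measurable:
  assumes "\<And>x. (\<lambda>s. g s x) \<in> borel_measurable borel"
  shows "(\<lambda>s. mean_norm r s (g s)) \<in> borel_measurable borel"
  unfolding mean_norm_def norm_upto_def total_dev_def sq_dev_def using assms by measurable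

text \<open>The upper bound is Fatou's lemma. For the lower bound, expand the nonnegative mean of
\<open>g s - component s (F k)\<close> with the reproducing property and integrate: the integral of the mean of
\<open>g s\<close> is at least \<open>\<parallel>f\<parallel>\<^sup>2 - \<parallel>f - F k\<parallel>\<^sup>2\<close>.\<close>

theorem components_parseval:
  assumes "f \<in> l2" "has_components f g"
  shows "(\<integral>\<^sup>+s. mean_norm r s (g s) \<partial>plancherel) = ennreal ((l2_norm f)\<^sup>2)"
    and "AE s in plancherel. has_mean (3 - s) (g s) (enn2real (mean_norm r s (g s)))"
proof -
  obtain F where F: "\<And>k::nat. finite {x. F k x \<noteq> 0}" "(\<lambda>k. l2_norm (\<lambda>x. f x - F k x)) \<longlonglongrightarrow> 0"
    "AE s in plancherel. \<forall>x. (\<lambda>k. component s (F k) x) \<longlonglongrightarrow> g s x" using assms(2) by (auto simp: has_components_def)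
  have lF: "F k \<in> l2" for k by (rule l2_finite[OF F(1)])
  note meas[measurable] = components_measurable[OF assms(2)]
  have [measurable]: "(\<lambda>s. mean_norm r s (g s)) \<in> borel_measurable borel" by (rule mean_norm_measurable) measurable
  have [measurable]: "(\<lambda>s. mean_norm r s (component s u)) \<in> borel_measurable borel" for u by (rule mean_norm_measurable) measurable
  have le1: "AE s in plancherel. mean_norm r s (g s) \<le> liminf (\<lambda>k. mean_norm r s (component s (F k)))"
    using F(3) AE_spec_interior
  proof eventually_elim
    case (elim s)
    have "ennreal (norm_upto r s (g s) n) \<le> liminf (\<lambda>k. mean_norm r s (component s (F k)))" for n
    proof -
      have "(\<lambda>k. ennreal (norm_upto r s (component s (F k)) n)) \<longlonglongrightarrow> ennreal (norm_upto r s (g s) n)"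
        unfolding norm_upto_def total_dev_def sq_dev_def using elim(1)
        by (intro tendsto_ennrealI tendsto_intros) auto
      then have "ennreal (norm_upto r s (g s) n) = liminf (\<lambda>k. ennreal (norm_upto r s (component s (F k)) n))"
        by (rule lim_imp_Liminf[OF sequentially_bot, symmetric])
      also have "\<dots> \<le> liminf (\<lambda>k. mean_norm r s (component s (F k)))"
        unfolding mean_norm_def by (intro Liminf_mono always_eventually allI SUP_upper) auto
      finally show ?thesis .
    qed
    then show ?case unfolding mean_norm_def[of r s "g s"] by (intro SUP_least)
  qed
  have gramE: "(\<integral>\<^sup>+s. mean_norm r s (component s u) \<partial>plancherel) = ennreal ((l2_norm u)\<^sup>2)"
    if "finite {x. u x \<noteq> 0}" for u
    unfolding nn_integral_gram[OF that, symmetric]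
    by (rule nn_integral_cong_AE, use AE_spec_interior in eventually_elim)
       (rule mean_norm_eq[OF _ eigen_component has_mean_component[OF that]])
  have n: "(\<lambda>k. ennreal ((l2_norm (F k))\<^sup>2)) \<longlonglongrightarrow> ennreal ((l2_norm f)\<^sup>2)"
    by (intro tendsto_ennrealI tendsto_power l2_tendsto_norm[OF lF assms(1) F(2)])
  have "(\<integral>\<^sup>+s. mean_norm r s (g s) \<partial>plancherel) \<le> (\<integral>\<^sup>+s. liminf (\<lambda>k. mean_norm r s (component s (F k))) \<partial>plancherel)"
    by (rule nn_integral_mono_AE[OF le1])
  also have "\<dots> \<le> liminf (\<lambda>k. \<integral>\<^sup>+s. mean_norm r s (component s (F k)) \<partial>plancherel)"
    by (rule nn_integral_liminf) measurable
  also have "\<dots> = liminf (\<lambda>k. ennreal ((l2_norm (F k))\<^sup>2))" by (simp add: gramE F)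
  also have "\<dots> = ennreal ((l2_norm f)\<^sup>2)" by (rule lim_imp_Liminf[OF sequentially_bot n])
  finally have upper: "(\<integral>\<^sup>+s. mean_norm r s (g s) \<partial>plancherel) \<le> ennreal ((l2_norm f)\<^sup>2)" .
  then have "(\<integral>\<^sup>+s. mean_norm r s (g s) \<partial>plancherel) \<noteq> \<infinity>" by (metis ennreal_less_top infinity_ennreal_def leD)
  then have "AE s in plancherel. mean_norm r s (g s) \<noteq> \<infinity>" by (intro nn_integral_PInf_AE) measurable
  then have fin: "AE s in plancherel. s \<in> spec_interior \<and> eigen (3 - s) (g s) \<and> mean_norm r s (g s) \<noteq> \<infinity>"
    using AE_spec_interior components_eigen[OF assms(2)] by eventually_elim simp
  then show mean: "AE s in plancherel. has_mean (3 - s) (g s) (enn2real (mean_norm r s (g s)))"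
    by eventually_elim (use has_mean_mean_norm in blast)
  define m where "m = (\<lambda>s. enn2real (mean_norm r s (g s)))"
  have [measurable]: "m \<in> borel_measurable borel" unfolding m_def by measurable
  have mE: "(\<integral>\<^sup>+s. ennreal (m s) \<partial>plancherel) = (\<integral>\<^sup>+s. mean_norm r s (g s) \<partial>plancherel)"
    by (rule nn_integral_cong_AE, use fin in eventually_elim) (simp add: m_def less_top)
  have mint: "integrable plancherel m"
    using upper unfolding mE[symmetric]
    by (intro integrableI_nonneg) (auto simp: m_def intro: order_le_less_trans)
  have lower: "2 * Re (l2_inner f (F k)) - (l2_norm (F k))\<^sup>2 \<le> (LINT s|plancherel. m s)" for k
  proof -
    let ?X = "{x. F k x \<noteq> 0}"
    define c where "c = (\<lambda>s. 2 * Re (\<Sum>x\<in>?X. cnj (F k x) * g s x) - gram s (F k))"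
    have gi: "integrable plancherel (\<lambda>s. g s x)" for x by (rule components_integrable'[OF assms])
    have si: "integrable plancherel (\<lambda>s. \<Sum>x\<in>?X. cnj (F k x) * g s x)"
      using gi by (intro Bochner_Integration.integrable_sum integrable_mult_right)
    have ci: "integrable plancherel c"
      unfolding c_def using si gram_integral(1)[OF F(1)]
      by (intro Bochner_Integration.integrable_diff integrable_mult_right integrable_Re)
    have "(LINT s|plancherel. (\<Sum>x\<in>?X. cnj (F k x) * g s x)) = (\<Sum>x\<in>?X. cnj (F k x) * f x)"
      using gi components_integral[OF assms] by (simp add: Bochner_Integration.integral_sum)
    also have "\<dots> = cnj (l2_inner (F k) f)"
      by (simp add: l2_inner_finite[OF F(1) order_refl])
    also have "\<dots> = l2_inner f (F k)" by (rule l2_inner_cnj[symmetric])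
    finally have "(LINT s|plancherel. c s) = 2 * Re (l2_inner f (F k)) - (l2_norm (F k))\<^sup>2"
      unfolding c_def using si gram_integral[OF F(1)]
      by (subst Bochner_Integration.integral_diff)
         (auto simp del: Re_sum simp: integral_Re intro!: integrable_mult_right integrable_Re)
    moreover have "(LINT s|plancherel. c s) \<le> (LINT s|plancherel. m s)"
    proof (rule integral_mono_AE[OF ci mint])
      show "AE s in plancherel. c s \<le> m s"
        using mean fin
      proof eventually_elim
        case (elim s)
        then have s: "s \<in> spec_interior" "eigen (3 - s) (g s)" "has_mean (3 - s) (g s) (m s)"
          by (auto simp: m_def)
        note p = has_mean_minus_component[OF F(1) s(2,1,3)]
        have "0 \<le> m s - 2 * Re (\<Sum>x | F k x \<noteq> 0. cnj (F k x) * g s x) + gram s (F k)"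
          by (rule order_trans[OF zero_le_power2 has_mean_ge[OF p(2) _ p(1)]])
             (use s(1) in \<open>simp add: spec_interior_iff\<close>)
        then show ?case by (simp add: c_def del: Re_sum)
      qed
    qed
    ultimately show ?thesis by simp
  qed
  have "(\<lambda>k. 2 * Re (l2_inner (F k) f) - (l2_norm (F k))\<^sup>2) \<longlonglongrightarrow> 2 * Re (l2_inner f f) - (l2_norm f)\<^sup>2"
    by (intro tendsto_intros l2_tendsto_inner[OF lF assms(1,1) F(2)] l2_tendsto_norm[OF lF assms(1) F(2)])
  moreover have "2 * Re (l2_inner (F k) f) - (l2_norm (F k))\<^sup>2 \<le> (LINT s|plancherel. m s)" for k
    using lower[of k] l2_inner_cnj[of f "F k"] by simp
  ultimately have "2 * Re (l2_inner f f) - (l2_norm f)\<^sup>2 \<le> (LINT s|plancherel. m s)"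
    by (meson LIMSEQ_le_const2)
  then have "ennreal ((l2_norm f)\<^sup>2) \<le> ennreal (LINT s|plancherel. m s)"
    by (intro ennreal_leI) (simp add: l2_inner_self[OF assms(1)])
  also have "\<dots> = (\<integral>\<^sup>+s. mean_norm r s (g s) \<partial>plancherel)"
    unfolding mE[symmetric] by (rule nn_integral_eq_integral[OF mint, symmetric]) (simp add: m_def)
  finally show "(\<integral>\<^sup>+s. mean_norm r s (g s) \<partial>plancherel) = ennreal ((l2_norm f)\<^sup>2)"
    using upper by (rule antisym[rotated])
qed

end

section \<open>Identification of the spectral projections\<close>

locale spectral_tree = cubic_tree adj for adj :: "'v \<Rightarrow> 'v \<Rightarrow> bool" +
  fixes E :: "real set \<Rightarrow> ('v \<Rightarrow> complex) \<Rightarrow> 'v \<Rightarrow> complex"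
  assumes resolution: "spectral_resolution (neg_laplacian adj) E"
begin

lemma pvm: "projection_valued_measure E"
  using resolution by (simp add: spectral_resolution_def)

lemma E_l2: "I \<in> sets borel \<Longrightarrow> f \<in> l2 \<Longrightarrow> E I f \<in> l2"
  using pvm by (simp add: projection_valued_measure_def)

lemma E_lincomb: "I \<in> sets borel \<Longrightarrow> f \<in> l2 \<Longrightarrow> g \<in> l2 \<Longrightarrow>
    E I (\<lambda>x. a * f x + b * g x) = (\<lambda>x. a * E I f x + b * E I g x)"
  using pvm by (simp add: projection_valued_measure_def)

lemma E_symmetric: "I \<in> sets borel \<Longrightarrow> f \<in> l2 \<Longrightarrow> g \<in> l2 \<Longrightarrow> l2_inner (E I f) g = l2_inner f (E I g)"
  using pvm by (simp add: projection_valued_measure_def)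

lemma E_mult: "I \<in> sets borel \<Longrightarrow> J \<in> sets borel \<Longrightarrow> f \<in> l2 \<Longrightarrow> E I (E J f) = E (I \<inter> J) f"
  using pvm by (simp add: projection_valued_measure_def)

lemma E_UNIV: "f \<in> l2 \<Longrightarrow> E UNIV f = f"
  using pvm by (simp add: projection_valued_measure_def)

lemma E_partial_sum_l2:
  assumes "range B \<subseteq> sets borel" "f \<in> l2" shows "(\<lambda>x. \<Sum>n<(N::nat). E (B n) f x) \<in> l2"
proof (induction N)
  case (Suc N)
  then show ?case using l2_add[OF Suc E_l2[of "B N" f]] assms by (simp add: image_subset_iff)
qed simp

lemma E_sums_norm:
  assumes "range B \<subseteq> sets borel" "disjoint_family B" "f \<in> l2"
  shows "(\<lambda>N. l2_norm (\<lambda>x. E (\<Union>n::nat. B n) f x - (\<Sum>n<N. E (B n) f x))) \<longlonglongrightarrow> 0"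
proof -
  have "(\<lambda>N. l2_norm (\<lambda>x. (\<Sum>n<N. E (B n) f x) - E (\<Union>n. B n) f x)) \<longlonglongrightarrow> 0"
    using pvm assms unfolding projection_valued_measure_def by blast
  then show ?thesis by (simp add: l2_norm_minus_commute[of "E (\<Union>n. B n) f"])
qed

lemma E_sums:
  assumes "range B \<subseteq> sets borel" "disjoint_family B" "f \<in> l2"
  shows "(\<lambda>n::nat. E (B n) f x) sums E (\<Union>n. B n) f x"
  unfolding sums_def
  by (rule l2_tendsto_pointwise[OF E_partial_sum_l2[OF assms(1,3)] E_l2[OF _ assms(3)] E_sums_norm[OF assms]])
     (use assms(1) in auto)

lemma E_empty: assumes "f \<in> l2" shows "E {} f = (\<lambda>x. 0)"
proof
  fix x
  have "(\<lambda>n::nat. E {} f x) sums E {} f x"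
    using E_sums[of "\<lambda>n. {}" f x] assms by (simp add: disjoint_family_on_def)
  then have "(\<lambda>n::nat. E {} f x) \<longlonglongrightarrow> 0" by (intro summable_LIMSEQ_zero) (rule sums_summable)
  then show "E {} f x = 0" by (simp add: LIMSEQ_const_iff)
qed

lemma E_complement:
  assumes "f \<in> l2" "I \<in> sets borel" shows "E I f x + E (- I) f x = f x"
proof -
  define B where "B = (\<lambda>n::nat. if n = 0 then I else if n = 1 then - I else {})"
  have "(\<lambda>n. E (B n) f x) sums E (\<Union>n. B n) f x"
    by (rule E_sums) (use assms in \<open>auto simp: B_def disjoint_family_on_def\<close>)
  moreover have "(\<Union>n. B n) = UNIV"
  proof -
    have "B 0 \<union> B 1 = UNIV" by (auto simp: B_def)
    then show ?thesis by blast
  qed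
  moreover have "(\<lambda>n. E (B n) f x) sums (\<Sum>n\<in>{0, 1}. E (B n) f x)"
    by (rule sums_finite) (auto simp: B_def E_empty[OF assms(1)])
  ultimately show ?thesis using sums_unique2 by (fastforce simp: B_def E_UNIV[OF assms(1)])
qed

lemma E_norm_sq:
  assumes "f \<in> l2" "I \<in> sets borel"
  shows "(l2_norm (E I f))\<^sup>2 = Re (l2_inner (E I f) f)"
proof -
  have "of_real ((l2_norm (E I f))\<^sup>2) = l2_inner (E I f) (E I f)"
    by (rule l2_inner_self[OF E_l2[OF assms(2,1)], symmetric])
  also have "\<dots> = l2_inner (E I f) f"
    using E_symmetric[OF assms(2) E_l2[OF assms(2,1)] assms(1)] E_mult[OF assms(2,2,1)] by simp
  finally show ?thesis by (metis Re_complex_of_real)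
qed

lemma sets_spectral [simp, measurable_cong]: "sets (scalar_spectral_measure E f) = sets borel"
  unfolding scalar_spectral_measure_def
  by (metis sets.sigma_sets_eq sets_measure_of sets.space_closed space_borel)

text \<open>Since \<open>\<parallel>E\<^sub>I f\<parallel>\<^sup>2 = \<langle>E\<^sub>I f, f\<rangle>\<close> is linear in \<open>E\<^sub>I f\<close>, strong additivity of \<open>E\<close> makes it countably
additive in \<open>I\<close>.\<close>

lemma emeasure_spectral:
  assumes "f \<in> l2" "I \<in> sets borel"
  shows "emeasure (scalar_spectral_measure E f) I = ennreal ((l2_norm (E I f))\<^sup>2)"
proof (rule emeasure_measure_of[OF scalar_spectral_measure_def])
  show "I \<in> sets (scalar_spectral_measure E f)" using assms(2) by simp
  show "positive (sets (scalar_spectral_measure E f)) (\<lambda>I. ennreal ((l2_norm (E I f))\<^sup>2))"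
    by (simp add: positive_def E_empty[OF assms(1)])
  show "countably_additive (sets (scalar_spectral_measure E f)) (\<lambda>I. ennreal ((l2_norm (E I f))\<^sup>2))"
    unfolding sets_spectral
  proof (rule countably_additiveI)
    fix B :: "nat \<Rightarrow> real set"
    assume B: "range B \<subseteq> sets borel" "disjoint_family B" "(\<Union>n. B n) \<in> sets borel"
    have Bn: "B n \<in> sets borel" for n using B(1) by auto
    have part: "Re (l2_inner (\<lambda>x. \<Sum>n<N. E (B n) f x) f) = (\<Sum>n<N. (l2_norm (E (B n) f))\<^sup>2)" for N
    proof (induction N)
      case (Suc N)
      then show ?case
        using l2_inner_add_left[OF E_partial_sum_l2[OF B(1) assms(1), of N] E_l2[OF Bn assms(1), of N] assms(1), of 1 1]
        by (simp add: E_norm_sq[OF assms(1) Bn])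
    qed (simp add: l2_inner_def)
    have "(\<lambda>N. Re (l2_inner (\<lambda>x. \<Sum>n<N. E (B n) f x) f)) \<longlonglongrightarrow> Re (l2_inner (E (\<Union>n. B n) f) f)"
      by (intro tendsto_Re l2_tendsto_inner[OF E_partial_sum_l2[OF B(1) assms(1)] E_l2[OF B(3) assms(1)] assms(1)
            E_sums_norm[OF B(1,2) assms(1)]])
    then have "(\<lambda>n. (l2_norm (E (B n) f))\<^sup>2) sums (l2_norm (E (\<Union>n. B n) f))\<^sup>2"
      unfolding part sums_def E_norm_sq[OF assms(1) B(3)] .
    then show "(\<Sum>n. ennreal ((l2_norm (E (B n) f))\<^sup>2)) = ennreal ((l2_norm (E (\<Union>n. B n) f))\<^sup>2)"
      by (intro suminf_ennreal_eq) auto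
  qed
qed auto

lemma space_spectral [simp]: "space (scalar_spectral_measure E f) = UNIV"
  by (simp add: scalar_spectral_measure_def space_measure_of_conv)

lemma A_form:
  "f \<in> l2 \<Longrightarrow> l2_inner (A f) f = complex_of_real (\<integral>s. s \<partial>scalar_spectral_measure E f)"
  using resolution by (simp add: spectral_resolution_def)

lemma finite_spectral: assumes "f \<in> l2" shows "finite_measure (scalar_spectral_measure E f)"
  by (rule finite_measureI) (simp add: emeasure_spectral[OF assms])

lemma measure_spectral_UNIV:
  assumes "f \<in> l2" shows "measure (scalar_spectral_measure E f) UNIV = (l2_norm f)\<^sup>2"
  by (simp add: measure_def emeasure_spectral[OF assms] E_UNIV[OF assms])

lemma integrable_spectral:
  assumes "f \<in> l2" shows "integrable (scalar_spectral_measure E f) (\<lambda>s. s)"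
proof -
  interpret finite_measure "scalar_spectral_measure E f" by (rule finite_spectral[OF assms])
  have "integrable (scalar_spectral_measure E f) (\<lambda>s. s\<^sup>2)"
    using resolution assms by (simp add: spectral_resolution_def)
  then have int: "integrable (scalar_spectral_measure E f) (\<lambda>s. 1 + s\<^sup>2)" by simp
  have "norm s \<le> norm (1 + s\<^sup>2)" for s :: real
    using zero_le_power2[of "\<bar>s\<bar> - 1"] zero_le_power2[of s] by (simp add: power2_diff)
  then show ?thesis by (intro Bochner_Integration.integrable_bound[OF int]) auto
qed

lemma AE_spectral:
  assumes "f \<in> l2" "J \<in> sets borel" "E J f = f"
  shows "AE s in scalar_spectral_measure E f. s \<in> J"
proof (rule AE_I[where N = "- J"])
  have "E (- J) f = E (- J \<inter> J) f" using E_mult[of "- J" J f] assms by simp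
  then show "emeasure (scalar_spectral_measure E f) (- J) = 0"
    using assms by (simp add: emeasure_spectral E_empty)
qed (use assms in auto)

lemma form_upper:
  assumes "f \<in> l2" "J \<in> sets borel" "E J f = f" "J \<subseteq> {..b}"
  shows "Re (l2_inner (A f) f) \<le> b * (l2_norm f)\<^sup>2"
proof -
  interpret finite_measure "scalar_spectral_measure E f" by (rule finite_spectral[OF assms(1)])
  have "(\<integral>s. s \<partial>scalar_spectral_measure E f) \<le> (\<integral>s. b \<partial>scalar_spectral_measure E f)"
    by (rule integral_mono_AE[OF integrable_spectral[OF assms(1)]])
       (use AE_spectral[OF assms(1-3)] assms(4) in auto)
  then show ?thesis by (simp add: A_form[OF assms(1)] measure_spectral_UNIV[OF assms(1)] mult.commute)
qed

lemma form_lower: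
  assumes "f \<in> l2" "J \<in> sets borel" "E J f = f" "J \<subseteq> {a..}"
  shows "a * (l2_norm f)\<^sup>2 \<le> Re (l2_inner (A f) f)"
proof -
  interpret finite_measure "scalar_spectral_measure E f" by (rule finite_spectral[OF assms(1)])
  have "(\<integral>s. a \<partial>scalar_spectral_measure E f) \<le> (\<integral>s. s \<partial>scalar_spectral_measure E f)"
    by (rule integral_mono_AE[OF _ integrable_spectral[OF assms(1)]])
       (use AE_spectral[OF assms(1-3)] assms(4) in auto)
  then show ?thesis by (simp add: A_form[OF assms(1)] measure_spectral_UNIV[OF assms(1)] mult.commute)
qed

lemma E_orthogonal:
  assumes "f \<in> l2" "g \<in> l2" "I \<in> sets borel" "J \<in> sets borel" "I \<inter> J = {}"
  shows "l2_inner (E I f) (E J g) = 0"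
proof -
  have "l2_inner (E I f) (E J g) = l2_inner f (E I (E J g))"
    using assms by (intro E_symmetric E_l2)
  also have "\<dots> = 0" using assms by (simp add: E_mult E_empty l2_inner_def)
  finally show ?thesis .
qed

text \<open>For orthogonal pieces the spectral measure of \<open>f + z g\<close> is the sum of the two spectral measures
whenever \<open>\<bar>z\<bar> = 1\<close>. So the quadratic form of \<open>A\<close> at \<open>f + z g\<close> is the same for all such \<open>z\<close>, which
forces the mixed term to vanish.\<close>

lemma A_orthogonal:
  assumes "f \<in> l2" "g \<in> l2" "J \<in> sets borel" "E J f = f" "E (- J) g = g"
  shows "l2_inner (A f) g = 0"
proof -
  define w where "w = l2_inner (A f) g"
  let ?h = "\<lambda>z x. f x + z * g x"
  have h: "?h z \<in> l2" for z using l2_lincomb[OF assms(1,2), of 1 z] by simp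
  have norm: "(l2_norm (E I (?h z)))\<^sup>2 = (l2_norm (E I f))\<^sup>2 + (l2_norm (E I g))\<^sup>2"
    if "I \<in> sets borel" "cmod z = 1" for I z
  proof -
    have "E I f = E (I \<inter> J) f" "E I g = E (I \<inter> - J) g"
      using E_mult[of I J f] E_mult[of I "- J" g] assms that by auto
    then have "l2_inner (E I f) (E I g) = 0"
      using E_orthogonal[of f g "I \<inter> J" "I \<inter> - J"] assms that by auto
    then show ?thesis
      using E_lincomb[OF that(1) assms(1,2), of 1 z]
        l2_norm_add_sq[OF E_l2[OF that(1) assms(1)] E_l2[OF that(1) assms(2)], of z] that(2) by simp
  qed
  have mu: "scalar_spectral_measure E (?h z) = scalar_spectral_measure E (?h 1)" if "cmod z = 1" for z
    unfolding scalar_spectral_measure_def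
  proof (rule measure_of_eq)
    fix I assume "I \<in> sigma_sets UNIV (sets (borel :: real measure))"
    then have "I \<in> sets borel" by (metis sets.sigma_sets_eq space_borel)
    then show "ennreal ((l2_norm (E I (?h z)))\<^sup>2) = ennreal ((l2_norm (E I (?h 1)))\<^sup>2)"
      using norm[of I z] norm[of I 1] that by simp
  qed simp
  have form: "Re (l2_inner (A (?h z)) (?h z)) = Re (l2_inner (A f) f) + Re (l2_inner (A g) g) + 2 * Re (cnj z * w)"
    if "cmod z = 1" for z
  proof -
    have l: "A f \<in> l2" "A g \<in> l2" by (rule A_l2; fact)+
    have "l2_inner (A (?h z)) (?h z) = l2_inner (\<lambda>x. 1 * A f x + z * A g x) (\<lambda>x. 1 * f x + z * g x)"
      using A_lincomb[of 1 f z g] by simp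
    also have "\<dots> = l2_inner (A f) f + cnj z * w + z * l2_inner (A g) f + z * cnj z * l2_inner (A g) g"
      unfolding l2_inner_add_left[OF l l2_lincomb[OF assms(1,2)]] l2_inner_add_right[OF assms(1,2) l(1)]
        l2_inner_add_right[OF assms(1,2) l(2)] w_def by (simp add: algebra_simps)
    also have "l2_inner (A g) f = cnj w"
      unfolding A_symmetric[OF assms(2,1)] w_def by (rule l2_inner_cnj)
    also have "z * cnj z = 1" using that by (simp add: complex_norm_square[symmetric])
    also have "z * cnj w = cnj (cnj z * w)" by simp
    finally show ?thesis by (simp only: plus_complex.simps cnj.simps mult_1)
  qed
  have const: "Re (cnj z * w) = Re w" if "cmod z = 1" for z
    using form[OF that] form[of 1] A_form[OF h, of z] A_form[OF h, of 1] mu[OF that] by simp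
  have "Re w = 0" "Im w = 0" using const[of "-1"] const[of \<i>] const[of "- \<i>"] by auto
  then show ?thesis by (simp add: w_def complex_eq_iff)
qed

text \<open>The quadratic form alone is known to be the integral of the spectral measure; this lemma recovers
from it that \<open>A\<close> commutes with the projections.\<close>

lemma A_invariant:
  assumes "f \<in> l2" "J \<in> sets borel" "E J f = f" shows "E J (A f) = A f"
proof -
  have l: "A f \<in> l2" by (rule A_l2[OF assms(1)])
  have J: "- J \<in> sets borel" using assms(2) by auto
  have l': "E (- J) (A f) \<in> l2" by (rule E_l2[OF J l])
  have "l2_inner (A f) (E (- J) (A f)) = 0"
    using E_mult[OF J J l] by (intro A_orthogonal[OF assms(1) l' assms(2,3)]) simp
  then have "(l2_norm (E (- J) (A f)))\<^sup>2 = 0"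
    using E_norm_sq[OF l J] E_symmetric[OF J l l] by simp
  then have "E (- J) (A f) = (\<lambda>x. 0)" using l2_norm_zero_iff[OF l'] by simp
  then show ?thesis using E_complement[OF l assms(2)] by (auto simp: fun_eq_iff)
qed

definition shifted :: "real \<Rightarrow> ('v \<Rightarrow> complex) \<Rightarrow> 'v \<Rightarrow> complex" where
  "shifted c f = (\<lambda>x. 1 * A f x + (- of_real c) * f x)"

lemma shifted_l2: "f \<in> l2 \<Longrightarrow> shifted c f \<in> l2"
  unfolding shifted_def by (intro l2_lincomb A_l2)

lemma shifted_invariant:
  assumes "f \<in> l2" "J \<in> sets borel" "E J f = f" shows "E J (shifted c f) = shifted c f"
  unfolding shifted_def E_lincomb[OF assms(2) A_l2(1)[OF assms(1)] assms(1)] A_invariant[OF assms] assms(3) ..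

lemma components_shifted:
  assumes "f \<in> l2" "has_components f g" shows "has_components (shifted c f) (\<lambda>s x. of_real (s - c) * g s x)"
  using components_lincomb[OF A_l2(1)[OF assms(1)] assms(1) components_A[OF assms] assms(2), of 1 "- of_real c"]
  by (simp add: shifted_def algebra_simps)

lemma shifted_form:
  assumes "f \<in> l2" "g \<in> l2"
  shows "Re (l2_inner (shifted c (\<lambda>x. f x + of_real t * g x)) (\<lambda>x. f x + of_real t * g x))
     = Re (l2_inner (shifted c f) f) + t\<^sup>2 * Re (l2_inner (shifted c g) g) + 2 * t * Re (l2_inner (shifted c f) g)"
proof -
  note l = shifted_l2[OF assms(1), of c] shifted_l2[OF assms(2), of c]
  have "shifted c (\<lambda>x. f x + of_real t * g x) = (\<lambda>x. 1 * shifted c f x + of_real t * shifted c g x)"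
    using A_lincomb[of 1 f "of_real t" g] by (simp add: shifted_def fun_eq_iff algebra_simps)
  then have "l2_inner (shifted c (\<lambda>x. f x + of_real t * g x)) (\<lambda>x. f x + of_real t * g x)
      = l2_inner (\<lambda>x. 1 * shifted c f x + of_real t * shifted c g x) (\<lambda>x. 1 * f x + of_real t * g x)"
    by simp
  also have "\<dots> = l2_inner (shifted c f) f + of_real t * l2_inner (shifted c f) g
      + of_real t * l2_inner (shifted c g) f + of_real (t * t) * l2_inner (shifted c g) g"
    unfolding l2_inner_add_left[OF l l2_lincomb[OF assms]] l2_inner_add_right[OF assms l(1)]
      l2_inner_add_right[OF assms l(2)]
    by (simp add: algebra_simps)
  finally have e: "Re (l2_inner (shifted c (\<lambda>x. f x + of_real t * g x)) (\<lambda>x. f x + of_real t * g x))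
      = Re (l2_inner (shifted c f) f) + t * Re (l2_inner (shifted c f) g)
      + t * Re (l2_inner (shifted c g) f) + t * t * Re (l2_inner (shifted c g) g)"
    by simp
  have "l2_inner (shifted c g) f = l2_inner g (shifted c f)"
    unfolding shifted_def
      l2_inner_add_left[OF A_l2(1)[OF assms(2)] assms(2) assms(1)]
      l2_inner_add_right[OF A_l2(1)[OF assms(1)] assms(1) assms(2)]
      A_symmetric[OF assms(2,1)] by simp
  then have "Re (l2_inner (shifted c g) f) = Re (l2_inner (shifted c f) g)"
    using l2_inner_cnj[of g "shifted c f"] by simp
  then show ?thesis unfolding e by (simp add: power2_eq_square)
qed

text \<open>A symmetric operator whose quadratic form is bounded by \<open>\<rho>\<close> has norm at most \<open>\<rho>\<close>. The proof
polarizes with \<open>f\<close> and \<open>(A f - c f) / \<rho>\<close>, which stay in the range of the projection.\<close>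

lemma shifted_norm:
  assumes "f \<in> l2" "J \<in> sets borel" "E J f = f"
    and bounds: "\<And>k. k \<in> l2 \<Longrightarrow> E J k = k \<Longrightarrow>
      (c - \<rho>) * (l2_norm k)\<^sup>2 \<le> Re (l2_inner (A k) k) \<and> Re (l2_inner (A k) k) \<le> (c + \<rho>) * (l2_norm k)\<^sup>2"
    and "0 < \<rho>"
  shows "l2_norm (shifted c f) \<le> \<rho> * l2_norm f"
proof -
  let ?T = "shifted c f"
  note l = shifted_l2[OF assms(1), of c]
  have q: "\<bar>Re (l2_inner (shifted c k) k)\<bar> \<le> \<rho> * (l2_norm k)\<^sup>2" if "k \<in> l2" "E J k = k" for k
  proof -
    have "Re (l2_inner (shifted c k) k) = Re (l2_inner (A k) k) - c * (l2_norm k)\<^sup>2"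
      unfolding shifted_def l2_inner_add_left[OF A_l2(1)[OF that(1)] that(1,1)] l2_inner_self[OF that(1)]
      by simp
    then show ?thesis using bounds[OF that] by (simp add: abs_le_iff algebra_simps)
  qed
  have k: "(\<lambda>x. f x + of_real t * ?T x) \<in> l2" "E J (\<lambda>x. f x + of_real t * ?T x) = (\<lambda>x. f x + of_real t * ?T x)" for t
    using l2_lincomb[OF assms(1) l, of 1 "of_real t"]
      E_lincomb[OF assms(2) assms(1) l, of 1 "of_real t"] shifted_invariant[OF assms(1-3)] assms(3) by auto
  define t where "t = 1 / \<rho>"
  define X where "X = (l2_norm ?T)\<^sup>2"
  define Y where "Y = (l2_norm f)\<^sup>2"
  have inner: "Re (l2_inner ?T ?T) = X" by (simp add: l2_inner_self[OF l] X_def)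
  have n: "(l2_norm (\<lambda>x. f x + of_real u * ?T x))\<^sup>2 = Y + u\<^sup>2 * X + 2 * u * Re (l2_inner f ?T)" for u
    unfolding l2_norm_add_sq[OF assms(1) l] X_def Y_def by simp
  have "Re (l2_inner (shifted c (\<lambda>x. f x + of_real t * ?T x)) (\<lambda>x. f x + of_real t * ?T x))
      - Re (l2_inner (shifted c (\<lambda>x. f x + of_real (- t) * ?T x)) (\<lambda>x. f x + of_real (- t) * ?T x)) = 4 * t * X"
    unfolding shifted_form[OF assms(1) l] inner by simp
  then have "4 * t * X \<le> \<rho> * (l2_norm (\<lambda>x. f x + of_real t * ?T x))\<^sup>2
      + \<rho> * (l2_norm (\<lambda>x. f x + of_real (- t) * ?T x))\<^sup>2"
    using q[OF k, of t] q[OF k, of "- t"] by linarith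
  also have "\<dots> = 2 * \<rho> * (Y + t\<^sup>2 * X)" unfolding n by (simp add: algebra_simps)
  finally have "X \<le> \<rho>\<^sup>2 * Y" using assms(5) by (simp add: t_def field_simps power2_eq_square)
  then have "(l2_norm ?T)\<^sup>2 \<le> (\<rho> * l2_norm f)\<^sup>2" by (simp add: X_def Y_def power_mult_distrib)
  then show ?thesis by (rule power2_le_imp_le) (use assms(5) in simp)
qed

text \<open>The powers of \<open>A - c\<close> enlarge the norm by at most \<open>\<rho>^n\<close> but multiply the components by
\<open>(s - c)^n\<close>. A nonzero component at \<open>\<bar>s - c\<bar> > \<rho>\<close> would therefore violate the uniform bound on the
rescaled integrals, by Fatou's lemma.\<close>

lemma components_vanish:
  assumes f: "f \<in> l2" "J \<in> sets borel" "E J f = f" "has_components f g"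
    and bounds: "\<And>k. k \<in> l2 \<Longrightarrow> E J k = k \<Longrightarrow>
      (c - \<rho>) * (l2_norm k)\<^sup>2 \<le> Re (l2_inner (A k) k) \<and> Re (l2_inner (A k) k) \<le> (c + \<rho>) * (l2_norm k)\<^sup>2"
    and "0 < \<rho>"
  shows "AE s in plancherel. \<rho> < \<bar>s - c\<bar> \<longrightarrow> g s x = 0"
proof -
  note [measurable] = components_measurable[OF f(4), of x]
  define T where "T = (\<lambda>n. (shifted c ^^ n) f)"
  have T: "T n \<in> l2 \<and> E J (T n) = T n \<and> l2_norm (T n) \<le> \<rho> ^ n * l2_norm f
      \<and> has_components (T n) (\<lambda>s x. of_real ((s - c) ^ n) * g s x)" for n
  proof (induction n)
    case 0
    then show ?case using f by (simp add: T_def)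
  next
    case (Suc n)
    have "T (Suc n) = shifted c (T n)" by (simp add: T_def)
    moreover have "l2_norm (shifted c (T n)) \<le> \<rho> * (\<rho> ^ n * l2_norm f)"
      using shifted_norm[OF _ f(2) _ bounds assms(6), of "T n"] Suc assms(6)
      by (meson less_imp_le mult_left_mono order_trans)
    ultimately show ?case
      using Suc shifted_l2[of "T n" c] shifted_invariant[OF _ f(2), of "T n" c]
        components_shifted[of "T n" "\<lambda>s x. of_real ((s - c) ^ n) * g s x" c] by (simp add: mult.assoc)
  qed
  define G where "G = (\<lambda>n s. ((s - c) / \<rho>) ^ (2 * n) * (cmod (g s x))\<^sup>2)"
  have [measurable]: "G n \<in> borel_measurable borel" for n unfolding G_def by measurable
  have "(\<integral>\<^sup>+s. ennreal (G n s) \<partial>plancherel) \<le> ennreal ((l2_norm f)\<^sup>2)" for n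
  proof -
    have "(\<integral>\<^sup>+s. ennreal (G n s) \<partial>plancherel)
        = (\<integral>\<^sup>+s. ennreal ((1 / \<rho>) ^ (2 * n)) * ennreal ((cmod (of_real ((s - c) ^ n) * g s x))\<^sup>2) \<partial>plancherel)"
    proof (rule nn_integral_cong)
      fix s
      have "G n s = (1 / \<rho>) ^ (2 * n) * (cmod (of_real ((s - c) ^ n) * g s x))\<^sup>2"
      proof -
        have "(cmod (of_real ((s - c) ^ n) * g s x))\<^sup>2 = ((s - c) ^ n)\<^sup>2 * (cmod (g s x))\<^sup>2"
          by (simp only: norm_mult norm_of_real power_mult_distrib power2_abs)
        then show ?thesis
          by (simp add: G_def power_divide power_mult[symmetric] mult.commute[of n])
      qed
      then show "ennreal (G n s) = ennreal ((1 / \<rho>) ^ (2 * n)) * ennreal ((cmod (of_real ((s - c) ^ n) * g s x))\<^sup>2)"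
        using assms(6) by (simp add: ennreal_mult)
    qed
    also have "\<dots> = ennreal ((1 / \<rho>) ^ (2 * n)) * (\<integral>\<^sup>+s. ennreal ((cmod (of_real ((s - c) ^ n) * g s x))\<^sup>2) \<partial>plancherel)"
      by (rule nn_integral_cmult) measurable
    also have "\<dots> \<le> ennreal ((1 / \<rho>) ^ (2 * n)) * ennreal ((\<rho> ^ n * l2_norm f)\<^sup>2)"
      using components_bound[of "T n" _ x] T[of n]
      by (intro mult_left_mono) (auto intro!: order_trans[OF components_bound[of "T n" _ x]] ennreal_leI power_mono)
    also have "\<dots> = ennreal ((l2_norm f)\<^sup>2)"
      using assms(6) by (simp add: ennreal_mult[symmetric] power_mult_distrib power_divide power_mult[symmetric] mult.commute[of n])
    finally show ?thesis .
  qed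
  then have "liminf (\<lambda>n. \<integral>\<^sup>+s. ennreal (G n s) \<partial>plancherel) \<le> liminf (\<lambda>n. ennreal ((l2_norm f)\<^sup>2))"
    by (intro Liminf_mono always_eventually allI)
  then have "(\<integral>\<^sup>+s. liminf (\<lambda>n. ennreal (G n s)) \<partial>plancherel) \<le> ennreal ((l2_norm f)\<^sup>2)"
    by (intro order_trans[OF nn_integral_liminf]) (auto simp: Liminf_const)
  then have "AE s in plancherel. liminf (\<lambda>n. ennreal (G n s)) \<noteq> \<infinity>"
    by (intro nn_integral_PInf_AE) (auto simp: top_unique)
  then show ?thesis
  proof eventually_elim
    case (elim s)
    show ?case
    proof (rule impI, rule ccontr)
      assume s: "\<rho> < \<bar>s - c\<bar>" "g s x \<noteq> 0"
      have "1 < \<bar>(s - c) / \<rho>\<bar>" using s(1) assms(6) by (simp add: abs_divide)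
      then have "1 < ((s - c) / \<rho>)\<^sup>2" using one_less_power[of "\<bar>(s - c) / \<rho>\<bar>" 2] by (metis pos2 power2_abs)
      then have "filterlim (\<lambda>n. (((s - c) / \<rho>)\<^sup>2) ^ n) at_top sequentially"
        using filterlim_at_infinity_imp_norm_at_top[OF filterlim_realpow_sequentially_gt1[of "((s - c) / \<rho>)\<^sup>2"]]
        by (simp add: norm_power)
      then have "filterlim (\<lambda>n. G n s) at_top sequentially"
        unfolding G_def power_mult using s(2)
        by (intro filterlim_at_top_mult_tendsto_pos[OF tendsto_const]) auto
      then have "(\<lambda>n. ennreal (G n s)) \<longlonglongrightarrow> top" by (simp add: ennreal_tendsto_top_eq_at_top)
      then have "liminf (\<lambda>n. ennreal (G n s)) = top" by (rule lim_imp_Liminf[OF sequentially_bot])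
      then show False using elim by simp
    qed
  qed
qed

lemma form_abs: "f \<in> l2 \<Longrightarrow> \<bar>Re (l2_inner (A f) f)\<bar> \<le> 6 * (l2_norm f)\<^sup>2"
  using order_trans[OF abs_Re_le_cmod A_form_bound] .

text \<open>The form bound for \<open>A\<close> closes the half line to a bounded interval, whose centre and radius are the
constants \<open>c\<close> and \<open>\<rho>\<close> of the previous lemma.\<close>

lemma components_half_line:
  assumes "f \<in> l2" "has_components f g"
  shows "E {..b} f = f \<Longrightarrow> AE s in plancherel. b < s \<longrightarrow> g s x = 0"
    and "E (- {..b}) f = f \<Longrightarrow> AE s in plancherel. s < b \<longrightarrow> g s x = 0"
proof -
  \<comment> \<open>Any bound on the form of \<open>A\<close> that exceeds \<open>\<bar>b\<bar>\<close> serves, so that both radii are positive.\<close>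
  define R where "R = 7 + \<bar>b\<bar>"
  have R: "\<bar>Re (l2_inner (A k) k)\<bar> \<le> R * (l2_norm k)\<^sup>2" if "k \<in> l2" for k
    by (rule order_trans[OF form_abs[OF that]]) (simp add: R_def mult_right_mono)
  show "AE s in plancherel. b < s \<longrightarrow> g s x = 0" if "E {..b} f = f"
  proof -
    have "AE s in plancherel. (b + R) / 2 < \<bar>s - (b - R) / 2\<bar> \<longrightarrow> g s x = 0"
    proof (rule components_vanish[OF assms(1) _ that assms(2)])
      fix k assume k: "k \<in> l2" "E {..b} k = k"
      have e: "(b - R) / 2 - (b + R) / 2 = - R" "(b - R) / 2 + (b + R) / 2 = b" by (auto simp: field_simps)
      show "((b - R) / 2 - (b + R) / 2) * (l2_norm k)\<^sup>2 \<le> Re (l2_inner (A k) k) \<and>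
         Re (l2_inner (A k) k) \<le> ((b - R) / 2 + (b + R) / 2) * (l2_norm k)\<^sup>2"
        unfolding e using R[OF k(1)] form_upper[OF k(1) _ k(2)] by simp
    qed (auto simp: R_def)
    then show ?thesis by eventually_elim (auto simp: field_simps abs_if)
  qed
  show "AE s in plancherel. s < b \<longrightarrow> g s x = 0" if "E (- {..b}) f = f"
  proof -
    have "AE s in plancherel. (R - b) / 2 < \<bar>s - (b + R) / 2\<bar> \<longrightarrow> g s x = 0"
    proof (rule components_vanish[OF assms(1) _ that assms(2)])
      fix k assume k: "k \<in> l2" "E (- {..b}) k = k"
      have e: "(b + R) / 2 - (R - b) / 2 = b" "(b + R) / 2 + (R - b) / 2 = R" by (auto simp: field_simps)
      show "((b + R) / 2 - (R - b) / 2) * (l2_norm k)\<^sup>2 \<le> Re (l2_inner (A k) k) \<and>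
         Re (l2_inner (A k) k) \<le> ((b + R) / 2 + (R - b) / 2) * (l2_norm k)\<^sup>2"
        unfolding e using R[OF k(1)] form_lower[OF k(1) _ k(2), of b] Ioi_le_Ico[of b]
        by (simp add: Compl_atMost)
    qed (auto simp: R_def)
    then show ?thesis by eventually_elim (auto simp: field_simps abs_if)
  qed
qed

text \<open>For a half line, split \<open>f\<close> into its two projections: the components of the one live to the left of
\<open>b\<close> and those of the other to the right, and the point \<open>b\<close> itself is a null set.\<close>

theorem E_eq_integral:
  assumes "f \<in> l2" "has_components f g" "I \<in> sets borel"
  shows "E I f x = (LINT s:I|plancherel. g s x)"
proof -
  have gi: "integrable plancherel (\<lambda>s. g s x)" by (rule components_integrable'[OF assms(1,2)])
  have si: "set_integrable plancherel B (\<lambda>s. g s x)" if "B \<in> sets borel" for B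
    unfolding set_integrable_def using integrable_mult_indicator[OF _ gi, of B] that by simp
  have sb: "sets (borel :: real measure) = sigma_sets UNIV (range (\<lambda>a. {..a}))"
    unfolding borel_eq_atMost by simp
  have "Int_stable (range (\<lambda>a::real. {..a}))" by (auto simp: Int_stable_def)
  moreover have "range (\<lambda>a::real. {..a}) \<subseteq> Pow UNIV" by simp
  moreover have "I \<in> sigma_sets UNIV (range (\<lambda>a::real. {..a}))" using assms(3) sb by simp
  ultimately show ?thesis
  proof (induction rule: sigma_sets_induct_disjoint)
    fix B assume "B \<in> range (\<lambda>a::real. {..a})"
    then obtain b where B: "B = {..b}" by auto
    have Bs: "{..b} \<in> sets borel" "- {..b} \<in> sets borel" by auto
    note l = E_l2[OF Bs(1) assms(1)] E_l2[OF Bs(2) assms(1)]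
    obtain g1 g2 where g: "has_components (E {..b} f) g1" "has_components (E (- {..b}) f) g2"
      using components_exists[OF l(1)] components_exists[OF l(2)] by blast
    have "has_components f (\<lambda>s x. g1 s x + g2 s x)"
      using components_lincomb[OF l g, of 1 1] E_complement[OF assms(1) Bs(1)] by simp
    then have sum: "AE s in plancherel. \<forall>x. g s x = g1 s x + g2 s x"
      by (rule components_unique[OF assms(1,2)])
    have 1: "AE s in plancherel. b < s \<longrightarrow> g1 s x = 0"
      using E_mult[OF Bs(1,1) assms(1)] by (intro components_half_line(1)[OF l(1) g(1)]) simp
    have 2: "AE s in plancherel. s < b \<longrightarrow> g2 s x = 0"
      using E_mult[OF Bs(2,2) assms(1)] by (intro components_half_line(2)[OF l(2) g(2)]) simp
    have "(LINT s:B|plancherel. g s x) = (LINT s|plancherel. g1 s x)"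
      unfolding set_lebesgue_integral_def B
    proof (rule integral_cong_AE)
      show "AE s in plancherel. indicator {..b} s *\<^sub>R g s x = g1 s x"
        using sum 1 2 AE_neq[of b] by eventually_elim (auto simp: indicator_def)
    qed (use components_measurable[OF assms(2)] components_measurable[OF g(1)] in auto)
    also have "\<dots> = E {..b} f x" by (rule components_integral[OF l(1) g(1)])
    finally show "E B f x = (LINT s:B|plancherel. g s x)" using B by simp
  next
    show "E {} f x = (LINT s:{}|plancherel. g s x)" by (simp add: E_empty[OF assms(1)] set_lebesgue_integral_def)
  next
    fix B assume B: "B \<in> sigma_sets UNIV (range (\<lambda>a::real. {..a}))" "E B f x = (LINT s:B|plancherel. g s x)"
    have Bs: "B \<in> sets borel" using B(1) sb by simp
    have "(LINT s:B|plancherel. g s x) + (LINT s:- B|plancherel. g s x) = (LINT s:B \<union> - B|plancherel. g s x)"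
      using Bs by (intro set_integral_Un[symmetric] si) auto
    also have "\<dots> = f x" using components_integral[OF assms(1,2), of x] by (simp add: set_lebesgue_integral_def)
    finally show "E (UNIV - B) f x = (LINT s:UNIV - B|plancherel. g s x)"
      using E_complement[OF assms(1) Bs, of x] B(2) by (simp add: Compl_eq_Diff_UNIV[symmetric]) (metis add_left_cancel)
  next
    fix B :: "nat \<Rightarrow> real set"
    assume B: "disjoint_family B" "range B \<subseteq> sigma_sets UNIV (range (\<lambda>a::real. {..a}))"
      "\<And>i. E (B i) f x = (LINT s:B i|plancherel. g s x)"
    have Bs: "range B \<subseteq> sets borel" using B(2) sb by simp
    have "(LINT s:(\<Union>i. B i)|plancherel. g s x) = (\<Sum>i. LINT s:B i|plancherel. g s x)"
      using Bs B(1) by (intro lebesgue_integral_countable_add si) (auto simp: disjoint_family_on_def)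
    moreover have "E (\<Union>i. B i) f x = (\<Sum>i. E (B i) f x)"
      by (rule sums_unique[OF E_sums[OF Bs B(1) assms(1)]])
    ultimately show "E (\<Union>i. B i) f x = (LINT s:(\<Union>i. B i)|plancherel. g s x)" using B(3) by simp
  qed
qed

end

section \<open>The modified mean of the spectral components\<close>

lemma mean_const_b_fun:
  assumes "s \<in> spec_interior" shows "mean_const (3 - s) * 12 * inverse (b_fun s) = 1"
proof -
  have e: "9 - (3 - s)\<^sup>2 = - s\<^sup>2 + 6 * s" "8 - (3 - s)\<^sup>2 = - s\<^sup>2 + 6 * s - 1"
    by (simp_all add: power2_eq_square algebra_simps)
  have "8 * q = 2 / 3 * q * 12" for q :: real by simp
  then have "b_fun s = mean_const (3 - s) * 12" unfolding mean_const_def e b_fun_def .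
  moreover have "mean_const (3 - s) \<noteq> 0" using assms by (simp add: spec_interior_iff mean_const_def)
  ultimately show ?thesis by simp
qed

lemma complex_density_unique:
  fixes u v :: "real \<Rightarrow> complex"
  assumes "integrable plancherel u" "integrable plancherel v"
    and "\<And>I. I \<in> sets borel \<Longrightarrow> (LINT s:I|plancherel. u s) = (LINT s:I|plancherel. v s)"
  shows "AE s in plancherel. u s = v s"
proof -
  have si: "integrable plancherel (\<lambda>s. indicator I s *\<^sub>R w s)"
    if "I \<in> sets borel" "integrable plancherel w" for I and w :: "real \<Rightarrow> complex"
    using integrable_mult_indicator[OF _ that(2), of I] that(1) by simp
  have Re: "(LINT s:I|plancherel. Re (w s)) = Re (LINT s:I|plancherel. w s)"
    and Im: "(LINT s:I|plancherel. Im (w s)) = Im (LINT s:I|plancherel. w s)"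
    if "I \<in> sets borel" "integrable plancherel w" for I and w :: "real \<Rightarrow> complex"
    unfolding set_lebesgue_integral_def
    using integral_Re[OF si[OF that]] integral_Im[OF si[OF that]] by simp_all
  have "AE s in plancherel. Re (u s) = Re (v s)"
    by (rule density_unique_real) (use assms Re in auto)
  moreover have "AE s in plancherel. Im (u s) = Im (v s)"
    by (rule density_unique_real) (use assms Im in auto)
  ultimately show ?thesis by eventually_elim (simp add: complex_eq_iff)
qed

context spectral_tree
begin

lemma components_spectral_density:
  assumes "f \<in> l2" "has_components f g" shows "is_spectral_density E f g"
  unfolding is_spectral_density_def
proof (intro allI conjI ballI impI)
  have S: "Sigma_spec \<in> sets plancherel" by (simp add: Sigma_spec_def)
  show "set_integrable plancherel Sigma_spec (\<lambda>s. g s x)" for x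
    unfolding set_integrable_def by (rule integrable_mult_indicator[OF S components_integrable'[OF assms]])
qed (rule E_eq_integral[OF assms])

text \<open>Densities are unique up to a null set for each vertex, and there are only countably many vertices.\<close>

lemma spectral_density_unique:
  assumes "is_spectral_density E f g" "is_spectral_density E f g'"
  shows "AE s in plancherel. \<forall>x. g s x = g' s x"
proof (rule AE_all_vertices)
  fix x
  have S: "Sigma_spec \<in> sets borel" by (simp add: Sigma_spec_def)
  have int: "integrable plancherel (\<lambda>s. indicator Sigma_spec s *\<^sub>R k s x)"
    if "is_spectral_density E f k" for k
    using that by (auto simp: is_spectral_density_def set_integrable_def)
  have "(LINT s:I|plancherel. indicator Sigma_spec s *\<^sub>R k s x) = E (I \<inter> Sigma_spec) f x"
    if "is_spectral_density E f k" "I \<in> sets borel" for k I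
  proof -
    have "(LINT s:I|plancherel. indicator Sigma_spec s *\<^sub>R k s x) = (LINT s:I \<inter> Sigma_spec|plancherel. k s x)"
      unfolding set_lebesgue_integral_def
      by (intro Bochner_Integration.integral_cong) (auto simp: indicator_def)
    also have "\<dots> = E (I \<inter> Sigma_spec) f x"
      using that S unfolding is_spectral_density_def by (metis inf_le2 sets.Int)
    finally show ?thesis .
  qed
  then have "AE s in plancherel. indicator Sigma_spec s *\<^sub>R g s x = indicator Sigma_spec s *\<^sub>R g' s x"
    by (intro complex_density_unique int assms) (simp add: assms)
  then show "AE s in plancherel. g s x = g' s x"
    using AE_spec_interior by eventually_elim (use spec_interior_subset in \<open>auto simp: indicator_def\<close>)
qed

text \<open>The measurability clause does not follow from the almost everywhere equality, because the
Plancherel measure is not complete.\<close>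

lemma spec_comp_components:
  assumes "f \<in> l2"
  obtains g where "has_components f g" "AE s in plancherel. spec_comp adj E s f = g s"
    "\<And>x. (\<lambda>s. indicator Sigma_spec s *\<^sub>R spec_comp adj E s f x) \<in> borel_measurable borel"
proof (cases "finite {y. f y \<noteq> 0}")
  case True
  have eq: "spec_comp adj E s f x = component s f x" if "s \<in> spec_interior" for s x
    using True that by (simp add: spec_comp_def component_def spherical_lam_inv)
  have "AE s in plancherel. spec_comp adj E s f = component s f"
    using AE_spec_interior by eventually_elim (auto simp: eq)
  moreover have "(\<lambda>s. indicator Sigma_spec s *\<^sub>R spec_comp adj E s f x) \<in> borel_measurable borel" for x
  proof -
    \<comment> \<open>At the two endpoints \<open>lam_inv\<close> has no meaningful value, but single points are measurable.\<close>
    define lo hi where "lo = 3 - 2 * sqrt (2::real)" and "hi = 3 + 2 * sqrt (2::real)"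
    have lohi: "lo < hi" by (simp add: lo_def hi_def)
    have "indicator Sigma_spec s *\<^sub>R spec_comp adj E s f x
        = indicator spec_interior s *\<^sub>R component s f x + indicator {lo} s *\<^sub>R spec_comp adj E lo f x
          + indicator {hi} s *\<^sub>R spec_comp adj E hi f x" for s
    proof -
      consider "s \<in> spec_interior" | "s = lo" | "s = hi" | "s \<notin> Sigma_spec"
        by (fastforce simp: Sigma_spec_def spec_interior_def lo_def hi_def)
      then show ?thesis
        using lohi eq[of s x] spec_interior_subset
        by cases (auto simp: indicator_def spec_interior_def Sigma_spec_def lo_def hi_def)
    qed
    moreover have "spec_interior \<in> sets borel" by (simp add: spec_interior_def)
    ultimately show ?thesis by simp
  qed
  ultimately show ?thesis using that[OF components_finite[OF True]] by blast
next
  case False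
  obtain g where g: "has_components f g" using components_exists[OF assms] by blast
  define k where "k = (SOME k. is_spectral_density E f k)"
  have k: "is_spectral_density E f k"
    unfolding k_def by (rule someI[where P = "is_spectral_density E f", OF components_spectral_density[OF assms g]])
  have eq: "spec_comp adj E s f = k s" for s
    using False by (auto simp: spec_comp_def k_def)
  have "AE s in plancherel. spec_comp adj E s f = g s"
    using spectral_density_unique[OF k components_spectral_density[OF assms g]]
    by eventually_elim (auto simp: eq)
  moreover have "(\<lambda>s. indicator Sigma_spec s *\<^sub>R spec_comp adj E s f x) \<in> borel_measurable borel" for x
  proof -
    have "integrable plancherel (\<lambda>s. indicator Sigma_spec s *\<^sub>R k s x)"
      using k by (auto simp: is_spectral_density_def set_integrable_def)
    then show ?thesis using borel_measurable_integrable by (simp add: eq)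
  qed
  ultimately show ?thesis using that[OF g] by blast
qed

theorem modified_mean_parseval:
  assumes "f \<in> l2"
  shows "AE s in plancherel. convergent (ball_average adj x0 (spec_comp adj E s f))"
    and "set_integrable plancherel Sigma_spec
           (\<lambda>s. modified_mean adj x0 (spec_comp adj E s f) * 12 * inverse (b_fun s))"
    and "(LINT s:Sigma_spec|plancherel.
            modified_mean adj x0 (spec_comp adj E s f) * 12 * inverse (b_fun s)) = (l2_norm f)\<^sup>2"
proof -
  obtain g where g: "has_components f g" "AE s in plancherel. spec_comp adj E s f = g s"
    and meas: "\<And>x. (\<lambda>s. indicator Sigma_spec s *\<^sub>R spec_comp adj E s f x) \<in> borel_measurable borel"
    using spec_comp_components[OF assms] by metis
  define m where "m = (\<lambda>s. enn2real (mean_norm x0 s (g s)))"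
  note parseval = components_parseval[OF assms g(1), of x0]
  have norm_meas: "(\<lambda>s. mean_norm x0 s (g s)) \<in> borel_measurable borel"
    by (rule mean_norm_measurable[OF components_measurable[OF g(1)]])
  then have m_meas [measurable]: "m \<in> borel_measurable borel" unfolding m_def by measurable
  have lim: "AE s in plancherel. ball_average adj x0 (spec_comp adj E s f) \<longlonglongrightarrow> mean_const (3 - s) * m s"
    using parseval(2) g(2) by eventually_elim (simp add: has_mean_def m_def)
  then show "AE s in plancherel. convergent (ball_average adj x0 (spec_comp adj E s f))"
    by eventually_elim (rule convergentI)
  let ?w = "\<lambda>s. indicator Sigma_spec s *\<^sub>R
      (modified_mean adj x0 (spec_comp adj E s f) * 12 * inverse (b_fun s))"
  have AE_eq: "AE s in plancherel. ?w s = m s"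
    using lim AE_spec_interior
  proof eventually_elim
    case (elim s)
    have "modified_mean adj x0 (spec_comp adj E s f) = mean_const (3 - s) * m s"
      unfolding modified_mean_def by (rule limI[OF elim(1)])
    then have "modified_mean adj x0 (spec_comp adj E s f) * 12 * inverse (b_fun s)
        = m s * (mean_const (3 - s) * 12 * inverse (b_fun s))" by simp
    then show ?case
      using elim(2) spec_interior_subset mean_const_b_fun[OF elim(2)] by (auto simp: indicator_def)
  qed
  have w_meas: "?w \<in> borel_measurable borel"
  proof -
    \<comment> \<open>The indicator can be moved inside the mean, where it makes the function measurable; the limit
      operator preserves measurability even where the averages diverge.\<close>
    define k where "k = (\<lambda>s x. indicator Sigma_spec s *\<^sub>R spec_comp adj E s f x)"
    have [measurable]: "(\<lambda>s. k s x) \<in> borel_measurable borel" for x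
      unfolding k_def by (rule meas)
    have [measurable]: "Sigma_spec \<in> sets borel" by (simp add: Sigma_spec_def)
    have "?w = (\<lambda>s. indicator Sigma_spec s *\<^sub>R
        (lim (\<lambda>N. 1 / real N * (\<Sum>x | d x x0 \<le> N. (cmod (k s x))\<^sup>2)) * 12 * inverse (b_fun s)))"
      by (auto simp: fun_eq_iff k_def indicator_def modified_mean_def ball_average_def[abs_def])
    moreover have "\<dots> \<in> borel_measurable borel" unfolding b_fun_def by measurable
    ultimately show ?thesis by simp
  qed
  have fin: "AE s in plancherel. mean_norm x0 s (g s) \<noteq> \<infinity>"
    by (rule nn_integral_PInf_AE) (use norm_meas parseval(1) in auto)
  have nn: "(\<integral>\<^sup>+s. ennreal (m s) \<partial>plancherel) = ennreal ((l2_norm f)\<^sup>2)"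
    unfolding parseval(1)[symmetric]
    by (rule nn_integral_cong_AE, use fin in eventually_elim) (simp add: m_def less_top)
  have m_int: "integrable plancherel m"
  proof (rule integrableI_nonneg)
    show "AE s in plancherel. 0 \<le> m s" by (simp add: m_def)
  qed (use nn in auto)
  have m_eq: "(LINT s|plancherel. m s) = (l2_norm f)\<^sup>2"
  proof (subst integral_eq_nn_integral)
    show "AE s in plancherel. 0 \<le> m s" by (simp add: m_def)
  qed (auto simp: nn)
  show "set_integrable plancherel Sigma_spec
           (\<lambda>s. modified_mean adj x0 (spec_comp adj E s f) * 12 * inverse (b_fun s))"
    unfolding set_integrable_def using w_meas m_int AE_eq
    by (subst integrable_cong_AE[where g = m]) auto
  have "(LINT s|plancherel. ?w s) = (LINT s|plancherel. m s)"
    by (rule integral_cong_AE) (use w_meas AE_eq in auto)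
  then show "(LINT s:Sigma_spec|plancherel.
            modified_mean adj x0 (spec_comp adj E s f) * 12 * inverse (b_fun s)) = (l2_norm f)\<^sup>2"
    unfolding set_lebesgue_integral_def m_eq .
qed

end

theorem corollary4p19:
  fixes adj :: "'v \<Rightarrow> 'v \<Rightarrow> bool" and x0 :: 'v
    and E :: "real set \<Rightarrow> ('v \<Rightarrow> complex) \<Rightarrow> 'v \<Rightarrow> complex"
    and f :: "'v \<Rightarrow> complex"
  assumes "regular_tree 3 adj"
    and "spectral_resolution (neg_laplacian adj) E"
    and "f \<in> l2"
  shows "(AE s in plancherel. s \<in> Sigma_spec \<longrightarrow>
            convergent (ball_average adj x0 (spec_comp adj E s f))) \<and>
         set_integrable plancherel Sigma_spec
           (\<lambda>s. modified_mean adj x0 (spec_comp adj E s f) * 12 * inverse (b_fun s)) \<and>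
         (l2_norm f)\<^sup>2 =
           (LINT s:Sigma_spec|plancherel.
              modified_mean adj x0 (spec_comp adj E s f) * 12 * inverse (b_fun s))"
proof -
  interpret spectral_tree adj E by unfold_locales (use assms in auto)
  have "AE s in plancherel. s \<in> Sigma_spec \<longrightarrow> convergent (ball_average adj x0 (spec_comp adj E s f))"
    using modified_mean_parseval(1)[OF assms(3), of x0] by eventually_elim simp
  then show ?thesis
    using modified_mean_parseval(2,3)[OF assms(3), of x0] by simp
qed

end
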